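(* Let $n$ be a positive integer and let $X$ be a random vector valued in $\mathbb{R}^n$ with (invertible) covariance matrix $\Sigma=\mathbb{E}XX^T$. Assume that for some $C,\eta>0$ the isotropic random vector $Z=\Sigma^{-1/2}X$ satisfies, for every orthogonal projection $P$ in $\mathbb{R}^n$, $$\mathbb{P}\{\|PZ\|_2^2>t\}\le C\,t^{-1-\eta}\quad\text{for all } t>C\,\mathrm{rank}(P).$$ Then, for every $\varepsilon\in(0,1)$ and every positive integer $$N\ge C_{\mathrm{main}}\,\varepsilon^{-2-2/\eta}\cdot n,\qquad C_{\mathrm{main}}=512\,(48C)^{2+2/\eta}(6+6/\eta)^{1+4/\eta},$$ the sample covariance matrix $\Sigma_N=\frac1N\sum_{i=1}^N X_iX_i^T$ obtained from $N$ independent copies $X_1,\dots,X_N$ of $X$ satisfies $$\mathbb{E}\|\Sigma_N-\Sigma\|\le\varepsilon\|\Sigma\|.$$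
   Context: The covariance matrix of $X$ is taken to be the $n\times n$ positive semidefinite matrix $\Sigma=\mathbb{E}XX^T$ (centering of $X$ is not needed). A random vector $Z$ in $\mathbb{R}^n$ is isotropic if $\mathbb{E}ZZ^T=I$. $\|\cdot\|$ denotes the spectral (operator) norm of a matrix and $\|\cdot\|_2$ the Euclidean norm. *)

theory Defs
  imports "HOL-Analysis.Analysis" "HOL-Probability.Probability"
begin

text \<open>The matrix $x x^T$.\<close>

definition outer :: "real ^ 'n \<Rightarrow> real ^ 'n ^ 'n" where
  "outer x = (\<chi> i j. x $ i * x $ j)"

text \<open>The (uncentered) covariance matrix $E X X^T$, as a matrix-valued Bochner integral; meaningful only
  if \<open>\<lambda>\<omega>. outer (X \<omega>)\<close> is integrable.\<close>

definition cov_matrix :: "'a measure \<Rightarrow> ('a \<Rightarrow> real ^ 'n) \<Rightarrow> real ^ 'n ^ 'n" where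
  "cov_matrix M X = (\<integral>\<omega>. outer (X \<omega>) \<partial>M)"

definition sample_cov :: "nat \<Rightarrow> (nat \<Rightarrow> 'a \<Rightarrow> real ^ 'n) \<Rightarrow> 'a \<Rightarrow> real ^ 'n ^ 'n" where
  "sample_cov N Y \<omega> = (1 / real N) *\<^sub>R (\<Sum>i=1..N. outer (Y i \<omega>))"

text \<open>The instance \<open>norm\<close> on \<open>real ^ 'n ^ 'n\<close> is the Frobenius norm, not the spectral norm.\<close>

definition spectral_norm :: "real ^ 'n ^ 'm \<Rightarrow> real" where
  "spectral_norm A = onorm (\<lambda>x. A *v x)"

definition pos_semidef :: "real ^ 'n ^ 'n \<Rightarrow> bool" where
  "pos_semidef A \<longleftrightarrow> transpose A = A \<and> (\<forall>x. 0 \<le> x \<bullet> (A *v x))"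

text \<open>A positive semidefinite matrix has exactly one positive semidefinite square root.\<close>

definition matrix_sqrt :: "real ^ 'n ^ 'n \<Rightarrow> real ^ 'n ^ 'n" where
  "matrix_sqrt A = (THE B. pos_semidef B \<and> B ** B = A)"

definition orthogonal_projection :: "real ^ 'n ^ 'n \<Rightarrow> bool" where
  "orthogonal_projection P \<longleftrightarrow> P ** P = P \<and> transpose P = P"

end

theory Submission
  imports Defs
begin

text \<open>
  The sample covariance matrix is controlled by a randomised barrier argument in the style of Batson,
  Spielman and Srivastava. In isotropic position the partial sums \<open>A\<close> of the matrices \<open>x x^T\<close> are kept
  below \<open>u I\<close> and above \<open>l I\<close>, while the traces of \<open>(u I - A)^{-1}\<close> and \<open>(A - l I)^{-1}\<close> stay at most
  \<open>\<phi>\<close>. By the Sherman--Morrison formula a new vector \<open>x\<close> needs an upper shift, and admits a lower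
  shift, given by normalised weighted sums of the squared coordinates of \<open>x\<close>. Their expectation is one
  up to an error that the regularity of the projections controls with the full exponent \<open>\<eta>\<close>, because
  tail integrals are convex. Iterating over \<open>N\<close> independent vectors bounds \<open>\<lambda>_max / N - 1\<close> and
  \<open>1 - \<lambda>_min / N\<close> in expectation. Their maximum is at most their sum plus the
  deviation of the normalised trace, which is small by truncation and a variance bound.
\<close>

section \<open>Symmetric matrices in an orthonormal eigenbasis\<close>

text \<open>The exponent of \<epsilon> balances two costs. Both barriers start from
  \<open>mat (n * \<theta>)\<close>, whose inverse has trace \<open>1 / \<theta>\<close>; this
  offset finally costs \<open>n * \<theta> / N\<close>. A potential of at most
  \<open>1 / \<theta>\<close> in turn keeps every eigenvalue of the barrier matrix at least
  \<theta>, so a vector is absorbed with relative error of order \<open>h\<close> unless it is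
  exceptional at scale \<open>h * \<theta> = 4 * s\<close>. Exceptional vectors have probability of
  order \<open>s powr (- 1 - \<eta>)\<close> and force jumps of order \<theta> or more, at an
  average cost of order \<open>s powr (- \<eta>) / h\<close>. With \<open>h\<close> of order
  \<epsilon> this is of order \<epsilon> once \<open>s\<close> has order
  \<open>\<epsilon> powr (- (2 / \<eta>))\<close>; then \<theta> has order
  \<open>s / \<epsilon>\<close> and \<open>N\<close> has order
  \<open>n * s / \<epsilon>\<^sup>2\<close>. The shifts are random, but the bound on the potential
  is kept almost surely, so one estimate in expectation serves every step. Bounds on two
  expectations do not bound the expected maximum, because the smaller quantity might be very
  negative; the trace, an average over all eigenvalues, excludes this.\<close>

lemma symmetric_matrix_inner:
  fixes A :: "real ^ 'n ^ 'n"
  assumes "transpose A = A"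
  shows "(A *v x) \<bullet> y = x \<bullet> (A *v y)"
  by (metis assms dot_lmul_matrix transpose_matrix_vector)

text \<open>A maximiser of the quadratic form on the unit sphere of \<open>V\<close> is an
  eigenvector: the residual \<open>r\<close> of the eigenvalue equation lies in \<open>V\<close>,
  and moving from \<open>x\<close> towards \<open>r\<close> would raise the form above its maximum
  unless \<open>r = 0\<close>.\<close>

lemma symmetric_eigenvector:
  fixes A :: "real ^ 'n ^ 'n"
  assumes sym: "transpose A = A" and sub: "subspace V" and inv: "\<And>x. x \<in> V \<Longrightarrow> A *v x \<in> V"
    and nz: "V \<noteq> {0}"
  obtains x c where "x \<in> V" "norm x = 1" "A *v x = c *\<^sub>R x"
proof -
  have "closed V" using sub by (rule closed_subspace)
  then have comp: "compact (sphere 0 1 \<inter> V)" by (intro compact_Int_closed) auto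
  obtain v where v: "v \<in> V" "v \<noteq> 0" using nz subspace_0[OF sub] by auto
  then have "v /\<^sub>R norm v \<in> sphere 0 1 \<inter> V"
    using sub by (auto simp: subspace_scale)
  then have ne: "sphere 0 1 \<inter> V \<noteq> {}" by blast
  have "continuous_on (sphere 0 1 \<inter> V) (\<lambda>x. x \<bullet> (A *v x))"
    by (intro continuous_intros)
  from continuous_attains_sup[OF comp ne this] obtain x where
    x: "x \<in> V" "norm x = 1" and mx: "\<And>y. y \<in> V \<Longrightarrow> norm y = 1 \<Longrightarrow> y \<bullet> (A *v y) \<le> x \<bullet> (A *v x)"
    by auto
  define c where "c = x \<bullet> (A *v x)"
  define q where "q v = c * (v \<bullet> v) - v \<bullet> (A *v v)" for v
  have q: "q v \<ge> 0" if "v \<in> V" for v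
  proof (cases "v = 0")
    case False
    have "(v /\<^sub>R norm v) \<bullet> (A *v (v /\<^sub>R norm v)) \<le> c"
      unfolding c_def using False that sub by (intro mx) (auto simp: subspace_scale)
    then have "(v \<bullet> (A *v v)) / (norm v)\<^sup>2 \<le> c"
      by (simp add: matrix_vector_mult_scaleR power2_eq_square field_simps)
    then show ?thesis using False
      by (simp add: q_def divide_le_eq power2_norm_eq_inner[symmetric])
  qed (simp add: q_def)
  define r where "r = A *v x - c *\<^sub>R x"
  have rV: "r \<in> V" unfolding r_def using sub inv x by (simp add: subspace_diff subspace_scale)
  have qx: "q x = 0" using x by (simp add: q_def c_def power2_norm_eq_inner[symmetric])
  have exp: "q (x + t *\<^sub>R r) = t\<^sup>2 * q r - 2 * t * (r \<bullet> r)" for t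
  proof -
    have 1: "x \<bullet> (A *v r) = r \<bullet> (A *v x)" by (metis sym symmetric_matrix_inner inner_commute)
    have 2: "r \<bullet> (A *v x) = r \<bullet> r + c * (r \<bullet> x)" unfolding r_def by (simp add: inner_simps)
    have "q (x + t *\<^sub>R r) = q x + 2 * t * (c * (r \<bullet> x) - r \<bullet> (A *v x)) + t\<^sup>2 * q r"
      unfolding q_def matrix_vector_right_distrib matrix_vector_mult_scaleR
      using 1 by (simp add: inner_add_left inner_add_right inner_commute power2_eq_square algebra_simps)
    then show ?thesis using qx 2 by (simp add: algebra_simps)
  qed
  have "r \<bullet> r = 0"
  proof (rule ccontr)
    assume "r \<bullet> r \<noteq> 0"
    then have rr: "r \<bullet> r > 0" by simp
    have qr: "q r \<ge> 0" using q rV by auto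
    \<comment> \<open>Small enough for the linear term \<open>2 * t * (r \<bullet> r)\<close> to
      beat the quadratic one; the \<open>+ 1\<close> covers \<open>q r = 0\<close>.\<close>
    define t where "t = (r \<bullet> r) / (q r + 1)"
    have t: "t > 0" using rr qr by (simp add: t_def)
    have "t * q r \<le> r \<bullet> r" using qr rr by (simp add: t_def field_simps)
    then have "t * (t * q r) < t * (2 * (r \<bullet> r))" using t rr by (intro mult_strict_left_mono) linarith+
    then have "q (x + t *\<^sub>R r) < 0" unfolding exp by (simp add: power2_eq_square algebra_simps)
    moreover have "q (x + t *\<^sub>R r) \<ge> 0" using q rV x sub by (simp add: subspace_add subspace_scale)
    ultimately show False by simp
  qed
  then have "A *v x = c *\<^sub>R x" by (simp add: r_def)
  with x show ?thesis by (rule that)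
qed

text \<open>Indexing by the type \<open>'n\<close> itself makes every such family a basis, and lets
  eigenvalues with multiplicity be a function on the same index type.\<close>

definition orthonormal_family :: "('n \<Rightarrow> real ^ 'n) \<Rightarrow> bool" where
  "orthonormal_family e \<longleftrightarrow> (\<forall>i j. e i \<bullet> e j = (if i = j then 1 else 0))"

text \<open>For an orthonormal family this is a diagonalised matrix: sums, products and inverses act
  pointwise on the eigenvalues \<open>w\<close>.\<close>

definition eigen_matrix :: "('n \<Rightarrow> real ^ 'n) \<Rightarrow> ('n \<Rightarrow> real) \<Rightarrow> real ^ 'n ^ 'n" where
  "eigen_matrix e w = (\<Sum>i\<in>UNIV. w i *\<^sub>R outer (e i))"

text \<open>The orthogonal complement of a set of eigenvectors is invariant under a symmetric
  matrix, and it is nonzero while fewer than \<open>CARD('n)\<close> vectors have been found, so it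
  contains a further eigenvector.\<close>

lemma orthonormal_eigenvectors:
  fixes A :: "real ^ 'n ^ 'n"
  assumes sym: "transpose A = A" and "k \<le> CARD('n)"
  shows "\<exists>E. finite E \<and> card E = k \<and> pairwise orthogonal E \<and> (\<forall>x\<in>E. norm x = 1 \<and> (\<exists>c. A *v x = c *\<^sub>R x))"
  using assms(2)
proof (induction k)
  case 0
  show ?case by (intro exI[of _ "{}"]) auto
next
  case (Suc k)
  then obtain E where E: "finite E" "card E = k" "pairwise orthogonal E"
    "\<And>x. x \<in> E \<Longrightarrow> norm x = 1" "\<And>x. x \<in> E \<Longrightarrow> \<exists>c. A *v x = c *\<^sub>R x" by auto
  define V where "V = {x. \<forall>e\<in>E. orthogonal e x}"
  have "dim (span E) < DIM(real^'n)"
    using dim_le_card'[OF E(1)] E(2) Suc.prems by simp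
  then have "span E \<noteq> UNIV" by (metis dim_UNIV less_irrefl)
  then have "span E \<subset> span UNIV" by (simp add: psubset_eq)
  then obtain y where "y \<noteq> 0" "\<And>x. x \<in> span E \<Longrightarrow> orthogonal y x"
    using orthogonal_to_subspace_exists_gen[of E UNIV] by blast
  then have yV: "y \<in> V" "y \<noteq> 0" by (auto simp: V_def orthogonal_commute span_base)
  have sub: "subspace V" unfolding V_def by (rule subspace_orthogonal_to_vectors)
  have inv: "A *v x \<in> V" if "x \<in> V" for x
    unfolding V_def
  proof safe
    fix e assume e: "e \<in> E"
    obtain c where c: "A *v e = c *\<^sub>R e" using E(5)[OF e] by auto
    have "e \<bullet> (A *v x) = (A *v e) \<bullet> x" using symmetric_matrix_inner[OF sym] by metis
    also have "\<dots> = 0" using that e by (simp add: c V_def orthogonal_def)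
    finally show "orthogonal e (A *v x)" by (simp add: orthogonal_def)
  qed
  obtain x c where x: "x \<in> V" "norm x = 1" "A *v x = c *\<^sub>R x"
    using symmetric_eigenvector[OF sym sub inv] yV by blast
  have "x \<notin> E" using x by (auto simp: V_def orthogonal_def)
  moreover have "pairwise orthogonal (insert x E)"
    using E(3) x(1) by (auto simp: V_def pairwise_insert orthogonal_commute)
  ultimately show ?case using E x by (intro exI[of _ "insert x E"]) auto
qed

lemma orthonormal_family_expand:
  fixes e :: "'n \<Rightarrow> real ^ 'n"
  assumes e: "orthonormal_family e"
  shows "x = (\<Sum>i\<in>UNIV. (x \<bullet> e i) *\<^sub>R e i)"
proof -
  have inj: "inj e"
  proof
    fix i j assume "e i = e j"
    then show "i = j" using e unfolding orthonormal_family_def by (metis zero_neq_one)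
  qed
  have orth: "pairwise orthogonal (range e)" using e
    by (auto simp: pairwise_def orthogonal_def orthonormal_family_def)
  have n0: "0 \<notin> range e" using e unfolding orthonormal_family_def
    by (metis imageE inner_zero_left zero_neq_one)
  have "independent (range e)" using orth n0 by (rule pairwise_orthogonal_independent)
  moreover have "card (range e) = DIM(real^'n)" using inj by (simp add: card_image)
  ultimately have "UNIV \<subseteq> span (range e)"
    by (intro card_ge_dim_independent) auto
  then have "span (range e) = UNIV" by auto
  have "norm b = 1" if "b \<in> range e" for b
    using that e by (auto simp: orthonormal_family_def norm_eq_1)
  then have "x = (\<Sum>b\<in>range e. (x \<bullet> b) *\<^sub>R b)"
    using orthonormal_basis_expand[of "range e" x] orth \<open>span (range e) = UNIV\<close> by simp
  also have "\<dots> = (\<Sum>i\<in>UNIV. (x \<bullet> e i) *\<^sub>R e i)"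
    by (subst sum.reindex[OF inj]) simp
  finally show ?thesis .
qed

lemma inner_orthonormal_family:
  assumes e: "orthonormal_family e"
  shows "x \<bullet> y = (\<Sum>i\<in>UNIV. (x \<bullet> e i) * (y \<bullet> e i))"
proof -
  have "x \<bullet> y = (\<Sum>i\<in>UNIV. (x \<bullet> e i) *\<^sub>R e i) \<bullet> y"
    using orthonormal_family_expand[OF e, of x] by simp
  also have "\<dots> = (\<Sum>i\<in>UNIV. (x \<bullet> e i) * (y \<bullet> e i))"
    by (simp add: inner_sum_left inner_sum_right inner_commute[of _ y])
  finally show ?thesis .
qed

lemma norm_orthonormal_family:
  assumes e: "orthonormal_family e"
  shows "(norm x)\<^sup>2 = (\<Sum>i\<in>UNIV. (x \<bullet> e i)\<^sup>2)"
  unfolding power2_norm_eq_inner inner_orthonormal_family[OF e, of x x] by (simp add: power2_eq_square)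

lemma orthonormal_family_eqI:
  assumes e: "orthonormal_family e" and "\<And>i. x \<bullet> e i = y \<bullet> e i"
  shows "x = y"
  using orthonormal_family_expand[OF e, of x] orthonormal_family_expand[OF e, of y] assms(2) by simp

section \<open>Outer products and matrices diagonal in a fixed orthonormal basis\<close>

lemma outer_mult: "outer x *v y = (x \<bullet> y) *\<^sub>R x"
  by (simp add: outer_def vec_eq_iff matrix_vector_mult_def inner_vec_def sum_distrib_left mult_ac)

lemma transpose_outer: "transpose (outer x) = outer x"
  by (simp add: outer_def transpose_def vec_eq_iff mult.commute)

lemma trace_outer: "trace (outer x) = x \<bullet> x"
  by (simp add: trace_def outer_def inner_vec_def)

lemma transpose_add: "transpose (A + B) = transpose A + transpose (B :: real^'n^'m)"
  by (simp add: transpose_def vec_eq_iff)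

lemma transpose_diff: "transpose (A - B) = transpose A - transpose (B :: real^'n^'m)"
  by (simp add: transpose_def vec_eq_iff)

lemma transpose_scaleR: "transpose (c *\<^sub>R A) = c *\<^sub>R transpose (A :: real^'n^'m)"
  by (simp add: transpose_def vec_eq_iff)

lemma transpose_sum: "transpose (sum f S) = (\<Sum>i\<in>S. transpose (f i :: real^'n^'m))"
  by (induction S rule: infinite_finite_induct) (auto simp: transpose_add, simp_all add: transpose_def vec_eq_iff)

lemma matrix_vector_mult_sum: "sum f S *v x = (\<Sum>i\<in>S. (f i :: real^'n^'m) *v x)"
  by (induction S rule: infinite_finite_induct) (auto simp: matrix_vector_mult_add_rdistrib)

lemma trace_sum: "trace (sum f S) = (\<Sum>i\<in>S. trace (f i :: real^'n^'n))"
  by (induction S rule: infinite_finite_induct) (auto simp: trace_add, auto simp: trace_def)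

lemma trace_scaleR: "trace (c *\<^sub>R A) = c * trace (A :: real^'n^'n)"
  by (simp add: trace_def sum_distrib_left)

lemma eigen_matrix_mult: "eigen_matrix e w *v x = (\<Sum>i\<in>UNIV. (w i * (x \<bullet> e i)) *\<^sub>R e i)"
  by (simp add: eigen_matrix_def matrix_vector_mult_sum scaleR_matrix_vector_assoc[symmetric] outer_mult inner_commute)

lemma inner_eigen_matrix:
  assumes e: "orthonormal_family e"
  shows "(eigen_matrix e w *v x) \<bullet> e i = w i * (x \<bullet> e i)"
proof -
  have "(eigen_matrix e w *v x) \<bullet> e i = (\<Sum>j\<in>UNIV. w j * (x \<bullet> e j) * (if j = i then 1 else 0))"
    using e unfolding eigen_matrix_mult orthonormal_family_def by (simp add: inner_sum_left)
  also have "\<dots> = w i * (x \<bullet> e i)" by (simp add: if_distrib cong: if_cong)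
  finally show ?thesis .
qed

lemma transpose_eigen_matrix: "transpose (eigen_matrix e w) = eigen_matrix e w"
  by (simp add: eigen_matrix_def transpose_sum transpose_scaleR transpose_outer)

lemma trace_eigen_matrix:
  assumes e: "orthonormal_family e"
  shows "trace (eigen_matrix e w) = (\<Sum>i\<in>UNIV. w i)"
  using e by (simp add: eigen_matrix_def trace_sum trace_scaleR trace_outer orthonormal_family_def)

lemma eigen_matrix_compose:
  assumes e: "orthonormal_family e"
  shows "eigen_matrix e w ** eigen_matrix e v = eigen_matrix e (\<lambda>i. w i * v i)"
  unfolding matrix_eq
  by (intro allI orthonormal_family_eqI[OF e])
     (simp add: matrix_vector_mul_assoc[symmetric] inner_eigen_matrix[OF e])

lemma eigen_matrix_one:
  assumes e: "orthonormal_family e"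
  shows "eigen_matrix e (\<lambda>_. 1) = mat 1"
  unfolding matrix_eq
  by (intro allI orthonormal_family_eqI[OF e]) (simp add: inner_eigen_matrix[OF e])

lemma eigen_matrix_const:
  assumes e: "orthonormal_family e"
  shows "eigen_matrix e (\<lambda>_. c) = mat c"
proof -
  have "eigen_matrix e (\<lambda>_. c) = c *\<^sub>R eigen_matrix e (\<lambda>_. 1)"
    by (simp add: eigen_matrix_def scaleR_sum_right)
  also have "\<dots> = mat c" unfolding eigen_matrix_one[OF e] by (simp add: mat_def vec_eq_iff)
  finally show ?thesis .
qed

lemma eigen_matrix_add: "eigen_matrix e w + eigen_matrix e v = eigen_matrix e (\<lambda>i. w i + v i)"
  by (simp add: eigen_matrix_def sum.distrib scaleR_add_left)

lemma quadratic_eigen_matrix: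
  assumes e: "orthonormal_family e"
  shows "x \<bullet> (eigen_matrix e w *v x) = (\<Sum>i\<in>UNIV. w i * (x \<bullet> e i)\<^sup>2)"
  by (subst inner_orthonormal_family[OF e]) (simp add: inner_eigen_matrix[OF e] power2_eq_square mult_ac)

lemma eigen_matrix_eigenvector:
  assumes e: "orthonormal_family e"
  shows "eigen_matrix e w *v e i = w i *\<^sub>R e i"
  using e by (intro orthonormal_family_eqI[OF e])
    (auto simp: inner_eigen_matrix[OF e] orthonormal_family_def)

theorem spectral_theorem_symmetric:
  fixes A :: "real ^ 'n ^ 'n"
  assumes sym: "transpose A = A"
  obtains e w where "orthonormal_family e" "A = eigen_matrix e w"
proof -
  obtain E where E: "finite E" "card E = CARD('n)" "pairwise orthogonal E"
    "\<And>x. x \<in> E \<Longrightarrow> norm x = 1 \<and> (\<exists>c. A *v x = c *\<^sub>R x)"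
    using orthonormal_eigenvectors[OF sym order_refl] by blast
  obtain e where e: "bij_betw e (UNIV::'n set) E"
    using finite_same_card_bij[of "UNIV::'n set" E] E by auto
  then have eE: "e i \<in> E" for i by (auto simp: bij_betw_def)
  have orth: "orthonormal_family e"
    unfolding orthonormal_family_def
  proof safe
    fix i j
    show "e i \<bullet> e j = (if i = j then 1 else 0)"
    proof (cases "i = j")
      case True then show ?thesis using E(4)[OF eE[of j]] by (simp add: norm_eq_1)
    next
      case False
      then have "e i \<noteq> e j" using e by (auto simp: bij_betw_def inj_on_def)
      then show ?thesis using E(3) eE False by (auto simp: pairwise_def orthogonal_def)
    qed
  qed
  have "\<forall>i. \<exists>c. A *v e i = c *\<^sub>R e i" using E(4) eE by blast
  then obtain w where w: "\<And>i. A *v e i = w i *\<^sub>R e i" by metis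
  have "A = eigen_matrix e w"
    unfolding matrix_eq
  proof (intro allI orthonormal_family_eqI[OF orth])
    fix x i
    have "(A *v x) \<bullet> e i = x \<bullet> (A *v e i)" by (rule symmetric_matrix_inner[OF sym])
    then show "(A *v x) \<bullet> e i = (eigen_matrix e w *v x) \<bullet> e i"
      by (simp add: w inner_eigen_matrix[OF orth])
  qed
  with orth show ?thesis by (rule that)
qed

lemma eigenvalue_quadratic_form:
  assumes e: "orthonormal_family e"
  shows "e i \<bullet> (eigen_matrix e w *v e i) = w i"
  using e by (simp add: eigen_matrix_eigenvector[OF e] orthonormal_family_def)

lemma matrix_eq_inverse:
  fixes A :: "real ^ 'n ^ 'n"
  assumes "A ** B = mat 1" "A ** C = mat 1"
  shows "B = C"
  by (metis assms matrix_left_right_inverse matrix_mul_assoc matrix_mul_lid matrix_mul_rid)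

section \<open>The barrier under rank-one updates\<close>

text \<open>The potential is the trace of the inverse. For \<open>B = u I - A\<close> and \<open>B = A - l I\<close> it is
  the Stieltjes transform of the spectrum of \<open>A\<close> at a point above and below the spectrum.\<close>

definition barrier :: "real \<Rightarrow> real ^ 'n ^ 'n \<Rightarrow> bool" where
  "barrier \<phi> B \<longleftrightarrow> (\<exists>e w. orthonormal_family e \<and> B = eigen_matrix e w \<and> (\<forall>i. 0 < w i) \<and>
     (\<Sum>i\<in>UNIV. 1 / w i) \<le> \<phi>)"

text \<open>Semidefiniteness and invertibility exclude nonpositive eigenvalues, and uniqueness of
  the inverse makes \<open>trace H\<close> the potential. An explicit inverse thus suffices, without
  the eigenvalues of \<open>B\<close>.\<close>

lemma barrierI:
  fixes B H :: "real ^ 'n ^ 'n"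
  assumes sym: "transpose B = B" and psd: "\<And>y. 0 \<le> y \<bullet> (B *v y)"
    and H: "B ** H = mat 1" and tr: "trace H \<le> \<phi>"
  shows "barrier \<phi> B"
proof -
  obtain e w where e: "orthonormal_family e" and B: "B = eigen_matrix e w"
    using spectral_theorem_symmetric[OF sym] .
  have w: "0 < w i" for i
  proof -
    have "w i \<ge> 0" using psd[of "e i"] by (simp add: B eigenvalue_quadratic_form[OF e])
    moreover have "w i \<noteq> 0"
    proof
      assume "w i = 0"
      then have "B *v e i = 0" by (simp add: B eigen_matrix_eigenvector[OF e])
      moreover have "H ** B = mat 1" using H by (rule matrix_left_right_inverse[THEN iffD1])
      then have "H *v (B *v e i) = e i" by (simp add: matrix_vector_mul_assoc)
      ultimately have "e i = 0" by simp
      moreover have "e i \<bullet> e i = 1" using e by (simp add: orthonormal_family_def)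
      ultimately show False by simp
    qed
    ultimately show ?thesis by simp
  qed
  have "B ** eigen_matrix e (\<lambda>i. 1 / w i) = mat 1"
    using w by (simp add: B eigen_matrix_compose[OF e] eigen_matrix_one[OF e] less_imp_neq[symmetric])
  from matrix_eq_inverse[OF H this] have "trace H = (\<Sum>i\<in>UNIV. 1 / w i)"
    by (simp add: trace_eigen_matrix[OF e])
  then show ?thesis unfolding barrier_def using e B w tr by auto
qed

text \<open>Raising every eigenvalue lowers the trace of the inverse, so a sufficient upper shift
  may be replaced by any larger one.\<close>

lemma barrier_mono:
  fixes B :: "real ^ 'n ^ 'n"
  assumes "barrier \<phi> B" "d \<ge> 0"
  shows "barrier \<phi> (B + mat d)"
proof -
  obtain e w where e: "orthonormal_family e" and B: "B = eigen_matrix e w" and w: "\<And>i. 0 < w i"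
    and s: "(\<Sum>i\<in>UNIV. 1 / w i) \<le> \<phi>"
    using assms(1) unfolding barrier_def by blast
  have "(\<Sum>i\<in>UNIV. 1 / (w i + d)) \<le> (\<Sum>i\<in>UNIV. 1 / w i)"
    using w assms(2) by (intro sum_mono divide_left_mono) (auto simp: add_pos_nonneg)
  then have "(\<Sum>i\<in>UNIV. 1 / (w i + d)) \<le> \<phi>" using s by simp
  moreover have "B + mat d = eigen_matrix e (\<lambda>i. w i + d)"
    by (simp add: B eigen_matrix_const[OF e, symmetric] eigen_matrix_add)
  ultimately show ?thesis unfolding barrier_def using e w assms(2)
    by (intro exI[of _ e] exI[of _ "\<lambda>i. w i + d"]) (auto simp: add_pos_nonneg)
qed

text \<open>Cauchy-Schwarz after splitting each product with the factor \<open>sqrt (v i)\<close>.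
  It keeps a rank-one downdate positive semidefinite as long as the first sum is below one.\<close>

lemma inner_square_le_weighted:
  assumes e: "orthonormal_family e" and v: "\<And>i. 0 < v i"
  shows "(x \<bullet> z)\<^sup>2 \<le> (\<Sum>i\<in>UNIV. (x \<bullet> e i)\<^sup>2 / v i) * (\<Sum>i\<in>UNIV. v i * (z \<bullet> e i)\<^sup>2)"
proof -
  have "x \<bullet> z = (\<Sum>i\<in>UNIV. ((x \<bullet> e i) / sqrt (v i)) * (sqrt (v i) * (z \<bullet> e i)))"
    unfolding inner_orthonormal_family[OF e, of x z]
  proof (intro sum.cong refl)
    fix i show "(x \<bullet> e i) * (z \<bullet> e i) = (x \<bullet> e i) / sqrt (v i) * (sqrt (v i) * (z \<bullet> e i))"
      using v[of i] by simp
  qed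
  then have "(x \<bullet> z)\<^sup>2 \<le> (\<Sum>i\<in>UNIV. ((x \<bullet> e i) / sqrt (v i))\<^sup>2) * (\<Sum>i\<in>UNIV. (sqrt (v i) * (z \<bullet> e i))\<^sup>2)"
    by (simp only: Cauchy_Schwarz_ineq_sum)
  then show ?thesis using v by (simp add: power_divide power_mult_distrib less_imp_le)
qed

text \<open>The inverse after the update is given by the Sherman--Morrison formula.\<close>

lemma barrier_rank_one:
  fixes e :: "'n \<Rightarrow> real ^ 'n" and x :: "real ^ 'n"
  assumes e: "orthonormal_family e" and v: "\<And>i. 0 < v i" and \<sigma>: "\<sigma> = 1 \<or> \<sigma> = (-1::real)"
  defines "Q1 \<equiv> (\<Sum>i\<in>UNIV. (x \<bullet> e i)\<^sup>2 / v i)" and "Q2 \<equiv> (\<Sum>i\<in>UNIV. (x \<bullet> e i)\<^sup>2 / (v i)\<^sup>2)"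
  assumes c: "0 < 1 + \<sigma> * Q1" and tr: "(\<Sum>i\<in>UNIV. 1 / v i) - \<sigma> * Q2 / (1 + \<sigma> * Q1) \<le> \<phi>"
  shows "barrier \<phi> (eigen_matrix e v + \<sigma> *\<^sub>R outer x)"
proof -
  define c where "c = 1 + \<sigma> * Q1"
  define D where "D = eigen_matrix e (\<lambda>i. 1 / v i)"
  define y where "y = D *v x"
  define H where "H = D - (\<sigma> / c) *\<^sub>R outer y"
  have c0: "c > 0" using assms by (simp add: c_def)
  have ye: "y \<bullet> e i = (x \<bullet> e i) / v i" for i
    by (simp add: y_def D_def inner_eigen_matrix[OF e])
  have ED: "eigen_matrix e v *v (D *v z) = z" for z
    using v by (intro orthonormal_family_eqI[OF e])
      (simp add: D_def inner_eigen_matrix[OF e] less_imp_neq[symmetric])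
  have xy: "x \<bullet> y = Q1"
    unfolding inner_orthonormal_family[OF e, of x y] ye Q1_def by (simp add: power2_eq_square)
  have yy: "y \<bullet> y = Q2"
    unfolding inner_orthonormal_family[OF e, of y y] ye Q2_def by (simp add: power2_eq_square)
  have xD: "x \<bullet> (D *v z) = y \<bullet> z" for z
    unfolding y_def D_def using symmetric_matrix_inner[OF transpose_eigen_matrix] by metis
  have "(eigen_matrix e v + \<sigma> *\<^sub>R outer x) *v (H *v z) = z" for z
  proof -
    have Hz: "H *v z = D *v z - (\<sigma> / c * (y \<bullet> z)) *\<^sub>R y"
      by (simp add: H_def matrix_vector_mult_diff_rdistrib scaleR_matrix_vector_assoc[symmetric] outer_mult)
    have "(eigen_matrix e v + \<sigma> *\<^sub>R outer x) *v (H *v z)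
        = eigen_matrix e v *v (H *v z) + (\<sigma> * (x \<bullet> (H *v z))) *\<^sub>R x"
      by (simp add: matrix_vector_mult_add_rdistrib scaleR_matrix_vector_assoc[symmetric] outer_mult)
    also have "eigen_matrix e v *v (H *v z) = z - (\<sigma> / c * (y \<bullet> z)) *\<^sub>R x"
      unfolding Hz matrix_vector_mult_diff_distrib matrix_vector_mult_scaleR ED
      by (simp add: y_def ED)
    also have "x \<bullet> (H *v z) = (y \<bullet> z) - \<sigma> / c * (y \<bullet> z) * Q1"
      unfolding Hz by (simp add: inner_diff_right xD xy)
    also have "\<sigma> * ((y \<bullet> z) - \<sigma> / c * (y \<bullet> z) * Q1) = \<sigma> / c * (y \<bullet> z)"
    proof -
      have "\<sigma> * \<sigma> = 1" using \<sigma> by auto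
      then have "\<sigma> * c - \<sigma> * \<sigma> * Q1 = \<sigma>" unfolding c_def
        by (metis add.right_neutral add_diff_cancel_right distrib_left mult.assoc mult.right_neutral diff_add_cancel add_diff_cancel)
      then have "\<sigma> - \<sigma> * \<sigma> / c * Q1 = \<sigma> / c" using c0 by (simp add: field_simps)
      then have "(\<sigma> - \<sigma> * \<sigma> / c * Q1) * (y \<bullet> z) = \<sigma> / c * (y \<bullet> z)" by simp
      then show ?thesis by (simp add: algebra_simps)
    qed
    finally show ?thesis by simp
  qed
  then have inv: "(eigen_matrix e v + \<sigma> *\<^sub>R outer x) ** H = mat 1"
    unfolding matrix_eq by (simp add: matrix_vector_mul_assoc[symmetric])
  \<comment> \<open>Invertibility alone would allow negative eigenvalues. For
    \<open>\<sigma> = -1\<close> the hypothesis gives \<open>Q1 < 1\<close>, and the weighted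
    Cauchy-Schwarz inequality bounds the subtracted square by \<open>Q1 * S\<close>.\<close>
  have "0 \<le> z \<bullet> ((eigen_matrix e v + \<sigma> *\<^sub>R outer x) *v z)" for z
  proof -
    define S where "S = (\<Sum>i\<in>UNIV. v i * (z \<bullet> e i)\<^sup>2)"
    have S: "S \<ge> 0" unfolding S_def using v by (intro sum_nonneg) (auto simp: less_imp_le)
    have eq: "z \<bullet> ((eigen_matrix e v + \<sigma> *\<^sub>R outer x) *v z) = S + \<sigma> * (x \<bullet> z)\<^sup>2"
      by (simp add: matrix_vector_mult_add_rdistrib scaleR_matrix_vector_assoc[symmetric] outer_mult
          inner_add_right quadratic_eigen_matrix[OF e] S_def power2_eq_square inner_commute)
    have cs: "(x \<bullet> z)\<^sup>2 \<le> Q1 * S" using inner_square_le_weighted[OF e v] by (simp add: Q1_def S_def)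
    show ?thesis
    proof (cases "\<sigma> = 1")
      case True then show ?thesis using S unfolding eq by simp
    next
      case False
      then have "\<sigma> = -1" using \<sigma> by simp
      then have "Q1 * S \<le> 1 * S" using c by (intro mult_right_mono S) simp
      then show ?thesis using cs \<open>\<sigma> = -1\<close> unfolding eq by simp
    qed
  qed
  moreover have "transpose (eigen_matrix e v + \<sigma> *\<^sub>R outer x) = eigen_matrix e v + \<sigma> *\<^sub>R outer x"
    by (simp add: transpose_add transpose_eigen_matrix transpose_scaleR transpose_outer)
  moreover have "trace H \<le> \<phi>"
    using tr by (simp add: H_def trace_sub D_def trace_eigen_matrix[OF e] trace_scaleR trace_outer yy c_def)
  ultimately show ?thesis using inv by (intro barrierI) auto
qed

text \<open>Raising the eigenvalues by \<delta> lowers the potential by \<open>s\<close>, and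
  subtracting \<open>outer x\<close> raises it by at most \<open>q2 / (1 - q1)\<close>. The bounds
  on the two sums of squares say that the gain pays for the loss.\<close>

lemma barrier_upper_update:
  fixes e :: "'n \<Rightarrow> real ^ 'n"
  assumes e: "orthonormal_family e" and w: "\<And>i. 0 < w i" and \<delta>: "0 \<le> \<delta>" and h: "h < 1"
    and \<phi>: "(\<Sum>i\<in>UNIV. 1 / w i) \<le> \<phi>"
    and Q1: "(\<Sum>i\<in>UNIV. (x \<bullet> e i)\<^sup>2 / (w i + \<delta>)) \<le> h"
    and Q2: "(\<Sum>i\<in>UNIV. (x \<bullet> e i)\<^sup>2 / (w i + \<delta>)\<^sup>2) \<le> (1 - h) * (\<delta> * (\<Sum>i\<in>UNIV. 1 / (w i * (w i + \<delta>))))"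
  shows "barrier \<phi> (eigen_matrix e w + mat \<delta> - outer x)"
proof -
  define q1 where "q1 = (\<Sum>i\<in>UNIV. (x \<bullet> e i)\<^sup>2 / (w i + \<delta>))"
  define q2 where "q2 = (\<Sum>i\<in>UNIV. (x \<bullet> e i)\<^sup>2 / (w i + \<delta>)\<^sup>2)"
  define s where "s = \<delta> * (\<Sum>i\<in>UNIV. 1 / (w i * (w i + \<delta>)))"
  have wd: "0 < w i + \<delta>" for i using w \<delta> by (simp add: add_pos_nonneg)
  have s0: "s \<ge> 0" unfolding s_def using w wd \<delta> by (intro mult_nonneg_nonneg sum_nonneg) (auto simp: less_imp_le)
  have "1 / (w i + \<delta>) = 1 / w i - \<delta> * (1 / (w i * (w i + \<delta>)))" for i
    using w[of i] less_imp_neq[OF wd[of i]] by (simp add: divide_simps)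
  then have s: "(\<Sum>i\<in>UNIV. 1 / (w i + \<delta>)) = (\<Sum>i\<in>UNIV. 1 / w i) - s"
    unfolding s_def by (simp only: sum_subtractf sum_distrib_left)
  have "(1 - h) * s \<le> (1 - q1) * s" using Q1 s0 by (intro mult_right_mono) (auto simp: q1_def)
  then have "q2 \<le> s * (1 - q1)" using Q2 unfolding q2_def[symmetric] s_def[symmetric] by (simp add: mult.commute)
  moreover have "q1 < 1" using Q1 h by (simp add: q1_def)
  ultimately have "q2 / (1 - q1) \<le> s" by (simp add: divide_le_eq)
  then have "barrier \<phi> (eigen_matrix e (\<lambda>i. w i + \<delta>) + (-1) *\<^sub>R outer x)"
    using \<open>q1 < 1\<close> \<phi> s by (intro barrier_rank_one[OF e wd]) (auto simp: q1_def[symmetric] q2_def[symmetric])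
  then show ?thesis by (simp add: eigen_matrix_const[OF e, symmetric] eigen_matrix_add)
qed

text \<open>The normalised quadratic form \<open>weighted_average e w d\<close> has expectation one on isotropic vectors, and
  it is the shift of the barrier needed to absorb \<open>x\<close>, up to lower order terms.\<close>

definition weighted_average :: "('n \<Rightarrow> real ^ 'n) \<Rightarrow> ('n \<Rightarrow> real) \<Rightarrow> real \<Rightarrow> real ^ 'n \<Rightarrow> real" where
  "weighted_average e w d x = (\<Sum>i\<in>UNIV. (x \<bullet> e i)\<^sup>2 / (w i * (w i + d))) / (\<Sum>i\<in>UNIV. 1 / (w i * (w i + d)))"

lemma weighted_average_mult:
  fixes w :: "'n::finite \<Rightarrow> real"
  assumes w: "\<And>i. 0 < w i" and d: "0 \<le> d"
  shows "(\<Sum>i\<in>UNIV. (x \<bullet> e i)\<^sup>2 / (w i * (w i + d))) = weighted_average e w d x * (\<Sum>i\<in>UNIV. 1 / (w i * (w i + d)))"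
    and "0 < (\<Sum>i\<in>UNIV. 1 / (w i * (w i + d)))" and "0 \<le> weighted_average e w d x"
proof -
  have wd: "0 < w i * (w i + d)" for i using w[of i] d by (simp add: add_pos_nonneg)
  show p: "0 < (\<Sum>i\<in>UNIV. 1 / (w i * (w i + d)))" using wd by (intro sum_pos) auto
  then show "(\<Sum>i\<in>UNIV. (x \<bullet> e i)\<^sup>2 / (w i * (w i + d))) = weighted_average e w d x * (\<Sum>i\<in>UNIV. 1 / (w i * (w i + d)))"
    by (simp add: weighted_average_def)
  show "0 \<le> weighted_average e w d x" unfolding weighted_average_def
    using p wd by (intro divide_nonneg_nonneg sum_nonneg) (auto simp: less_imp_le)
qed

text \<open>The bound on \<open>weighted_average\<close> makes \<delta> at most
  \<open>h / (1 - 2 * h)\<close> times each \<open>w i\<close>, so replacing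
  \<open>w i + \<delta>\<close> by \<open>w i\<close> in the gain costs only the factor
  \<open>(1 - 2 * h) / (1 - h)\<close>. Together with the factor \<open>1 - h\<close> from the
  Sherman-Morrison denominator, \<open>1 - 2 * h\<close> remains and is divided out of the
  shift.\<close>

lemma barrier_upper_small:
  fixes e :: "'n \<Rightarrow> real ^ 'n"
  assumes e: "orthonormal_family e" and w: "\<And>i. \<theta> \<le> w i" and \<theta>: "0 < \<theta>" and h: "0 < h" "h < 1/2"
    and \<phi>: "(\<Sum>i\<in>UNIV. 1 / w i) \<le> \<phi>"
    and Q1: "(\<Sum>i\<in>UNIV. (x \<bullet> e i)\<^sup>2 / w i) \<le> h"
    and R: "weighted_average e w 0 x \<le> h * \<theta>"
  shows "barrier \<phi> (eigen_matrix e w + mat (weighted_average e w 0 x / (1 - 2 * h)) - outer x)"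
proof -
  define R where "R = weighted_average e w 0 x"
  define \<delta> where "\<delta> = R / (1 - 2 * h)"
  define p where "p = (\<Sum>i\<in>UNIV. 1 / (w i * w i))"
  have w0: "0 < w i" for i using w[of i] \<theta> by simp
  have Rp: "(\<Sum>i\<in>UNIV. (x \<bullet> e i)\<^sup>2 / (w i * w i)) = R * p" and p: "p > 0" and R0: "R \<ge> 0"
    using weighted_average_mult(1)[of w 0 x e] weighted_average_mult(2)[of w 0] weighted_average_mult(3)[of w 0 e x] w0
    by (simp_all add: R_def p_def)
  have \<delta>: "\<delta> \<ge> 0" using R0 h by (simp add: \<delta>_def)
  have wd: "0 < w i + \<delta>" for i using w0 \<delta> by (simp add: add_pos_nonneg)
  have q1: "(\<Sum>i\<in>UNIV. (x \<bullet> e i)\<^sup>2 / (w i + \<delta>)) \<le> (\<Sum>i\<in>UNIV. (x \<bullet> e i)\<^sup>2 / w i)"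
    using w0 wd \<delta> by (intro sum_mono divide_left_mono) auto
  have q2: "(\<Sum>i\<in>UNIV. (x \<bullet> e i)\<^sup>2 / (w i + \<delta>)\<^sup>2) \<le> R * p"
    unfolding Rp[symmetric] power2_eq_square[of "w _ + \<delta>"]
    using w0 wd \<delta> by (intro sum_mono divide_left_mono mult_mono) (auto simp: less_imp_le)
  have k: "(1 - 2 * h) / (1 - h) * (1 / (w i * w i)) \<le> 1 / (w i * (w i + \<delta>))" for i
  proof -
    have "\<delta> * (1 - 2 * h) \<le> h * w i"
    proof -
      have "\<delta> * (1 - 2 * h) = R" using h by (simp add: \<delta>_def)
      also have "\<dots> \<le> h * \<theta>" using R by (simp add: R_def)
      also have "\<dots> \<le> h * w i" using w h by simp
      finally show ?thesis .
    qed
    then have "(1 - 2 * h) * (w i + \<delta>) \<le> (1 - h) * w i" by (simp add: algebra_simps)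
    then show ?thesis using w0[of i] wd[of i] h by (simp add: divide_simps)
  qed
  have "(1 - 2 * h) / (1 - h) * p \<le> (\<Sum>i\<in>UNIV. 1 / (w i * (w i + \<delta>)))"
    unfolding p_def sum_distrib_left by (intro sum_mono k)
  then have "(1 - h) * (\<delta> * ((1 - 2 * h) / (1 - h) * p)) \<le> (1 - h) * (\<delta> * (\<Sum>i\<in>UNIV. 1 / (w i * (w i + \<delta>))))"
    using h \<delta> by (intro mult_left_mono) auto
  moreover have "(1 - h) * (\<delta> * ((1 - 2 * h) / (1 - h) * p)) = R * p"
    using h by (simp add: \<delta>_def)
  ultimately have "R * p \<le> (1 - h) * (\<delta> * (\<Sum>i\<in>UNIV. 1 / (w i * (w i + \<delta>))))" by simp
  moreover have h1: "h < 1" using h by simp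
  ultimately show ?thesis
    unfolding R_def[symmetric] \<delta>_def[symmetric]
    using q1 q2 Q1 h1 by (intro barrier_upper_update[OF e w0 \<delta> h1 \<phi>]) linarith+
qed

text \<open>Serves shifts that may be large compared with the eigenvalues. The weights
  \<open>1 / (w i * (w i + d))\<close> are those of the gain itself, and
  \<open>(w i + d)\<^sup>2\<close> dominates \<open>w i * (w i + d)\<close>.\<close>

lemma barrier_upper_large:
  fixes e :: "'n \<Rightarrow> real ^ 'n"
  assumes e: "orthonormal_family e" and w: "\<And>i. 0 < w i" and d: "0 \<le> d" and h: "h < 1"
    and \<phi>: "(\<Sum>i\<in>UNIV. 1 / w i) \<le> \<phi>"
    and Q1: "(\<Sum>i\<in>UNIV. (x \<bullet> e i)\<^sup>2 / (w i + d)) \<le> h"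
    and R: "weighted_average e w d x \<le> (1 - h) * d"
  shows "barrier \<phi> (eigen_matrix e w + mat d - outer x)"
proof (rule barrier_upper_update[OF e w d h \<phi> Q1])
  define p where "p = (\<Sum>i\<in>UNIV. 1 / (w i * (w i + d)))"
  have wd: "0 < w i + d" for i using w d by (simp add: add_pos_nonneg)
  have "(\<Sum>i\<in>UNIV. (x \<bullet> e i)\<^sup>2 / (w i + d)\<^sup>2) \<le> (\<Sum>i\<in>UNIV. (x \<bullet> e i)\<^sup>2 / (w i * (w i + d)))"
    unfolding power2_eq_square[of "w _ + d"]
    using w wd d by (intro sum_mono divide_left_mono mult_right_mono) (auto simp: less_imp_le)
  also have "\<dots> = weighted_average e w d x * p" unfolding p_def by (intro weighted_average_mult w d)
  also have "\<dots> \<le> (1 - h) * d * p"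
    using R weighted_average_mult(2)[of w d] w d by (intro mult_right_mono) (auto simp: p_def less_imp_le)
  finally show "(\<Sum>i\<in>UNIV. (x \<bullet> e i)\<^sup>2 / (w i + d)\<^sup>2) \<le> (1 - h) * (d * (\<Sum>i\<in>UNIV. 1 / (w i * (w i + d))))"
    by (simp add: p_def mult.assoc)
qed

text \<open>Adding \<open>outer x\<close> lowers the potential by \<open>q2 / (1 + q1)\<close>,
  which pays for lowering all eigenvalues. One factor \<open>1 - h\<close> is lost in
  \<open>1 + q1\<close>, the other in replacing \<open>w i - \<delta>\<close> by \<open>w i\<close>
  in the price; hence the square in the shift.\<close>

lemma barrier_lower:
  fixes e :: "'n \<Rightarrow> real ^ 'n"
  assumes e: "orthonormal_family e" and w: "\<And>i. \<theta> \<le> w i" and \<theta>: "0 < \<theta>" and h: "0 < h" "h < 1"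
    and \<phi>: "(\<Sum>i\<in>UNIV. 1 / w i) \<le> \<phi>"
    and Q1: "(\<Sum>i\<in>UNIV. (x \<bullet> e i)\<^sup>2 / w i) \<le> h"
    and R: "weighted_average e w 0 x \<le> h * \<theta>"
  shows "barrier \<phi> (eigen_matrix e w - mat ((1 - h)\<^sup>2 * weighted_average e w 0 x) + outer x)"
proof -
  define R where "R = weighted_average e w 0 x"
  define \<delta> where "\<delta> = (1 - h)\<^sup>2 * R"
  define p where "p = (\<Sum>i\<in>UNIV. 1 / (w i * w i))"
  have w0: "0 < w i" for i using w[of i] \<theta> by simp
  have Rp: "(\<Sum>i\<in>UNIV. (x \<bullet> e i)\<^sup>2 / (w i * w i)) = R * p" and p: "p > 0" and R0: "R \<ge> 0"
    using weighted_average_mult(1)[of w 0 x e] weighted_average_mult(2)[of w 0] weighted_average_mult(3)[of w 0 e x] w0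
    by (simp_all add: R_def p_def)
  have \<delta>: "\<delta> \<ge> 0" using R0 h by (simp add: \<delta>_def)
  have "(1 - h)\<^sup>2 \<le> 1" using h by (simp add: power_le_one)
  then have "\<delta> \<le> 1 * R" unfolding \<delta>_def using R0 by (intro mult_right_mono) auto
  then have \<delta>w: "\<delta> \<le> h * w i" for i
    using R w[of i] h by (simp add: R_def) (meson mult_left_mono less_imp_le order_trans)
  have wh: "(1 - h) * w i \<le> w i - \<delta>" for i using \<delta>w[of i] by (simp add: algebra_simps)
  have v: "0 < w i - \<delta>" for i
    using wh[of i] w0[of i] h mult_pos_pos[of "1 - h" "w i"] by linarith
  define q1 where "q1 = (\<Sum>i\<in>UNIV. (x \<bullet> e i)\<^sup>2 / (w i - \<delta>))"
  define q2 where "q2 = (\<Sum>i\<in>UNIV. (x \<bullet> e i)\<^sup>2 / (w i - \<delta>)\<^sup>2)"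
  have q1: "q1 \<le> h / (1 - h)"
  proof -
    have "q1 \<le> (\<Sum>i\<in>UNIV. (x \<bullet> e i)\<^sup>2 / ((1 - h) * w i))"
      unfolding q1_def using wh v w0 h by (intro sum_mono divide_left_mono) auto
    also have "\<dots> = (\<Sum>i\<in>UNIV. (x \<bullet> e i)\<^sup>2 / w i) / (1 - h)"
      by (simp add: sum_divide_distrib mult.commute)
    finally show ?thesis using Q1 h by (meson divide_right_mono diff_ge_0_iff_ge less_imp_le order_trans)
  qed
  have q10: "q1 \<ge> 0" unfolding q1_def using v by (intro sum_nonneg) (auto simp: less_imp_le)
  have q2: "R * p \<le> q2"
    unfolding Rp[symmetric] q2_def power2_eq_square[of "w _ - \<delta>"]
    using w0 v \<delta> by (intro sum_mono divide_left_mono mult_mono) (auto simp: less_imp_le)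
  have "1 + q1 \<le> 1 / (1 - h)" using q1 h by (simp add: field_simps)
  then have "(1 - h) * (1 + q1) \<le> 1" using h by (simp add: field_simps)
  then have "(1 - h) * (1 + q1) * (R * p) \<le> 1 * (R * p)"
    using R0 p by (intro mult_right_mono) auto
  then have q21: "(1 - h) * (R * p) \<le> q2 / (1 + q1)"
    using q2 q10 by (simp add: le_divide_eq mult_ac)
  have "1 / (w i - \<delta>) \<le> 1 / w i + \<delta> / (1 - h) * (1 / (w i * w i))" for i
  proof -
    have "1 / (w i - \<delta>) = 1 / w i + \<delta> / (w i * (w i - \<delta>))" using w0[of i] v[of i] by (simp add: field_simps)
    also have "\<delta> / (w i * (w i - \<delta>)) \<le> \<delta> / (w i * ((1 - h) * w i))"
      using w0[of i] v[of i] wh[of i] \<delta> h by (intro divide_left_mono mult_left_mono) auto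
    finally show ?thesis by (simp add: mult_ac)
  qed
  then have "(\<Sum>i\<in>UNIV. 1 / (w i - \<delta>)) \<le> (\<Sum>i\<in>UNIV. 1 / w i) + \<delta> / (1 - h) * p"
    unfolding p_def sum_distrib_left sum.distrib[symmetric] by (intro sum_mono)
  also have "\<delta> / (1 - h) * p = (1 - h) * (R * p)" using h by (simp add: \<delta>_def power2_eq_square)
  finally have "(\<Sum>i\<in>UNIV. 1 / (w i - \<delta>)) - q2 / (1 + q1) \<le> \<phi>" using q21 \<phi> by linarith
  then have "barrier \<phi> (eigen_matrix e (\<lambda>i. w i - \<delta>) + 1 *\<^sub>R outer x)"
    using q10 by (intro barrier_rank_one[OF e v]) (auto simp: q1_def[symmetric] q2_def[symmetric])
  moreover have "eigen_matrix e (\<lambda>i. w i - \<delta>) = eigen_matrix e w - mat \<delta>"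
  proof -
    have "eigen_matrix e w = eigen_matrix e (\<lambda>i. w i - \<delta>) + mat \<delta>"
      by (simp add: eigen_matrix_const[OF e, symmetric] eigen_matrix_add)
    then show ?thesis by simp
  qed
  ultimately show ?thesis by (simp add: \<delta>_def R_def)
qed

section \<open>Tails of weighted sums of squared coordinates\<close>

text \<open>Tonelli, after writing the positive part as the length of the interval
  \<open>{b..<Y x}\<close>.\<close>

lemma nn_integral_pos_part_layer_cake:
  fixes Y :: "'a \<Rightarrow> real"
  assumes "sigma_finite_measure M" and [measurable]: "Y \<in> borel_measurable M"
  shows "(\<integral>\<^sup>+x. ennreal (max 0 (Y x - b)) \<partial>M) =
    (\<integral>\<^sup>+t. indicator {b..} t * emeasure M {x \<in> space M. t < Y x} \<partial>lborel)"
proof -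
  interpret M: sigma_finite_measure M by fact
  interpret P: pair_sigma_finite lborel M by standard
  have "ennreal (max 0 (Y x - b)) = (\<integral>\<^sup>+t. indicator {b..} t * indicator {t. t < Y x} t \<partial>lborel)" for x
  proof -
    have "(\<integral>\<^sup>+t. indicator {b..} t * indicator {t. t < Y x} t \<partial>lborel) = (\<integral>\<^sup>+t. indicator {b..<Y x} t \<partial>lborel)"
      by (intro nn_integral_cong) (auto simp: indicator_def)
    also have "\<dots> = emeasure lborel {b..<Y x}" by simp
    also have "\<dots> = ennreal (max 0 (Y x - b))" by (cases "b \<le> Y x") (auto simp: max_def)
    finally show ?thesis by simp
  qed
  then have "(\<integral>\<^sup>+x. ennreal (max 0 (Y x - b)) \<partial>M) =
      (\<integral>\<^sup>+x. (\<integral>\<^sup>+t. indicator {b..} t * indicator {t. t < Y x} t \<partial>lborel) \<partial>M)" by simp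
  also have "\<dots> = (\<integral>\<^sup>+t. (\<integral>\<^sup>+x. indicator {b..} t * indicator {t. t < Y x} t \<partial>M) \<partial>lborel)"
    by (rule P.Fubini') measurable
  also have "\<dots> = (\<integral>\<^sup>+t. indicator {b..} t * emeasure M {x \<in> space M. t < Y x} \<partial>lborel)"
  proof (intro nn_integral_cong)
    fix t
    have "(\<integral>\<^sup>+x. indicator {b..} t * indicator {t. t < Y x} t \<partial>M)
        = (\<integral>\<^sup>+x. indicator {b..} t * indicator {x \<in> space M. t < Y x} x \<partial>M)"
      by (intro nn_integral_cong) (auto simp: indicator_def)
    also have "\<dots> = indicator {b..} t * emeasure M {x \<in> space M. t < Y x}"
      by (simp add: nn_integral_cmult)
    finally show "(\<integral>\<^sup>+x. indicator {b..} t * indicator {t. t < Y x} t \<partial>M)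
      = indicator {b..} t * emeasure M {x \<in> space M. t < Y x}" .
  qed
  finally show ?thesis .
qed

lemma nn_integral_powr_tail:
  fixes C \<eta> b :: real
  assumes "0 < b" "0 < \<eta>" "0 \<le> C"
  shows "(\<integral>\<^sup>+t. ennreal (C * t powr (- 1 - \<eta>)) * indicator {b..} t \<partial>lborel) = ennreal (C / \<eta> * b powr (- \<eta>))"
proof -
  have "(\<integral>\<^sup>+t. ennreal (C * t powr (- 1 - \<eta>)) * indicator {b..} t \<partial>lborel)
      = ennreal (0 - (- (C / \<eta>) * b powr (- \<eta>)))"
  proof (rule nn_integral_FTC_atLeast)
    show "((\<lambda>t. - (C / \<eta>) * t powr (- \<eta>)) has_real_derivative C * t powr (- 1 - \<eta>)) (at t)"
      if "b \<le> t" for t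
      using that assms by (auto intro!: derivative_eq_intros simp: field_simps powr_diff powr_minus)
    show "((\<lambda>t. - (C / \<eta>) * t powr (- \<eta>)) \<longlongrightarrow> 0) at_top"
      using assms by (intro tendsto_mult_right_zero tendsto_neg_powr filterlim_ident) auto
  qed (use assms in auto)
  then show ?thesis by simp
qed

text \<open>Peel off the indicator of the support of \<open>a\<close> with the smallest nonzero
  weight \<open>m\<close> as coefficient: the support shrinks and the upper bound on the weights
  drops by \<open>m\<close>. Hence the coefficients add up to at most \<alpha>, however many
  distinct weights there are.\<close>

lemma weights_decompose:
  fixes a :: "'n::finite \<Rightarrow> real"
  assumes "\<And>i. 0 \<le> a i" "\<And>i. a i \<le> \<alpha>"
  shows "\<exists>c. (\<forall>S. 0 \<le> c S) \<and> (\<Sum>S\<in>UNIV. c S) \<le> \<alpha> \<and> (\<forall>i. a i = (\<Sum>S\<in>UNIV. c S * indicator S i))"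
  using assms
proof (induction "card {i. a i \<noteq> 0}" arbitrary: a \<alpha> rule: less_induct)
  case less
  show ?case
  proof (cases "{i. a i \<noteq> 0} = {}")
    case True
    have "\<alpha> \<ge> 0" using less.prems order_trans by blast
    then show ?thesis using True by (intro exI[of _ "\<lambda>_. 0"]) auto
  next
    case False
    define S where "S = {i. a i \<noteq> 0}"
    define m where "m = Min (a ` S)"
    have "m \<in> a ` S" unfolding m_def using False by (intro Min_in) (auto simp: S_def)
    then obtain k where k: "k \<in> S" "a k = m" by auto
    have m: "m > 0" using k less.prems(1)[of k] by (auto simp: S_def)
    have mS: "m \<le> a i" if "i \<in> S" for i unfolding m_def using that by (intro Min_le) auto
    define a' where "a' i = a i - m * indicator S i" for i
    have "{i. a' i \<noteq> 0} \<subset> S"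
    proof
      show "{i. a' i \<noteq> 0} \<subseteq> S" by (auto simp: a'_def S_def indicator_def)
      have "a' k = 0" using k by (simp add: a'_def)
      then show "{i. a' i \<noteq> 0} \<noteq> S" using k(1) by blast
    qed
    then have "card {i. a' i \<noteq> 0} < card {i. a i \<noteq> 0}"
      unfolding S_def by (intro psubset_card_mono) auto
    moreover have "0 \<le> a' i" for i
      using mS[of i] less.prems(1)[of i] by (auto simp: a'_def indicator_def)
    moreover have "a' i \<le> \<alpha> - m" for i
    proof (cases "i \<in> S")
      case True then show ?thesis using less.prems(2)[of i] by (simp add: a'_def)
    next
      case False
      then show ?thesis using less.prems(2)[of k] k by (simp add: a'_def S_def)
    qed
    ultimately obtain c where c: "\<And>S. 0 \<le> c S" "(\<Sum>S\<in>UNIV. c S) \<le> \<alpha> - m"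
      "\<And>i. a' i = (\<Sum>S\<in>UNIV. c S * indicator S i)"
      using less.hyps[of a' "\<alpha> - m"] by blast
    define c' where "c' T = c T + (if T = S then m else 0)" for T
    have "(\<Sum>T\<in>UNIV. c' T) \<le> \<alpha>" using c(2) by (simp add: c'_def sum.distrib)
    moreover have "a i = (\<Sum>T\<in>UNIV. c' T * indicator T i)" for i
    proof -
      have "(\<Sum>T\<in>UNIV. c' T * indicator T i) = a' i + (\<Sum>T\<in>UNIV. if T = S then m * indicator T i else 0)"
        unfolding c(3) sum.distrib[symmetric] by (intro sum.cong) (auto simp: c'_def algebra_simps)
      then show ?thesis by (simp add: a'_def)
    qed
    moreover have "0 \<le> c' T" for T using c(1) m by (simp add: c'_def)
    ultimately show ?thesis by blast
  qed
qed

text \<open>\<open>M\<close> is the law of the normalised vector. A projection enters only through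
  squared coordinates in an orthonormal family, with \<open>card S\<close> in the role of the
  rank.\<close>

locale regular_isotropic = prob_space M for M :: "(real ^ 'n) measure" +
  fixes C \<eta> :: real
  assumes sets_M [measurable_cong]: "sets M = sets borel"
    and C_pos: "0 < C" and \<eta>_pos: "0 < \<eta>"
    and integrable_norm_square: "integrable M (\<lambda>x. (norm x)\<^sup>2)"
    and isotropic: "(\<integral>x. (x \<bullet> v)\<^sup>2 \<partial>M) = (norm v)\<^sup>2"
    and regular: "orthonormal_family e \<Longrightarrow> C * real (card S) < t \<Longrightarrow>
      measure M {x \<in> space M. t < (\<Sum>i\<in>S. (x \<bullet> e i)\<^sup>2)} \<le> C * t powr (- 1 - \<eta>)"
begin

lemma integrable_inner_square: "integrable M (\<lambda>x. (x \<bullet> v)\<^sup>2)"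
proof (rule Bochner_Integration.integrable_bound)
  show "integrable M (\<lambda>x. (norm v)\<^sup>2 * (norm x)\<^sup>2)" using integrable_norm_square by simp
  show "AE x in M. norm ((x \<bullet> v)\<^sup>2) \<le> norm ((norm v)\<^sup>2 * (norm x)\<^sup>2)"
  proof (intro AE_I2)
    fix x
    have "\<bar>x \<bullet> v\<bar>\<^sup>2 \<le> (norm x * norm v)\<^sup>2" by (intro power_mono Cauchy_Schwarz_ineq2) auto
    then show "norm ((x \<bullet> v)\<^sup>2) \<le> norm ((norm v)\<^sup>2 * (norm x)\<^sup>2)"
      by (simp add: power_mult_distrib mult.commute)
  qed
qed simp

lemma integrable_weighted_squares: "integrable M (\<lambda>x. \<Sum>i\<in>S. a i * (x \<bullet> e i)\<^sup>2)"
  by (intro Bochner_Integration.integrable_sum integrable_mult_right integrable_inner_square)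

lemma integral_weighted_squares:
  assumes "orthonormal_family e"
  shows "(\<integral>x. (\<Sum>i\<in>UNIV. a i * (x \<bullet> e i)\<^sup>2) \<partial>M) = (\<Sum>i\<in>UNIV. a i)"
proof -
  have "norm (e i) = 1" for i using assms by (simp add: orthonormal_family_def norm_eq_1)
  then show ?thesis
    by (subst Bochner_Integration.integral_sum) (auto simp: isotropic integrable_inner_square)
qed

lemma projection_tail_integral:
  assumes e: "orthonormal_family e" and b: "0 < b" "C * real (card S) \<le> b"
  shows "(\<integral>\<^sup>+x. ennreal (max 0 ((\<Sum>i\<in>S. (x \<bullet> e i)\<^sup>2) - b)) \<partial>M) \<le> ennreal (C / \<eta> * b powr (- \<eta>))"
proof -
  have "(\<integral>\<^sup>+x. ennreal (max 0 ((\<Sum>i\<in>S. (x \<bullet> e i)\<^sup>2) - b)) \<partial>M) =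
    (\<integral>\<^sup>+t. indicator {b..} t * emeasure M {x \<in> space M. t < (\<Sum>i\<in>S. (x \<bullet> e i)\<^sup>2)} \<partial>lborel)"
    by (intro nn_integral_pos_part_layer_cake) (auto intro: sigma_finite_measure_axioms)
  also have "\<dots> \<le> (\<integral>\<^sup>+t. ennreal (C * t powr (- 1 - \<eta>)) * indicator {b..} t \<partial>lborel)"
  proof (rule nn_integral_mono_AE)
    \<comment> \<open>The tail bound is assumed only for \<open>t\<close> strictly above its
      threshold, so it may fail at \<open>t = b\<close> when \<open>b = C * real (card S)\<close>; a
      single point is negligible.\<close>
    have "AE t in lborel. t \<noteq> b" by (rule AE_lborel_singleton)
    then show "AE t in lborel. indicator {b..} t * emeasure M {x \<in> space M. t < (\<Sum>i\<in>S. (x \<bullet> e i)\<^sup>2)}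
       \<le> ennreal (C * t powr (- 1 - \<eta>)) * indicator {b..} t"
    proof eventually_elim
      case (elim t)
      show ?case
      proof (cases "b \<le> t")
        case True
        then have "C * real (card S) < t" using elim b by linarith
        then show ?thesis using regular[OF e] True by (simp add: emeasure_eq_measure ennreal_leI)
      qed simp
    qed
  qed
  also have "\<dots> = ennreal (C / \<eta> * b powr (- \<eta>))"
    using b C_pos \<eta>_pos by (intro nn_integral_powr_tail) auto
  finally show ?thesis .
qed

text \<open>A weight vector is a combination of indicators of index sets, and the tail integral is convex, so
  the bound for projections carries over to weighted sums without loss.\<close>

lemma weighted_tail_integral:
  fixes a :: "'n \<Rightarrow> real"
  assumes e: "orthonormal_family e" and a: "\<And>i. 0 \<le> a i" "\<And>i. a i \<le> \<alpha>" and \<sigma>: "(\<Sum>i\<in>UNIV. a i) \<le> \<sigma>"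
    and s: "0 < s"
  shows "(\<integral>\<^sup>+x. ennreal (max 0 ((\<Sum>i\<in>UNIV. a i * (x \<bullet> e i)\<^sup>2) - C * \<sigma> - s * \<alpha>)) \<partial>M)
    \<le> ennreal (\<alpha> * (C / \<eta> * s powr (- \<eta>)))"
proof -
  have "\<exists>c. (\<forall>S. 0 \<le> c S) \<and> (\<Sum>S\<in>UNIV. c S) \<le> \<alpha> \<and> (\<forall>i. a i = (\<Sum>S\<in>UNIV. c S * indicator S i))"
    by (rule weights_decompose[OF a])
  then obtain c where c: "\<And>S. 0 \<le> c S" "(\<Sum>S\<in>UNIV. c S) \<le> \<alpha>" and
    ac: "\<And>i. a i = (\<Sum>S\<in>UNIV. c S * indicator S i)" by auto
  have swap: "(\<Sum>i\<in>UNIV. a i * y i) = (\<Sum>S\<in>UNIV. c S * (\<Sum>i\<in>S. y i))" for y :: "'n \<Rightarrow> real"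
  proof -
    have "(\<Sum>i\<in>UNIV. a i * y i) = (\<Sum>i\<in>UNIV. \<Sum>S\<in>UNIV. c S * (indicator S i * y i))"
      unfolding ac by (simp only: sum_distrib_right mult.assoc)
    also have "\<dots> = (\<Sum>S\<in>UNIV. c S * (\<Sum>i\<in>UNIV. indicator S i * y i))"
      by (subst sum.swap) (simp only: sum_distrib_left)
    finally show ?thesis by simp
  qed
  define F where "F S x = max 0 ((\<Sum>i\<in>S. (x \<bullet> e i)\<^sup>2) - (C * real (card S) + s))" for S x
  have F0: "F S x \<ge> 0" for S x by (simp add: F_def)
  have [measurable]: "F S \<in> borel_measurable M" for S unfolding F_def by measurable
  \<comment> \<open>Each index set gets its own threshold \<open>C * real (card S) + s\<close>.
    Weighted by \<open>c\<close> these add up to at most \<open>C * \<sigma> + s * \<alpha>\<close>,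
    because the weighted cardinalities sum to the total weight and the coefficients to at most
    \<alpha>.\<close>
  have pw: "max 0 ((\<Sum>i\<in>UNIV. a i * (x \<bullet> e i)\<^sup>2) - C * \<sigma> - s * \<alpha>) \<le> (\<Sum>S\<in>UNIV. c S * F S x)" for x
  proof -
    have "(\<Sum>S\<in>UNIV. c S * real (card S)) \<le> \<sigma>" using swap[of "\<lambda>_. 1"] \<sigma> by simp
    then have "C * (\<Sum>S\<in>UNIV. c S * real (card S)) \<le> C * \<sigma>" using C_pos by simp
    moreover have "s * (\<Sum>S\<in>UNIV. c S) \<le> s * \<alpha>" using c(2) s by simp
    ultimately have "(\<Sum>i\<in>UNIV. a i * (x \<bullet> e i)\<^sup>2) - C * \<sigma> - s * \<alpha>
      \<le> (\<Sum>S\<in>UNIV. c S * (\<Sum>i\<in>S. (x \<bullet> e i)\<^sup>2)) - C * (\<Sum>S\<in>UNIV. c S * real (card S)) - s * (\<Sum>S\<in>UNIV. c S)"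
      unfolding swap by linarith
    also have "\<dots> = (\<Sum>S\<in>UNIV. c S * ((\<Sum>i\<in>S. (x \<bullet> e i)\<^sup>2) - (C * real (card S) + s)))"
      unfolding sum_distrib_left[of C] sum_distrib_left[of s] sum_subtractf[symmetric]
      by (simp only: algebra_simps)
    also have "\<dots> \<le> (\<Sum>S\<in>UNIV. c S * F S x)"
      using c(1) by (intro sum_mono mult_left_mono) (auto simp: F_def)
    finally show ?thesis using c(1) F0 by (simp add: sum_nonneg)
  qed
  have K: "0 \<le> C / \<eta> * s powr (- \<eta>)" using C_pos \<eta>_pos by simp
  have const: "(\<Sum>S\<in>UNIV. ennreal (c S) * ennreal k) = ennreal ((\<Sum>S\<in>UNIV. c S) * k)" if "0 \<le> k" for k
    using c(1) that by (simp add: sum_distrib_right ennreal_mult[symmetric])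
  have "(\<integral>\<^sup>+x. ennreal (max 0 ((\<Sum>i\<in>UNIV. a i * (x \<bullet> e i)\<^sup>2) - C * \<sigma> - s * \<alpha>)) \<partial>M)
    \<le> (\<integral>\<^sup>+x. (\<Sum>S\<in>UNIV. ennreal (c S) * ennreal (F S x)) \<partial>M)"
    using pw c(1) F0 by (intro nn_integral_mono) (simp add: ennreal_mult[symmetric] ennreal_leI)
  also have "\<dots> = (\<Sum>S\<in>UNIV. ennreal (c S) * (\<integral>\<^sup>+x. ennreal (F S x) \<partial>M))"
    by (subst nn_integral_sum) (auto simp: nn_integral_cmult)
  also have "\<dots> \<le> (\<Sum>S\<in>UNIV. ennreal (c S) * ennreal (C / \<eta> * s powr (- \<eta>)))"
  proof (intro sum_mono mult_left_mono)
    fix S :: "'n set"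
    have b: "0 < C * real (card S) + s" using C_pos s by (simp add: add_nonneg_pos)
    have "(\<integral>\<^sup>+x. ennreal (F S x) \<partial>M) \<le> ennreal (C / \<eta> * (C * real (card S) + s) powr (- \<eta>))"
      unfolding F_def using s by (intro projection_tail_integral[OF e b]) auto
    also have "\<dots> \<le> ennreal (C / \<eta> * s powr (- \<eta>))"
      using C_pos \<eta>_pos s by (intro ennreal_leI mult_left_mono powr_mono2') auto
    finally show "(\<integral>\<^sup>+x. ennreal (F S x) \<partial>M) \<le> ennreal (C / \<eta> * s powr (- \<eta>))" .
  qed auto
  also have "\<dots> = ennreal ((\<Sum>S\<in>UNIV. c S) * (C / \<eta> * s powr (- \<eta>)))"
    by (rule const[OF K])
  also have "\<dots> \<le> ennreal (\<alpha> * (C / \<eta> * s powr (- \<eta>)))"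
    using c(2) K by (intro ennreal_leI mult_right_mono)
  finally show ?thesis .
qed

text \<open>Markov's inequality for the positive part: beyond \<open>q\<close> the excess is at
  least \<open>s * \<alpha>\<close>, and dividing by this improves the exponent from
  \<open>- \<eta>\<close> to \<open>- 1 - \<eta>\<close>.\<close>

lemma weighted_tail_prob:
  fixes a :: "'n \<Rightarrow> real"
  assumes e: "orthonormal_family e" and a: "\<And>i. 0 \<le> a i" "\<And>i. a i \<le> \<alpha>" and \<sigma>: "(\<Sum>i\<in>UNIV. a i) \<le> \<sigma>"
    and s: "0 < s" and \<alpha>: "0 < \<alpha>" and q: "C * \<sigma> + 2 * s * \<alpha> \<le> q"
  shows "prob {x \<in> space M. q < (\<Sum>i\<in>UNIV. a i * (x \<bullet> e i)\<^sup>2)} \<le> C / \<eta> * s powr (- 1 - \<eta>)"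
proof -
  define A where "A = {x \<in> space M. q < (\<Sum>i\<in>UNIV. a i * (x \<bullet> e i)\<^sup>2)}"
  have [measurable]: "A \<in> sets M" unfolding A_def by measurable
  have "ennreal (s * \<alpha>) * emeasure M A = (\<integral>\<^sup>+x. ennreal (s * \<alpha>) * indicator A x \<partial>M)"
    by (simp add: nn_integral_cmult)
  also have "\<dots> \<le> (\<integral>\<^sup>+x. ennreal (max 0 ((\<Sum>i\<in>UNIV. a i * (x \<bullet> e i)\<^sup>2) - C * \<sigma> - s * \<alpha>)) \<partial>M)"
  proof (intro nn_integral_mono)
    fix x
    show "ennreal (s * \<alpha>) * indicator A x \<le> ennreal (max 0 ((\<Sum>i\<in>UNIV. a i * (x \<bullet> e i)\<^sup>2) - C * \<sigma> - s * \<alpha>))"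
    proof (cases "x \<in> A")
      case True
      then have "s * \<alpha> \<le> (\<Sum>i\<in>UNIV. a i * (x \<bullet> e i)\<^sup>2) - C * \<sigma> - s * \<alpha>"
        using q unfolding A_def mem_Collect_eq by linarith
      then show ?thesis using True by (auto intro!: ennreal_leI)
    qed simp
  qed
  also have "\<dots> \<le> ennreal (\<alpha> * (C / \<eta> * s powr (- \<eta>)))" by (rule weighted_tail_integral[OF e a \<sigma> s])
  finally have "s * \<alpha> * prob A \<le> \<alpha> * (C / \<eta> * s powr (- \<eta>))"
    using s \<alpha> C_pos \<eta>_pos by (simp add: emeasure_eq_measure ennreal_mult[symmetric])
  then have "\<alpha> * (s * prob A) \<le> \<alpha> * (C / \<eta> * s powr (- \<eta>))" by (simp add: mult_ac)
  then have "s * prob A \<le> C / \<eta> * s powr (- \<eta>)" using \<alpha> by (simp only: mult_le_cancel_left_pos)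
  then have "prob A \<le> C / \<eta> * s powr (- \<eta>) / s" using s by (simp only: pos_le_divide_eq mult.commute)
  also have "\<dots> = C / \<eta> * s powr (- 1 - \<eta>)" using s by (simp add: powr_diff powr_minus field_simps)
  finally show ?thesis by (simp add: A_def)
qed

text \<open>Unit variance of one coordinate keeps \<open>C\<close> away from zero: cutting at
  \<open>b\<close> gives \<open>1 \<le> b + C / \<eta> * b powr (- \<eta>)\<close>, and
  \<open>b = C powr (1 / (1 + \<eta>))\<close> is chosen to make
  \<open>C * b powr (- \<eta>) = b\<close>. This lets the sample size absorb constants even when
  \<open>C\<close> is small.\<close>

lemma regularity_constant_lower_bound: "1 \<le> C * (1 + 1 / \<eta>) powr (1 + \<eta>)"
proof (cases "1 \<le> C")
  case True
  have "1 * 1 \<le> C * (1 + 1 / \<eta>) powr (1 + \<eta>)"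
    using True \<eta>_pos by (intro mult_mono ge_one_powr_ge_zero) auto
  then show ?thesis by simp
next
  case False
  define b where "b = C powr (1 / (1 + \<eta>))"
  define e :: "'n \<Rightarrow> real ^ 'n" where "e i = axis i 1" for i
  have e: "orthonormal_family e" by (auto simp: orthonormal_family_def e_def inner_axis_axis)
  fix k :: 'n
  have b0: "b > 0" using C_pos by (simp add: b_def)
  \<comment> \<open>For \<open>C < 1\<close> this choice satisfies \<open>C \<le> b\<close>, which
    makes \<open>b\<close> an admissible threshold for a one-dimensional projection.\<close>
  have "C = C powr 1" using C_pos by simp
  also have "\<dots> \<le> b" unfolding b_def using C_pos False \<eta>_pos by (intro powr_mono') auto
  finally have bC: "C * real (card {k}) \<le> b" by simp
  have "norm (e k) = 1" by (simp add: e_def)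
  then have "1 = (\<integral>x. (x \<bullet> e k)\<^sup>2 \<partial>M)" using isotropic[of "e k"] by simp
  then have "ennreal 1 = (\<integral>\<^sup>+x. ennreal ((x \<bullet> e k)\<^sup>2) \<partial>M)"
    by (simp add: nn_integral_eq_integral integrable_inner_square)
  also have "\<dots> \<le> (\<integral>\<^sup>+x. ennreal b + ennreal (max 0 ((\<Sum>i\<in>{k}. (x \<bullet> e i)\<^sup>2) - b)) \<partial>M)"
  proof (intro nn_integral_mono)
    fix x
    have "ennreal ((x \<bullet> e k)\<^sup>2) \<le> ennreal (b + max 0 ((\<Sum>i\<in>{k}. (x \<bullet> e i)\<^sup>2) - b))"
      by (intro ennreal_leI) simp
    then show "ennreal ((x \<bullet> e k)\<^sup>2) \<le> ennreal b + ennreal (max 0 ((\<Sum>i\<in>{k}. (x \<bullet> e i)\<^sup>2) - b))"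
      using b0 by (simp only: ennreal_plus less_imp_le max.cobounded1)
  qed
  also have "\<dots> = ennreal b + (\<integral>\<^sup>+x. ennreal (max 0 ((\<Sum>i\<in>{k}. (x \<bullet> e i)\<^sup>2) - b)) \<partial>M)"
    by (subst nn_integral_add) (auto simp: emeasure_space_1)
  also have "\<dots> \<le> ennreal b + ennreal (C / \<eta> * b powr (- \<eta>))"
    by (intro add_left_mono projection_tail_integral e b0 bC)
  finally have "1 \<le> b + C / \<eta> * b powr (- \<eta>)"
    using b0 C_pos \<eta>_pos by (simp add: ennreal_plus[symmetric] del: ennreal_plus)
  also have "C * b powr (- \<eta>) = b"
  proof -
    have "C * b powr (- \<eta>) = C powr 1 * C powr (- \<eta> / (1 + \<eta>))" using C_pos by (simp add: b_def powr_powr)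
    also have "\<dots> = C powr (1 + - \<eta> / (1 + \<eta>))" by (simp only: powr_add)
    also have "1 + - \<eta> / (1 + \<eta>) = 1 / (1 + \<eta>)" using \<eta>_pos by (simp add: field_simps)
    finally show ?thesis by (simp add: b_def)
  qed
  then have "b + C / \<eta> * b powr (- \<eta>) = b * (1 + 1 / \<eta>)" by (simp add: field_simps)
  finally have "1 \<le> (b * (1 + 1 / \<eta>)) powr (1 + \<eta>)" using \<eta>_pos by (intro ge_one_powr_ge_zero) auto
  also have "\<dots> = b powr (1 + \<eta>) * (1 + 1 / \<eta>) powr (1 + \<eta>)"
    using b0 \<eta>_pos by (simp add: powr_mult)
  also have "b powr (1 + \<eta>) = C" using C_pos \<eta>_pos by (simp add: b_def powr_powr)
  finally show ?thesis .
qed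

end

section \<open>One step of the barrier\<close>

text \<open>\<open>e\<close> and \<open>w\<close> diagonalise the current barrier matrix,
  \<open>h\<close> is the tolerated relative loss and \<open>s\<close> the tail scale. With
  \<open>h * \<theta> = 4 * s\<close> and \<open>C \<le> 2 * s\<close>, the term from
  \<open>C\<close> takes at most half of the threshold \<open>h * \<theta>\<close> and the tail term
  \<open>2 * s\<close> takes the other half.\<close>

locale barrier_step = regular_isotropic M C \<eta> for M :: "(real ^ 'n) measure" and C \<eta> +
  fixes e :: "'n \<Rightarrow> real ^ 'n" and w :: "'n \<Rightarrow> real" and \<theta> h s :: real
  assumes e: "orthonormal_family e" and w_pos: "0 < w i"
    and potential: "(\<Sum>i\<in>UNIV. 1 / w i) \<le> 1 / \<theta>" and \<theta>_pos: "0 < \<theta>"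
    and h_pos: "0 < h" and h_le: "h \<le> 1 / 6" and s_def: "h * \<theta> = 4 * s" and C_le: "C \<le> 2 * s"
begin

lemma s_pos: "0 < s" using C_le C_pos by linarith

lemma w_ge: "\<theta> \<le> w i"
proof -
  have "1 / w i \<le> (\<Sum>i\<in>UNIV. 1 / w i)"
    using w_pos by (intro member_le_sum) (auto simp: less_imp_le)
  then have "1 / w i \<le> 1 / \<theta>" using potential by simp
  then show ?thesis using w_pos[of i] \<theta>_pos by (simp add: divide_simps)
qed

text \<open>Vectors of the space outside this set satisfy what the update lemmas ask for: at
  \<open>d = 0\<close> those of \<open>barrier_upper_small\<close> and \<open>barrier_lower\<close>,
  and for \<open>d \<ge> \<theta>\<close> that of \<open>barrier_upper_large\<close>.\<close>

definition heavy :: "real \<Rightarrow> (real ^ 'n) set" where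
  "heavy d = {x \<in> space M. h < (\<Sum>i\<in>UNIV. (x \<bullet> e i)\<^sup>2 / (w i + d)) \<or> h * (\<theta> + d) < weighted_average e w d x}"

lemma heavy_measurable [measurable]: "heavy d \<in> sets M"
  unfolding heavy_def weighted_average_def by measurable

definition avg_weight :: "real \<Rightarrow> 'n \<Rightarrow> real" where
  "avg_weight d i = 1 / (w i * (w i + d)) / (\<Sum>i\<in>UNIV. 1 / (w i * (w i + d)))"

lemma weighted_average_eq: "weighted_average e w d x = (\<Sum>i\<in>UNIV. avg_weight d i * (x \<bullet> e i)\<^sup>2)"
  unfolding weighted_average_def avg_weight_def sum_divide_distrib[of _ UNIV "\<Sum>i\<in>UNIV. _ i"]
  by (intro sum.cong refl) simp

lemma avg_weight:
  assumes "0 \<le> d"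
  shows "0 \<le> avg_weight d i" "(\<Sum>i\<in>UNIV. avg_weight d i) = 1" "avg_weight d i \<le> 1"
proof -
  define p where "p = (\<Sum>i\<in>UNIV. 1 / (w i * (w i + d)))"
  have p: "0 < p" unfolding p_def using weighted_average_mult(2)[of w d] w_pos assms by simp
  have t: "0 \<le> 1 / (w i * (w i + d))" for i using w_pos[of i] assms by simp
  show "0 \<le> avg_weight d i" unfolding avg_weight_def p_def[symmetric] using p t[of i] by (rule divide_nonneg_pos[rotated])
  show "(\<Sum>i\<in>UNIV. avg_weight d i) = 1"
    unfolding avg_weight_def p_def[symmetric] sum_divide_distrib[symmetric] using p by (simp add: p_def[symmetric])
  have "1 / (w i * (w i + d)) \<le> p" unfolding p_def using t by (intro member_le_sum) auto
  then show "avg_weight d i \<le> 1" unfolding avg_weight_def p_def[symmetric] using p by (simp only: divide_le_eq_1_pos)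
qed

lemma weighted_average_tail:
  assumes "0 \<le> d" "0 < r"
  shows "(\<integral>\<^sup>+x. ennreal (max 0 (weighted_average e w d x - C - r)) \<partial>M) \<le> ennreal (C / \<eta> * r powr (- \<eta>))"
  using weighted_tail_integral[OF e avg_weight(1,3)[OF assms(1)] _ assms(2), where \<sigma> = 1] avg_weight(2)[OF assms(1)]
  by (simp add: weighted_average_eq)

lemma integrable_weighted_average: "integrable M (weighted_average e w d)"
  unfolding weighted_average_eq[abs_def] by (rule integrable_weighted_squares)

lemma integral_weighted_average: "0 \<le> d \<Longrightarrow> (\<integral>x. weighted_average e w d x \<partial>M) = 1"
  unfolding weighted_average_eq using integral_weighted_squares[OF e] avg_weight(2) by simp

text \<open>Union bound over the two defects, both with tail parameter
  \<open>h * (\<theta> + d) / 4\<close>. In the first, the weights \<open>1 / (w i + d)\<close> are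
  at most \<open>1 / (\<theta> + d)\<close> and their sum is at most \<open>1 / \<theta>\<close>, so
  the \<open>C\<close> term and the tail term each take at most \<open>h / 2\<close>.\<close>

lemma prob_heavy:
  assumes d: "0 \<le> d"
  shows "prob (heavy d) \<le> 2 * (C / \<eta> * (h * (\<theta> + d) / 4) powr (- 1 - \<eta>))"
proof -
  define r where "r = h * (\<theta> + d) / 4"
  have r: "0 < r" using h_pos \<theta>_pos d by (simp add: r_def)
  have Ch: "C \<le> h * \<theta> / 2" using C_le s_def by simp
  have "C \<le> h * (\<theta> + d) / 2" using Ch h_pos d by (simp add: algebra_simps add_increasing2)
  then have C2: "C * 1 + 2 * r * 1 \<le> h * (\<theta> + d)" by (simp add: r_def)
  have wd: "0 < w i + d" for i using w_pos[of i] d by simp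
  have 1: "prob {x \<in> space M. h < (\<Sum>i\<in>UNIV. 1 / (w i + d) * (x \<bullet> e i)\<^sup>2)} \<le> C / \<eta> * r powr (- 1 - \<eta>)"
  proof (rule weighted_tail_prob[OF e])
    show "0 \<le> 1 / (w i + d)" for i using wd[of i] by simp
    show "1 / (w i + d) \<le> 1 / (\<theta> + d)" for i using w_ge[of i] \<theta>_pos d by (intro divide_left_mono) auto
    have "(\<Sum>i\<in>UNIV. 1 / (w i + d)) \<le> (\<Sum>i\<in>UNIV. 1 / w i)"
      using wd w_pos d by (intro sum_mono divide_left_mono) auto
    then show "(\<Sum>i\<in>UNIV. 1 / (w i + d)) \<le> 1 / \<theta>" using potential by simp
    show "0 < r" by fact
    show "0 < 1 / (\<theta> + d)" using \<theta>_pos d by simp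
    have "C * (1 / \<theta>) \<le> h / 2" using Ch \<theta>_pos by (simp add: field_simps)
    moreover have "\<theta> + d \<noteq> 0" using \<theta>_pos d by simp
    then have "2 * r * (1 / (\<theta> + d)) = h / 2" unfolding r_def by (simp add: divide_simps)
    ultimately show "C * (1 / \<theta>) + 2 * r * (1 / (\<theta> + d)) \<le> h" by linarith
  qed
  have 2: "prob {x \<in> space M. h * (\<theta> + d) < (\<Sum>i\<in>UNIV. avg_weight d i * (x \<bullet> e i)\<^sup>2)} \<le> C / \<eta> * r powr (- 1 - \<eta>)"
    using avg_weight(2)[OF d]
    by (intro weighted_tail_prob[OF e avg_weight(1,3)[OF d] _ r _ C2]) auto
  have "heavy d = {x \<in> space M. h < (\<Sum>i\<in>UNIV. 1 / (w i + d) * (x \<bullet> e i)\<^sup>2)} \<union>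
     {x \<in> space M. h * (\<theta> + d) < (\<Sum>i\<in>UNIV. avg_weight d i * (x \<bullet> e i)\<^sup>2)}"
    unfolding heavy_def weighted_average_eq by auto
  then have "prob (heavy d) \<le> prob {x \<in> space M. h < (\<Sum>i\<in>UNIV. 1 / (w i + d) * (x \<bullet> e i)\<^sup>2)} +
     prob {x \<in> space M. h * (\<theta> + d) < (\<Sum>i\<in>UNIV. avg_weight d i * (x \<bullet> e i)\<^sup>2)}"
    by (simp only:) (intro measure_Un_le; measurable)
  then show ?thesis using 1 2 unfolding r_def by linarith
qed

text \<open>Heavy vectors get no shift, since adding \<open>outer x\<close> can only lower the
  potential. This loses the integral of \<open>weighted_average\<close> over the heavy set, at most
  \<open>7 * K\<close>. The shift is negative because the lower barrier matrix
  \<open>A - l I\<close> shrinks as \<open>l\<close> rises; the factor \<open>-1\<close> brings it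
  into the form used for both barriers.\<close>

lemma shift_exists_lower:
  "\<exists>\<delta>. integrable M \<delta> \<and> (\<integral>x. \<delta> x \<partial>M) \<le> - (1 - 2 * h - 7 * (C / \<eta> * s powr (- \<eta>))) \<and>
     (AE x in M. barrier (1 / \<theta>) (eigen_matrix e w + mat (\<delta> x) - (-1) *\<^sub>R outer x))"
proof -
  define R where "R = weighted_average e w 0"
  define G where "G x = R x * indicator (space M - heavy 0) x" for x
  have Rm [measurable]: "R \<in> borel_measurable M" and Ri: "integrable M R" and R1: "(\<integral>x. R x \<partial>M) = 1"
    using integrable_weighted_average[of 0] integral_weighted_average[of 0] by (auto simp: R_def)
  have R0: "0 \<le> R x" for x unfolding R_def using w_pos by (intro weighted_average_mult(3)) auto
  have Gi: "integrable M G" unfolding G_def by (intro integrable_real_mult_indicator Ri) measurable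
  have Bi: "integrable M (\<lambda>x. R x * indicator (heavy 0) x)" by (intro integrable_real_mult_indicator Ri) measurable
  define K where "K = C / \<eta> * s powr (- \<eta>)"
  have K: "0 \<le> K" using C_pos \<eta>_pos by (simp add: K_def)
  have "ennreal (\<integral>x. R x * indicator (heavy 0) x \<partial>M) = (\<integral>\<^sup>+x. ennreal (R x * indicator (heavy 0) x) \<partial>M)"
    using Bi R0 by (intro nn_integral_eq_integral[symmetric]) auto
  \<comment> \<open>On the heavy set \<open>R\<close> is cut at \<open>3 * s\<close>, which is at
    least \<open>C + s\<close>. The bounded part costs \<open>3 * s * prob (heavy 0)\<close>, at
    most \<open>6 * K\<close>, and the excess at most \<open>K\<close>.\<close>
  also have "\<dots> \<le> (\<integral>\<^sup>+x. ennreal (3 * s) * indicator (heavy 0) x + ennreal (max 0 (R x - C - s)) \<partial>M)"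
  proof (intro nn_integral_mono)
    fix x
    have "R x \<le> 3 * s + max 0 (R x - C - s)" using C_le by simp
    then have "ennreal (R x) \<le> ennreal (3 * s) + ennreal (max 0 (R x - C - s))"
      using s_pos by (subst ennreal_plus[symmetric]) (auto intro: ennreal_leI simp del: ennreal_plus)
    then show "ennreal (R x * indicator (heavy 0) x) \<le> ennreal (3 * s) * indicator (heavy 0) x + ennreal (max 0 (R x - C - s))"
      by (simp add: indicator_def)
  qed
  also have "\<dots> = ennreal (3 * s) * emeasure M (heavy 0) + (\<integral>\<^sup>+x. ennreal (max 0 (R x - C - s)) \<partial>M)"
    by (subst nn_integral_add) (auto simp: nn_integral_cmult)
  also have "\<dots> \<le> ennreal (3 * s) * ennreal (2 * (C / \<eta> * s powr (- 1 - \<eta>))) + ennreal K"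
    using prob_heavy[of 0] weighted_average_tail[of 0 s] s_pos s_def unfolding R_def K_def
    by (intro add_mono mult_left_mono) (auto simp: emeasure_eq_measure intro!: ennreal_leI)
  also have "\<dots> = ennreal (3 * s * (2 * (C / \<eta> * s powr (- 1 - \<eta>))) + K)"
    using s_pos C_pos \<eta>_pos K by (simp add: ennreal_mult[symmetric] ennreal_plus[symmetric] del: ennreal_plus)
  also have "3 * s * (2 * (C / \<eta> * s powr (- 1 - \<eta>))) + K = 7 * K"
    using s_pos by (simp add: K_def powr_diff powr_minus field_simps)
  finally have B: "(\<integral>x. R x * indicator (heavy 0) x \<partial>M) \<le> 7 * K" using K by simp
  have "(\<integral>x. G x \<partial>M) + (\<integral>x. R x * indicator (heavy 0) x \<partial>M) = (\<integral>x. R x \<partial>M)"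
    unfolding Bochner_Integration.integral_add[OF Gi Bi, symmetric]
    by (intro Bochner_Integration.integral_cong) (auto simp: G_def indicator_def)
  then have G1: "1 - 7 * K \<le> (\<integral>x. G x \<partial>M)" using R1 B by linarith
  have "(\<integral>x. G x \<partial>M) \<le> (\<integral>x. R x \<partial>M)"
    by (intro integral_mono Gi Ri) (auto simp: G_def indicator_def R0)
  then have G2: "(\<integral>x. G x \<partial>M) \<le> 1" using R1 by simp
  have G0: "0 \<le> (\<integral>x. G x \<partial>M)" by (intro Bochner_Integration.integral_nonneg) (auto simp: G_def R0)
  define g where "g = (\<integral>x. G x \<partial>M)"
  have "(1 - h)\<^sup>2 = 1 - 2 * h + h\<^sup>2" by (simp add: power2_eq_square algebra_simps)
  then have "(1 - 2 * h) * g \<le> (1 - h)\<^sup>2 * g" using G0 by (intro mult_right_mono) (auto simp: g_def)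
  moreover have "(1 - 2 * h) * g = g - 2 * (h * g)" by (simp add: algebra_simps)
  moreover have "h * g \<le> h * 1" using G2 h_pos by (intro mult_left_mono) (auto simp: g_def)
  ultimately have main: "1 - 2 * h - 7 * K \<le> (1 - h)\<^sup>2 * g" using G1 by (simp add: g_def)
  have bar: "barrier (1 / \<theta>) (eigen_matrix e w + mat (- ((1 - h)\<^sup>2 * G x)) - (-1) *\<^sub>R outer x)" if x: "x \<in> space M" for x
  proof (cases "x \<in> heavy 0")
    case True
    have "barrier (1 / \<theta>) (eigen_matrix e w + 1 *\<^sub>R outer x)"
    proof (rule barrier_rank_one[OF e w_pos])
      have "0 \<le> (\<Sum>i\<in>UNIV. (x \<bullet> e i)\<^sup>2 / w i)" "0 \<le> (\<Sum>i\<in>UNIV. (x \<bullet> e i)\<^sup>2 / (w i)\<^sup>2)"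
        using w_pos by (auto intro!: sum_nonneg simp: less_imp_le)
      then show "0 < 1 + 1 * (\<Sum>i\<in>UNIV. (x \<bullet> e i)\<^sup>2 / w i)"
        "(\<Sum>i\<in>UNIV. 1 / w i) - 1 * (\<Sum>i\<in>UNIV. (x \<bullet> e i)\<^sup>2 / (w i)\<^sup>2) / (1 + 1 * (\<Sum>i\<in>UNIV. (x \<bullet> e i)\<^sup>2 / w i)) \<le> 1 / \<theta>"
        using potential by (auto intro: order_trans[rotated] divide_nonneg_nonneg simp: algebra_simps add_increasing2)
    qed auto
    then show ?thesis using True by (simp add: G_def)
  next
    case False
    then have "(\<Sum>i\<in>UNIV. (x \<bullet> e i)\<^sup>2 / w i) \<le> h" "weighted_average e w 0 x \<le> h * \<theta>"
      using x by (auto simp: heavy_def)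
    from barrier_lower[OF e w_ge \<theta>_pos h_pos _ potential this] h_le
    have "barrier (1 / \<theta>) (eigen_matrix e w - mat ((1 - h)\<^sup>2 * weighted_average e w 0 x) + outer x)" by simp
    moreover have "mat (- c) = - (mat c :: real^'n^'n)" for c by (simp add: mat_def vec_eq_iff)
    ultimately show ?thesis using False x by (simp add: G_def R_def)
  qed
  show ?thesis
    using Gi main bar unfolding K_def
    by (intro exI[of _ "\<lambda>x. - ((1 - h)\<^sup>2 * G x)"]) (auto simp: g_def)
qed

text \<open>Light vectors need the shift \<open>R / (1 - 2 h)\<close>, of expectation about one. Otherwise the barrier moves
  to the first point of the geometric grid \<open>(2 ^ j - 1) \<theta>\<close> at which the vector is no longer heavy;
  the sum below dominates that point.\<close>

lemma shift_exists_upper: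
  "\<exists>\<delta>. integrable M \<delta> \<and> (\<integral>x. \<delta> x \<partial>M) \<le> 1 + 3 * h + 32 * (C * (1 + 1 / \<eta>)\<^sup>2) * s powr (- \<eta>) / h \<and>
     (AE x in M. barrier (1 / \<theta>) (eigen_matrix e w + mat (\<delta> x) - 1 *\<^sub>R outer x))"
proof -
  define R where "R = weighted_average e w 0"
  have Rm [measurable]: "R \<in> borel_measurable M" and Ri: "integrable M R" and R1: "(\<integral>x. R x \<partial>M) = 1"
    using integrable_weighted_average[of 0] integral_weighted_average[of 0] by (auto simp: R_def)
  have R0: "0 \<le> R x" for x unfolding R_def using w_pos by (intro weighted_average_mult(3)) auto
  have h12: "0 < 1 - 2 * h" using h_le by simp
  define d where "d j = (2 ^ j - 1) * \<theta>" for j :: nat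
  have d0: "0 \<le> d j" for j using \<theta>_pos by (simp add: d_def)
  have td: "\<theta> + d j = 2 ^ j * \<theta>" for j by (simp add: d_def algebra_simps)
  \<comment> \<open>Values in \<open>ennreal\<close> admit the series over the whole grid;
    finiteness almost everywhere will follow from its integral. The weight
    \<open>2 ^ (j + 1) * \<theta>\<close> exceeds the next grid point
    \<open>d (j + 1)\<close>.\<close>
  define \<Delta> where "\<Delta> x = ennreal (R x / (1 - 2 * h)) + (\<Sum>j. ennreal (2 ^ (j + 1) * \<theta>) * indicator (heavy (d j)) x)" for x
  have \<Delta>m [measurable]: "\<Delta> \<in> borel_measurable M" unfolding \<Delta>_def by measurable
  define p where "p = 1 + 1 / \<eta>"
  define L where "L = C / \<eta> * s powr (- 1 - \<eta>)"
  have L: "0 \<le> L" using C_pos \<eta>_pos by (simp add: L_def)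
  define r where "r = 2 powr (- \<eta>)"
  have r: "0 < r" "r < 1" using \<eta>_pos by (auto simp: r_def powr_less_one)
  \<comment> \<open>From \<open>2 powr \<eta> \<ge> 1 + \<eta> * ln 2\<close> and
    \<open>ln 2 \<ge> 1 / 2\<close>: summing the geometric series over the grid costs one factor
    \<open>1 + 1 / \<eta>\<close>, up to the constant 2.\<close>
  have rp: "1 / (1 - r) \<le> 2 * p"
  proof -
    have "1 + \<eta> * ln 2 \<le> exp (\<eta> * ln 2)" by (rule exp_ge_add_one_self)
    also have "exp (\<eta> * ln 2) = 1 / r" by (simp add: r_def powr_def exp_minus field_simps)
    finally have a: "(1 + \<eta> * ln 2) * r \<le> 1" using r by (simp add: field_simps)
    have "1 / 2 \<le> ln (2::real)" using ln_add_one_self_le_self2[of 1] ln2_ge_two_thirds by simp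
    then have "(1 + \<eta> * (1 / 2)) * r \<le> (1 + \<eta> * ln 2) * r" using r \<eta>_pos by (intro mult_right_mono) auto
    with a have "(1 + \<eta> / 2) * r \<le> 1" by simp
    moreover have "(1 + \<eta> / 2) * (1 - r) = 1 + \<eta> / 2 - (1 + \<eta> / 2) * r" by (simp only: right_diff_distrib mult_1_right)
    ultimately have "\<eta> / 2 \<le> (1 + \<eta> / 2) * (1 - r)" by linarith
    also have "\<dots> \<le> (1 + \<eta>) * (1 - r)" using r \<eta>_pos by (intro mult_right_mono) auto
    finally show ?thesis using r \<eta>_pos by (simp add: p_def field_simps)
  qed
  \<comment> \<open>The jumps grow like \<open>2 ^ j\<close> while the probabilities decay like
    \<open>(2 ^ j) powr (- 1 - \<eta>)\<close>, so the products are bounded by a geometric series of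
    ratio \<open>r\<close>.\<close>
  have heavy_term: "2 ^ (j + 1) * \<theta> * prob (heavy (d j)) \<le> 4 * \<theta> * L * r ^ j" for j
  proof -
    have "prob (heavy (d j)) \<le> 2 * (C / \<eta> * (s * 2 ^ j) powr (- 1 - \<eta>))"
    proof -
      have "h * (2 ^ j * \<theta>) / 4 = (h * \<theta>) * 2 ^ j / 4" by simp
      also have "\<dots> = s * 2 ^ j" unfolding s_def by simp
      finally have "h * (2 ^ j * \<theta>) / 4 = s * 2 ^ j" .
      then show ?thesis using prob_heavy[OF d0[of j]] unfolding td by (simp only:)
    qed
    also have "(s * 2 ^ j) powr (- 1 - \<eta>) = s powr (- 1 - \<eta>) * (r ^ j / 2 ^ j)"
    proof -
      have "(2 ^ j) powr (- 1 - \<eta>) = (2 powr (- 1 - \<eta>)) ^ j"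
        by (simp add: powr_realpow[symmetric] powr_powr mult.commute powr_power)
      also have "2 powr (- 1 - \<eta>) = r / 2" by (simp add: r_def powr_diff powr_minus field_simps)
      finally show ?thesis using s_pos by (simp add: powr_mult power_divide)
    qed
    finally have "prob (heavy (d j)) \<le> 2 * (L * (r ^ j / 2 ^ j))" by (simp add: L_def mult.assoc)
    then have "2 ^ (j + 1) * \<theta> * prob (heavy (d j)) \<le> 2 ^ (j + 1) * \<theta> * (2 * (L * (r ^ j / 2 ^ j)))"
      using \<theta>_pos by (intro mult_left_mono) auto
    then show ?thesis by simp
  qed
  have "(\<integral>\<^sup>+x. \<Delta> x \<partial>M) = (\<integral>\<^sup>+x. ennreal (R x / (1 - 2 * h)) \<partial>M) +
      (\<Sum>j. \<integral>\<^sup>+x. ennreal (2 ^ (j + 1) * \<theta>) * indicator (heavy (d j)) x \<partial>M)"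
    unfolding \<Delta>_def by (subst nn_integral_add) (auto intro!: nn_integral_suminf)
  also have "(\<integral>\<^sup>+x. ennreal (R x / (1 - 2 * h)) \<partial>M) = ennreal (1 / (1 - 2 * h))"
    using Ri R1 R0 h12 by (subst nn_integral_eq_integral) auto
  also have "(\<Sum>j. \<integral>\<^sup>+x. ennreal (2 ^ (j + 1) * \<theta>) * indicator (heavy (d j)) x \<partial>M)
      \<le> (\<Sum>j. ennreal (4 * \<theta> * L * r ^ j))"
  proof (intro suminf_le allI summableI)
    fix j
    have "(\<integral>\<^sup>+x. ennreal (2 ^ (j + 1) * \<theta>) * indicator (heavy (d j)) x \<partial>M) = ennreal (2 ^ (j + 1) * \<theta> * prob (heavy (d j)))"
      using \<theta>_pos by (subst nn_integral_cmult) (auto simp: emeasure_eq_measure ennreal_mult)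
    then show "(\<integral>\<^sup>+x. ennreal (2 ^ (j + 1) * \<theta>) * indicator (heavy (d j)) x \<partial>M) \<le> ennreal (4 * \<theta> * L * r ^ j)"
      using heavy_term[of j] by (simp add: ennreal_leI)
  qed
  also have "(\<Sum>j. ennreal (4 * \<theta> * L * r ^ j)) = ennreal (4 * \<theta> * L * (1 / (1 - r)))"
    using \<theta>_pos L r by (intro suminf_ennreal_eq sums_mult geometric_sums) auto
  finally have "(\<integral>\<^sup>+x. \<Delta> x \<partial>M) \<le> ennreal (1 / (1 - 2 * h)) + ennreal (4 * \<theta> * L * (1 / (1 - r)))"
    by (simp add: add_left_mono)
  also have "\<dots> = ennreal (1 / (1 - 2 * h) + 4 * \<theta> * L * (1 / (1 - r)))"
    using h12 \<theta>_pos L r by (intro ennreal_plus[symmetric]) auto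
  finally have \<Delta>_int: "(\<integral>\<^sup>+x. \<Delta> x \<partial>M) \<le> ennreal (1 / (1 - 2 * h) + 4 * \<theta> * L * (1 / (1 - r)))" .
  then have "(\<integral>\<^sup>+x. \<Delta> x \<partial>M) < \<infinity>" by (rule order_le_less_trans) simp
  then have fin: "AE x in M. \<Delta> x \<noteq> \<infinity>" by (intro nn_integral_PInf_AE) auto
  \<comment> \<open>\<open>enn2real\<close> is 0 at infinity, a value taken only on a null
    set.\<close>
  define \<delta> where "\<delta> x = enn2real (\<Delta> x)" for x
  have \<delta>_nonneg: "0 \<le> \<delta> x" for x by (simp add: \<delta>_def)
  have \<delta>m [measurable]: "\<delta> \<in> borel_measurable M" unfolding \<delta>_def by measurable
  have "(\<integral>\<^sup>+x. ennreal (\<delta> x) \<partial>M) = (\<integral>\<^sup>+x. \<Delta> x \<partial>M)"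
    using fin by (intro nn_integral_cong_AE) (auto simp: \<delta>_def less_top)
  note \<delta>_int = \<Delta>_int[folded this]
  have \<delta>i: "integrable M \<delta>"
    using \<delta>_int by (intro integrableI_nonneg) (auto simp: \<delta>_nonneg intro: order_le_less_trans)
  have "ennreal (\<integral>x. \<delta> x \<partial>M) = (\<integral>\<^sup>+x. ennreal (\<delta> x) \<partial>M)"
    using \<delta>i \<delta>_nonneg by (intro nn_integral_eq_integral[symmetric]) auto
  with \<delta>_int have "ennreal (\<integral>x. \<delta> x \<partial>M) \<le> ennreal (1 / (1 - 2 * h) + 4 * \<theta> * L * (1 / (1 - r)))" by (simp only:)
  moreover have "0 \<le> 1 / (1 - 2 * h) + 4 * \<theta> * L * (1 / (1 - r))"
    using h12 \<theta>_pos L r by (intro add_nonneg_nonneg mult_nonneg_nonneg) auto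
  ultimately have "(\<integral>x. \<delta> x \<partial>M) \<le> 1 / (1 - 2 * h) + 4 * \<theta> * L * (1 / (1 - r))" by (simp only: ennreal_le_iff)
  also have "1 / (1 - 2 * h) + 4 * \<theta> * L * (1 / (1 - r)) \<le> (1 + 3 * h) + 32 * (C * p\<^sup>2) * s powr (- \<eta>) / h"
  proof (intro add_mono)
    \<comment> \<open>\<open>(1 + 3 * h) * (1 - 2 * h)\<close> equals
      \<open>1 + h * (1 - 6 * h)\<close>; this is where the bound \<open>1 / 6\<close> on
      \<open>h\<close> comes from.\<close>
    have "0 \<le> h * (1 - 6 * h)" using h_pos h_le by simp
    then have "1 \<le> (1 + 3 * h) * (1 - 2 * h)" by (simp add: algebra_simps power2_eq_square)
    then show "1 / (1 - 2 * h) \<le> 1 + 3 * h" using h12 by (simp add: divide_le_eq)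
    have \<theta>: "\<theta> = 4 * s / h" using s_def h_pos by (simp add: field_simps)
    have p0: "0 < p" using \<eta>_pos by (simp add: p_def add_pos_pos)
    have "4 * \<theta> * L * (1 / (1 - r)) \<le> 4 * \<theta> * L * (2 * p)"
      using rp \<theta>_pos L by (intro mult_left_mono) auto
    also have "\<dots> = 32 * (C * (1 / \<eta>) * p) * (s * s powr (- 1 - \<eta>)) / h"
      by (simp add: \<theta> L_def mult_ac)
    also have "s * s powr (- 1 - \<eta>) = s powr (- \<eta>)"
      using s_pos by (simp add: powr_diff powr_minus field_simps)
    also have "32 * (C * (1 / \<eta>) * p) * s powr (- \<eta>) / h \<le> 32 * (C * p * p) * s powr (- \<eta>) / h"
      using C_pos p0 h_pos by (intro divide_right_mono mult_right_mono mult_left_mono) (auto simp: p_def)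
    finally show "4 * \<theta> * L * (1 / (1 - r)) \<le> 32 * (C * p\<^sup>2) * s powr (- \<eta>) / h"
      by (simp add: power2_eq_square mult.assoc)
  qed
  finally have \<delta>_bound: "(\<integral>x. \<delta> x \<partial>M) \<le> 1 + 3 * h + 32 * (C * p\<^sup>2) * s powr (- \<eta>) / h" .
  have bar: "barrier (1 / \<theta>) (eigen_matrix e w + mat (\<delta> x) - 1 *\<^sub>R outer x)" if x: "x \<in> space M" "\<Delta> x \<noteq> \<infinity>" for x
  proof -
    have \<delta>\<Delta>: "ennreal (\<delta> x) = \<Delta> x" using x(2) by (simp add: \<delta>_def less_top)
    note \<delta>0 = \<delta>_nonneg[of x]
    have jump: "2 ^ (j + 1) * \<theta> \<le> \<delta> x" if "x \<in> heavy (d j)" for j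
    proof -
      have "ennreal (2 ^ (j + 1) * \<theta>) = (\<Sum>k\<in>{j}. ennreal (2 ^ (k + 1) * \<theta>) * indicator (heavy (d k)) x)"
        using that by simp
      also have "\<dots> \<le> (\<Sum>k. ennreal (2 ^ (k + 1) * \<theta>) * indicator (heavy (d k)) x)"
        by (intro sum_le_suminf summableI) auto
      also have "\<dots> \<le> \<Delta> x" unfolding \<Delta>_def by (rule add_increasing) auto
      finally show ?thesis using \<delta>0 unfolding \<delta>\<Delta>[symmetric] by simp
    qed
    have mono: ?thesis if "barrier (1 / \<theta>) (eigen_matrix e w + mat c - outer x)" "c \<le> \<delta> x" for c
    proof -
      have "mat c + mat (\<delta> x - c) = (mat (\<delta> x) :: real^'n^'n)" by (simp add: mat_def vec_eq_iff)
      moreover have "barrier (1 / \<theta>) (eigen_matrix e w + mat c - outer x + mat (\<delta> x - c))"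
        using that by (intro barrier_mono) auto
      ultimately show ?thesis by (metis (no_types, opaque_lifting) add.assoc add_diff_eq diff_add_eq scaleR_one)
    qed
    \<comment> \<open>Heaviness at \<open>d k\<close> forces a shift of at least
      \<open>2 ^ (k + 1) * \<theta>\<close>, so a finite shift rules out heaviness at all grid
      points at once, and a least light index exists.\<close>
    obtain k :: nat where "\<delta> x / \<theta> < 2 ^ k" using real_arch_pow[of 2] by auto
    then have "\<delta> x < 2 ^ k * \<theta>" using \<theta>_pos by (simp add: field_simps)
    also have "\<dots> \<le> 2 ^ (k + 1) * \<theta>" using \<theta>_pos by simp
    finally have "x \<notin> heavy (d k)" using jump[of k] by auto
    define j where "j = (LEAST j. x \<notin> heavy (d j))"
    have j: "x \<notin> heavy (d j)" unfolding j_def by (rule LeastI) fact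
    show ?thesis
    proof (cases j)
      case 0
      then have "(\<Sum>i\<in>UNIV. (x \<bullet> e i)\<^sup>2 / w i) \<le> h" "weighted_average e w 0 x \<le> h * \<theta>"
        using j x by (auto simp: heavy_def d_def)
      from barrier_upper_small[OF e w_ge \<theta>_pos h_pos _ potential this] h_le
      have "barrier (1 / \<theta>) (eigen_matrix e w + mat (R x / (1 - 2 * h)) - outer x)" by (simp add: R_def)
      moreover have "ennreal (R x / (1 - 2 * h)) \<le> \<Delta> x" unfolding \<Delta>_def by (rule add_increasing2) auto
      then have "R x / (1 - 2 * h) \<le> \<delta> x" using \<delta>0 unfolding \<delta>\<Delta>[symmetric] by simp
      ultimately show ?thesis by (rule mono)
    next
      case (Suc k)
      then have "x \<in> heavy (d k)" using not_less_Least[of k "\<lambda>j. x \<notin> heavy (d j)"] by (auto simp: j_def)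
      from jump[OF this] have "d j \<le> \<delta> x" using Suc \<theta>_pos by (simp add: d_def algebra_simps)
      moreover have "barrier (1 / \<theta>) (eigen_matrix e w + mat (d j) - outer x)"
      proof (rule barrier_upper_large[OF e w_pos d0 _ potential])
        show "h < 1" using h_le by simp
        show "(\<Sum>i\<in>UNIV. (x \<bullet> e i)\<^sup>2 / (w i + d j)) \<le> h" using j x by (auto simp: heavy_def)
        \<comment> \<open>From index 1 on the grid point is at least \<theta>, so
          \<open>h * (\<theta> + d j)\<close> is at most \<open>2 * h * d j\<close>, which stays
          within \<open>(1 - h) * d j\<close>.\<close>
        have "(1::real) \<le> 2 ^ k" by simp
        then have "1 * \<theta> \<le> 2 ^ k * \<theta>" using \<theta>_pos by (intro mult_right_mono) auto
        then have "\<theta> \<le> d j" using Suc by (simp add: d_def algebra_simps)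
        have "weighted_average e w (d j) x \<le> h * (\<theta> + d j)" using j x by (auto simp: heavy_def)
        also have "\<dots> \<le> h * (d j + d j)" using \<open>\<theta> \<le> d j\<close> h_pos by simp
        also have "\<dots> = (2 * h) * d j" by simp
        also have "\<dots> \<le> (1 - h) * d j" using h_le d0 by (intro mult_right_mono) auto
        finally show "weighted_average e w (d j) x \<le> (1 - h) * d j" .
      qed
      ultimately show ?thesis using mono by blast
    qed
  qed
  have "AE x in M. barrier (1 / \<theta>) (eigen_matrix e w + mat (\<delta> x) - 1 *\<^sub>R outer x)"
    using fin AE_space by eventually_elim (rule bar)
  then show ?thesis using \<delta>i \<delta>_bound unfolding p_def by blast
qed

end

section \<open>Extreme eigenvalues of sums of independent rank-one matrices\<close>

text \<open>The largest eigenvalue, for symmetric \<open>A\<close>. As a supremum of quadratic forms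
  it is 1-Lipschitz, hence measurable, and it is equivariant under adding multiples of the identity,
  all without diagonalising a random matrix.\<close>

definition rayleigh_sup :: "real ^ 'n ^ 'n \<Rightarrow> real" where
  "rayleigh_sup A = (SUP v\<in>sphere 0 1. v \<bullet> (A *v v))"

lemma norm_matrix_vector_mult_le:
  fixes A :: "real ^ 'n ^ 'm"
  shows "norm (A *v x) \<le> norm A * norm x"
proof -
  have "norm (A *v x) = L2_set (\<lambda>i. norm (A $ i \<bullet> x)) UNIV"
    by (simp add: norm_vec_def matrix_vector_mul_component)
  also have "\<dots> \<le> L2_set (\<lambda>i. norm (A $ i) * norm x) UNIV"
    by (intro L2_set_mono) (auto simp: Cauchy_Schwarz_ineq2)
  also have "\<dots> = norm A * norm x"
    by (simp add: norm_vec_def L2_set_left_distrib)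
  finally show ?thesis .
qed

lemma abs_quadratic_form_le:
  fixes A :: "real ^ 'n ^ 'n"
  shows "norm v = 1 \<Longrightarrow> \<bar>v \<bullet> (A *v v)\<bar> \<le> norm A"
  using Cauchy_Schwarz_ineq2[of v "A *v v"] norm_matrix_vector_mult_le[of A v] by simp

lemma quadratic_form_le:
  fixes A :: "real ^ 'n ^ 'n"
  shows "norm v = 1 \<Longrightarrow> v \<bullet> (A *v v) \<le> norm A"
  using abs_quadratic_form_le[of v A] by simp

lemma bdd_above_rayleigh:
  fixes A :: "real ^ 'n ^ 'n"
  shows "bdd_above ((\<lambda>v. v \<bullet> (A *v v)) ` sphere 0 1)"
  by (rule bdd_aboveI[of _ "norm A"]) (auto simp: quadratic_form_le)

lemma rayleigh_sup_upper: "norm v = 1 \<Longrightarrow> v \<bullet> (A *v v) \<le> rayleigh_sup A"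
  unfolding rayleigh_sup_def by (rule cSUP_upper[OF _ bdd_above_rayleigh]) auto

lemma rayleigh_sup_least:
  fixes A :: "real ^ 'n ^ 'n"
  assumes "\<And>v. norm v = 1 \<Longrightarrow> v \<bullet> (A *v v) \<le> c"
  shows "rayleigh_sup A \<le> c"
  unfolding rayleigh_sup_def
proof (rule cSUP_least)
  obtain v :: "real ^ 'n" where "norm v = 1" using vector_choose_size[of 1] by auto
  then show "sphere (0 :: real ^ 'n) 1 \<noteq> {}" by auto
qed (use assms in auto)

lemma quadratic_form_le_rayleigh_sup:
  fixes A :: "real ^ 'n ^ 'n"
  shows "v \<bullet> (A *v v) \<le> rayleigh_sup A * (norm v)\<^sup>2"
proof (cases "v = 0")
  case False
  have "(v /\<^sub>R norm v) \<bullet> (A *v (v /\<^sub>R norm v)) \<le> rayleigh_sup A"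
    using False by (intro rayleigh_sup_upper) auto
  then have "(v \<bullet> (A *v v)) / (norm v)\<^sup>2 \<le> rayleigh_sup A"
    by (simp add: matrix_vector_mult_scaleR power2_eq_square field_simps)
  then show ?thesis using False by (simp add: divide_le_eq)
qed simp

lemma mat_mult: "mat c *v x = c *\<^sub>R (x :: real ^ 'n)"
proof -
  have "mat c = c *\<^sub>R (mat 1 :: real ^ 'n ^ 'n)" by (simp add: mat_def vec_eq_iff)
  then show ?thesis by (simp add: scaleR_matrix_vector_assoc[symmetric])
qed

lemma rayleigh_sup_shift:
  fixes A :: "real ^ 'n ^ 'n"
  shows "rayleigh_sup (A + mat c) = rayleigh_sup A + c"
proof (rule antisym)
  show "rayleigh_sup (A + mat c) \<le> rayleigh_sup A + c"
    by (intro rayleigh_sup_least)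
      (simp add: matrix_vector_mult_add_rdistrib mat_mult inner_add_right rayleigh_sup_upper norm_eq_1)
  have "rayleigh_sup A \<le> rayleigh_sup (A + mat c) - c"
  proof (rule rayleigh_sup_least)
    fix v :: "real ^ 'n" assume v: "norm v = 1"
    show "v \<bullet> (A *v v) \<le> rayleigh_sup (A + mat c) - c"
      using rayleigh_sup_upper[OF v, of "A + mat c"] v
      by (simp add: matrix_vector_mult_add_rdistrib mat_mult inner_add_right norm_eq_1)
  qed
  then show "rayleigh_sup A + c \<le> rayleigh_sup (A + mat c)" by simp
qed

lemma rayleigh_sup_scaleR:
  fixes A :: "real ^ 'n ^ 'n"
  assumes "0 < c"
  shows "rayleigh_sup (c *\<^sub>R A) = c * rayleigh_sup A"
proof (rule antisym)
  show "rayleigh_sup (c *\<^sub>R A) \<le> c * rayleigh_sup A"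
    using assms by (intro rayleigh_sup_least) (simp add: scaleR_matrix_vector_assoc[symmetric] rayleigh_sup_upper)
  have "rayleigh_sup A \<le> rayleigh_sup (c *\<^sub>R A) / c"
  proof (rule rayleigh_sup_least)
    fix v :: "real ^ 'n" assume v: "norm v = 1"
    show "v \<bullet> (A *v v) \<le> rayleigh_sup (c *\<^sub>R A) / c"
      using rayleigh_sup_upper[OF v, of "c *\<^sub>R A"] assms
      by (simp add: scaleR_matrix_vector_assoc[symmetric] field_simps)
  qed
  then show "c * rayleigh_sup A \<le> rayleigh_sup (c *\<^sub>R A)" using assms by (simp add: field_simps)
qed

lemma rayleigh_sup_lipschitz:
  fixes A :: "real ^ 'n ^ 'n"
  shows "rayleigh_sup A \<le> rayleigh_sup B + norm (A - B)"
proof (rule rayleigh_sup_least)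
  fix v :: "real ^ 'n" assume v: "norm v = 1"
  have "v \<bullet> (A *v v) = v \<bullet> (B *v v) + v \<bullet> ((A - B) *v v)"
    by (simp add: matrix_vector_mult_diff_rdistrib inner_diff_right)
  then show "v \<bullet> (A *v v) \<le> rayleigh_sup B + norm (A - B)"
    using rayleigh_sup_upper[OF v, of B] quadratic_form_le[OF v, of "A - B"] by simp
qed

lemma abs_rayleigh_sup_le: "\<bar>rayleigh_sup (A :: real ^ 'n ^ 'n)\<bar> \<le> norm A"
proof -
  obtain v :: "real ^ 'n" where v: "norm v = 1" using vector_choose_size[of 1] by auto
  have "- norm A \<le> rayleigh_sup A"
    using abs_quadratic_form_le[OF v, of A] rayleigh_sup_upper[OF v, of A] by linarith
  moreover have "rayleigh_sup A \<le> norm A" by (intro rayleigh_sup_least quadratic_form_le)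
  ultimately show ?thesis by simp
qed

lemma lipschitz_borel_measurable:
  fixes f :: "'a :: euclidean_space \<Rightarrow> real"
  assumes "\<And>x y. f x \<le> f y + norm (x - y)"
  shows "f \<in> borel_measurable borel"
proof -
  have "\<bar>f x - f y\<bar> \<le> norm (x - y)" for x y
    using assms[of x y] assms[of y x] by (simp add: norm_minus_commute abs_le_iff)
  then have "1-lipschitz_on UNIV f" by (intro lipschitz_onI) (auto simp: dist_norm)
  then have "continuous_on UNIV f" by (rule lipschitz_on_continuous_on)
  then show ?thesis by (rule borel_measurable_continuous_onI)
qed

lemma rayleigh_sup_measurable [measurable]: "rayleigh_sup \<in> borel_measurable borel"
  by (rule lipschitz_borel_measurable) (rule rayleigh_sup_lipschitz)

lemma rayleigh_sup_minus_barrier: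
  fixes B :: "real ^ 'n ^ 'n"
  assumes "barrier \<phi> B"
  shows "rayleigh_sup (- B) \<le> 0"
proof -
  obtain e w where e: "orthonormal_family e" and B: "B = eigen_matrix e w" and w: "\<And>i. 0 < w i"
    using assms unfolding barrier_def by blast
  show ?thesis
  proof (rule rayleigh_sup_least)
    fix v :: "real ^ 'n"
    have "(- B) *v v = - (B *v v)" using matrix_vector_mult_diff_rdistrib[of 0 B v] by simp
    moreover have "0 \<le> v \<bullet> (B *v v)" unfolding B quadratic_eigen_matrix[OF e]
      using w by (intro sum_nonneg) (auto simp: less_imp_le)
    ultimately show "v \<bullet> ((- B) *v v) \<le> 0" by simp
  qed
qed

lemma norm_outer: "norm (outer x) = (norm x)\<^sup>2"
proof -
  have "norm (outer x $ i) = \<bar>x $ i\<bar> * norm x" for i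
  proof -
    have "outer x $ i = (x $ i) *\<^sub>R x" by (simp add: outer_def vec_eq_iff)
    then show ?thesis by simp
  qed
  then have "norm (outer x) = L2_set (\<lambda>i. \<bar>x $ i\<bar> * norm x) UNIV" by (simp add: norm_vec_def[of "outer x"])
  also have "\<dots> = norm x * norm x"
    by (simp add: norm_vec_def[of x] L2_set_left_distrib)
  finally show ?thesis by (simp add: power2_eq_square)
qed

lemma outer_measurable [measurable]: "outer \<in> borel_measurable borel"
proof -
  have "continuous_on UNIV (outer :: real ^ 'n \<Rightarrow> _)"
    unfolding outer_def by (intro continuous_intros)
  then show ?thesis by (rule borel_measurable_continuous_onI)
qed

section \<open>Iterating the barrier over a product measure\<close>

lemma (in prob_space) integrable_PiM_component:
  fixes f :: "'a \<Rightarrow> real"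
  assumes "finite I" "i \<in> I" "integrable M f"
  shows "integrable (Pi\<^sub>M I (\<lambda>_. M)) (\<lambda>\<omega>. f (\<omega> i))"
proof -
  have "distr (Pi\<^sub>M I (\<lambda>_. M)) M (\<lambda>\<omega>. \<omega> i) = M"
    using assms by (intro distr_PiM_component) (auto intro: prob_space_axioms)
  then have "integrable (distr (Pi\<^sub>M I (\<lambda>_. M)) M (\<lambda>\<omega>. \<omega> i)) f" using assms by simp
  then show ?thesis using assms by (subst (asm) integrable_distr_eq) auto
qed

text \<open>Induction over \<open>I\<close> for all starting matrices at once. The vector integrated
  last is the one whose update is applied first, so for a fixed \<open>B\<close> a single shift
  function is chosen, and the induction hypothesis is used pointwise at
  \<open>B + mat (\<delta> x) - \<sigma> *\<^sub>R outer x\<close>. This avoids a measurable choice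
  of shifts along the whole history.\<close>

lemma barrier_iterate:
  fixes M :: "(real ^ 'n) measure"
  assumes "prob_space M" and sets_M [measurable_cong]: "sets M = sets borel"
    and int: "integrable M (\<lambda>x. (norm x)\<^sup>2)"
    and step: "\<And>B. barrier \<phi> B \<Longrightarrow> \<exists>\<delta>. integrable M \<delta> \<and> (\<integral>x. \<delta> x \<partial>M) \<le> c \<and>
      (AE x in M. barrier \<phi> (B + mat (\<delta> x) - \<sigma> *\<^sub>R outer x))"
    and "finite I" and "barrier \<phi> B"
  shows "(\<integral>\<omega>. rayleigh_sup (\<sigma> *\<^sub>R (\<Sum>i\<in>I. outer (\<omega> i)) - B) \<partial>Pi\<^sub>M I (\<lambda>_. M)) \<le> real (card I) * c"
  using assms(5,6)
proof (induction I arbitrary: B rule: finite_induct)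
  case empty
  interpret prob_space "Pi\<^sub>M {} (\<lambda>_. M)" by (intro prob_space_PiM assms(1))
  show ?case using rayleigh_sup_minus_barrier[OF empty] by (simp add: prob_space)
next
  case (insert k I B)
  interpret prob_space M by fact
  interpret product_sigma_finite "\<lambda>_. M" by standard
  interpret PI: prob_space "Pi\<^sub>M I (\<lambda>_. M)" by (intro prob_space_PiM) (rule prob_space_axioms)
  define F where "F x \<omega> = rayleigh_sup (\<sigma> *\<^sub>R (outer x + (\<Sum>i\<in>I. outer (\<omega> i))) - B)" for x \<omega>
  have [measurable]: "case_prod F \<in> borel_measurable (M \<Otimes>\<^sub>M Pi\<^sub>M I (\<lambda>_. M))"
    unfolding F_def by measurable
  \<comment> \<open>A dominating function linear in the squared norms supplies all integrability
    below, both in each variable and on the product.\<close>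
  have F_le: "\<bar>F x \<omega>\<bar> \<le> \<bar>\<sigma>\<bar> * (norm x)\<^sup>2 + (\<bar>\<sigma>\<bar> * (\<Sum>i\<in>I. (norm (\<omega> i))\<^sup>2) + norm B)" for x \<omega>
  proof -
    have "\<bar>F x \<omega>\<bar> \<le> norm (\<sigma> *\<^sub>R (outer x + (\<Sum>i\<in>I. outer (\<omega> i))) - B)"
      unfolding F_def by (rule abs_rayleigh_sup_le)
    also have "\<dots> \<le> \<bar>\<sigma>\<bar> * norm (outer x + (\<Sum>i\<in>I. outer (\<omega> i))) + norm B"
      using norm_triangle_ineq4[of "\<sigma> *\<^sub>R (outer x + (\<Sum>i\<in>I. outer (\<omega> i)))" B] by simp
    finally have 1: "\<bar>F x \<omega>\<bar> \<le> \<bar>\<sigma>\<bar> * norm (outer x + (\<Sum>i\<in>I. outer (\<omega> i))) + norm B" .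
    have "norm (outer x + (\<Sum>i\<in>I. outer (\<omega> i))) \<le> (norm x)\<^sup>2 + (\<Sum>i\<in>I. (norm (\<omega> i))\<^sup>2)"
      by (rule order_trans[OF norm_triangle_ineq])
        (auto simp: norm_outer intro!: order_trans[OF norm_sum])
    then have "\<bar>\<sigma>\<bar> * norm (outer x + (\<Sum>i\<in>I. outer (\<omega> i))) \<le> \<bar>\<sigma>\<bar> * ((norm x)\<^sup>2 + (\<Sum>i\<in>I. (norm (\<omega> i))\<^sup>2))"
      by (rule mult_left_mono) simp
    with 1 show ?thesis by (simp add: distrib_left)
  qed
  define S where "S \<omega> = \<bar>\<sigma>\<bar> * (\<Sum>i\<in>I. (norm (\<omega> i))\<^sup>2) + norm B" for \<omega> :: "_ \<Rightarrow> real ^ 'n"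
  have F_le_S: "\<bar>F x \<omega>\<bar> \<le> \<bar>\<sigma>\<bar> * (norm x)\<^sup>2 + S \<omega>" for x \<omega> using F_le unfolding S_def .
  have S: "integrable (Pi\<^sub>M I (\<lambda>_. M)) S" unfolding S_def
    using integrable_PiM_component[OF insert.hyps(1) _ int] by (intro Bochner_Integration.integrable_add integrable_mult_right Bochner_Integration.integrable_sum) auto
  have FI: "integrable (Pi\<^sub>M I (\<lambda>_. M)) (F x)" if "x \<in> space M" for x
  proof (rule Bochner_Integration.integrable_bound)
    show "integrable (Pi\<^sub>M I (\<lambda>_. M)) (\<lambda>\<omega>. \<bar>\<sigma>\<bar> * (norm x)\<^sup>2 + S \<omega>)" using S by simp
    show "F x \<in> borel_measurable (Pi\<^sub>M I (\<lambda>_. M))" unfolding F_def by measurable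
    show "AE \<omega> in Pi\<^sub>M I (\<lambda>_. M). norm (F x \<omega>) \<le> norm (\<bar>\<sigma>\<bar> * (norm x)\<^sup>2 + S \<omega>)"
      using F_le_S unfolding real_norm_def by (intro AE_I2) (meson abs_ge_self order_trans)
  qed
  define G where "G x = (\<integral>\<omega>. F x \<omega> \<partial>Pi\<^sub>M I (\<lambda>_. M))" for x
  have Gm [measurable]: "G \<in> borel_measurable M" unfolding G_def by measurable
  have Gi: "integrable M G"
  proof (rule Bochner_Integration.integrable_bound)
    show "integrable M (\<lambda>x. \<bar>\<sigma>\<bar> * (norm x)\<^sup>2 + (\<integral>\<omega>. S \<omega> \<partial>Pi\<^sub>M I (\<lambda>_. M)))" using int by simp
    show "AE x in M. norm (G x) \<le> norm (\<bar>\<sigma>\<bar> * (norm x)\<^sup>2 + (\<integral>\<omega>. S \<omega> \<partial>Pi\<^sub>M I (\<lambda>_. M)))"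
    proof (intro AE_I2)
      fix x assume x: "x \<in> space M"
      have "\<bar>G x\<bar> \<le> (\<integral>\<omega>. \<bar>F x \<omega>\<bar> \<partial>Pi\<^sub>M I (\<lambda>_. M))" unfolding G_def by (rule integral_abs_bound)
      also have "\<dots> \<le> (\<integral>\<omega>. \<bar>\<sigma>\<bar> * (norm x)\<^sup>2 + S \<omega> \<partial>Pi\<^sub>M I (\<lambda>_. M))"
        using FI[OF x] S F_le_S by (intro integral_mono) auto
      also have "\<dots> = \<bar>\<sigma>\<bar> * (norm x)\<^sup>2 + (\<integral>\<omega>. S \<omega> \<partial>Pi\<^sub>M I (\<lambda>_. M))"
        using S by (simp add: PI.prob_space)
      finally show "norm (G x) \<le> norm (\<bar>\<sigma>\<bar> * (norm x)\<^sup>2 + (\<integral>\<omega>. S \<omega> \<partial>Pi\<^sub>M I (\<lambda>_. M)))"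
        unfolding real_norm_def by (meson abs_ge_self order_trans)
    qed
  qed simp
  obtain \<delta> where \<delta>: "integrable M \<delta>" "(\<integral>x. \<delta> x \<partial>M) \<le> c"
    "AE x in M. barrier \<phi> (B + mat (\<delta> x) - \<sigma> *\<^sub>R outer x)" using step[OF insert.prems] by blast
  have "AE x in M. G x \<le> \<delta> x + real (card I) * c"
    using \<delta>(3) AE_space
  proof eventually_elim
    case (elim x)
    \<comment> \<open>The matrix inside is unchanged: subtracting the updated barrier matrix removes
      an extra \<open>mat (\<delta> x)\<close>, which shift equivariance returns as the summand
      \<open>\<delta> x\<close>.\<close>
    have "F x \<omega> = rayleigh_sup (\<sigma> *\<^sub>R (\<Sum>i\<in>I. outer (\<omega> i)) - (B + mat (\<delta> x) - \<sigma> *\<^sub>R outer x)) + \<delta> x" for \<omega>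
      unfolding F_def rayleigh_sup_shift[symmetric] by (rule arg_cong[where f = rayleigh_sup]) (simp add: algebra_simps)
    note F_eq = this
    have "integrable (Pi\<^sub>M I (\<lambda>_. M)) (\<lambda>\<omega>. F x \<omega> - \<delta> x)" using FI[OF elim(2)] by simp
    then have "integrable (Pi\<^sub>M I (\<lambda>_. M)) (\<lambda>\<omega>. rayleigh_sup (\<sigma> *\<^sub>R (\<Sum>i\<in>I. outer (\<omega> i)) - (B + mat (\<delta> x) - \<sigma> *\<^sub>R outer x)))"
      by (simp add: F_eq)
    then have "G x = (\<integral>\<omega>. rayleigh_sup (\<sigma> *\<^sub>R (\<Sum>i\<in>I. outer (\<omega> i)) - (B + mat (\<delta> x) - \<sigma> *\<^sub>R outer x)) \<partial>Pi\<^sub>M I (\<lambda>_. M)) + \<delta> x"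
      unfolding G_def F_eq by (simp add: PI.prob_space)
    then show ?case using insert.IH[OF elim(1)] by simp
  qed
  then have "(\<integral>x. G x \<partial>M) \<le> (\<integral>x. \<delta> x + real (card I) * c \<partial>M)"
    using Gi \<delta>(1) by (intro integral_mono_AE) auto
  also have "\<dots> \<le> c + real (card I) * c" using \<delta> by (simp add: prob_space)
  finally have bound: "(\<integral>x. G x \<partial>M) \<le> c + real (card I) * c" .
  define H where "H \<omega> = rayleigh_sup (\<sigma> *\<^sub>R (\<Sum>i\<in>insert k I. outer (\<omega> i)) - B)" for \<omega>
  have Hi: "integrable (Pi\<^sub>M (insert k I) (\<lambda>_. M)) H"
  proof (rule Bochner_Integration.integrable_bound)
    have kI: "finite (insert k I)" using insert.hyps by simp
    show "integrable (Pi\<^sub>M (insert k I) (\<lambda>_. M)) (\<lambda>\<omega>. \<bar>\<sigma>\<bar> * (norm (\<omega> k))\<^sup>2 + S \<omega>)" unfolding S_def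
      using integrable_PiM_component[OF kI _ int] prob_space.prob_space[OF prob_space_PiM, of "insert k I" "\<lambda>_. M"]
      by (intro Bochner_Integration.integrable_add integrable_mult_right Bochner_Integration.integrable_sum finite_measure.integrable_const
          prob_space.finite_measure prob_space_PiM prob_space_axioms) auto
    show "H \<in> borel_measurable (Pi\<^sub>M (insert k I) (\<lambda>_. M))" unfolding H_def by measurable
    have "H \<omega> = F (\<omega> k) \<omega>" for \<omega> using insert.hyps by (simp add: H_def F_def)
    then show "AE \<omega> in Pi\<^sub>M (insert k I) (\<lambda>_. M). norm (H \<omega>) \<le> norm (\<bar>\<sigma>\<bar> * (norm (\<omega> k))\<^sup>2 + S \<omega>)"
      using F_le_S unfolding real_norm_def by (intro AE_I2) (metis abs_ge_self order_trans)
  qed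
  have "(\<integral>\<omega>. H \<omega> \<partial>Pi\<^sub>M (insert k I) (\<lambda>_. M)) =
      (\<integral>x. (\<integral>y. H (merge {k} I (x, y)) \<partial>Pi\<^sub>M I (\<lambda>_. M)) \<partial>Pi\<^sub>M {k} (\<lambda>_. M))"
    using product_integral_fold[of "{k}" I H] insert.hyps Hi by simp
  also have "\<dots> = (\<integral>x. G (x k) \<partial>Pi\<^sub>M {k} (\<lambda>_. M))"
  proof -
    have "H (merge {k} I (x, y)) = F (x k) y" for x y
    proof -
      have "(\<Sum>i\<in>I. outer (merge {k} I (x, y) i)) = (\<Sum>i\<in>I. outer (y i))"
        using insert.hyps by (intro sum.cong) (auto simp: merge_def)
      then show ?thesis using insert.hyps by (simp add: H_def F_def merge_def)
    qed
    then show ?thesis by (simp add: G_def)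
  qed
  also have "\<dots> = (\<integral>x. G x \<partial>M)" by (rule product_integral_singleton) simp
  finally have "(\<integral>\<omega>. H \<omega> \<partial>Pi\<^sub>M (insert k I) (\<lambda>_. M)) \<le> c + real (card I) * c" using bound by simp
  then show ?case using insert.hyps by (simp add: H_def[abs_def] algebra_simps)
qed

section \<open>The isotropic case\<close>

lemma (in prob_space) expectation_sum_square_indep:
  fixes X :: "'i \<Rightarrow> 'a \<Rightarrow> real"
  assumes fin: "finite I" and ind: "indep_vars (\<lambda>_. borel) X I"
    and int: "\<And>i. i \<in> I \<Longrightarrow> integrable M (X i)" and sq: "\<And>i. i \<in> I \<Longrightarrow> integrable M (\<lambda>\<omega>. (X i \<omega>)\<^sup>2)"
    and mean: "\<And>i. i \<in> I \<Longrightarrow> expectation (X i) = 0"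
  shows "integrable M (\<lambda>\<omega>. (\<Sum>i\<in>I. X i \<omega>)\<^sup>2)"
    and "expectation (\<lambda>\<omega>. (\<Sum>i\<in>I. X i \<omega>)\<^sup>2) = (\<Sum>i\<in>I. expectation (\<lambda>\<omega>. (X i \<omega>)\<^sup>2))"
proof -
  have sum_eq: "(\<Sum>i\<in>I. X i \<omega>)\<^sup>2 = (\<Sum>i\<in>I. \<Sum>j\<in>I. X i \<omega> * X j \<omega>)" for \<omega>
    by (simp add: power2_eq_square sum_product)
  have prod: "integrable M (\<lambda>\<omega>. X i \<omega> * X j \<omega>) \<and>
      expectation (\<lambda>\<omega>. X i \<omega> * X j \<omega>) = (if i = j then expectation (\<lambda>\<omega>. (X i \<omega>)\<^sup>2) else 0)"
    if ij: "i \<in> I" "j \<in> I" for i j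
  proof (cases "i = j")
    case True
    then show ?thesis using sq[OF ij(1)] by (simp add: power2_eq_square)
  next
    case False
    have ind2: "indep_vars (\<lambda>_. borel) X {i, j}" using ind by (rule indep_vars_subset) (use ij in auto)
    have int2: "\<And>k. k \<in> {i, j} \<Longrightarrow> integrable M (X k)" using int ij by auto
    have "integrable M (\<lambda>\<omega>. \<Prod>k\<in>{i, j}. X k \<omega>)"
      using ind2 int2 by (intro indep_vars_integrable) auto
    moreover have "expectation (\<lambda>\<omega>. \<Prod>k\<in>{i, j}. X k \<omega>) = (\<Prod>k\<in>{i, j}. expectation (X k))"
      using ind2 int2 by (intro indep_vars_lebesgue_integral) auto
    ultimately show ?thesis using False mean ij by simp
  qed
  show "integrable M (\<lambda>\<omega>. (\<Sum>i\<in>I. X i \<omega>)\<^sup>2)"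
    unfolding sum_eq using prod by (intro Bochner_Integration.integrable_sum) auto
  have "expectation (\<lambda>\<omega>. (\<Sum>i\<in>I. X i \<omega>)\<^sup>2) = (\<Sum>i\<in>I. \<Sum>j\<in>I. expectation (\<lambda>\<omega>. X i \<omega> * X j \<omega>))"
    unfolding sum_eq using prod
    by (subst Bochner_Integration.integral_sum) (auto intro!: sum.cong Bochner_Integration.integral_sum Bochner_Integration.integrable_sum)
  also have "\<dots> = (\<Sum>i\<in>I. \<Sum>j\<in>I. if i = j then expectation (\<lambda>\<omega>. (X i \<omega>)\<^sup>2) else 0)"
    using prod by (intro sum.cong) auto
  also have "\<dots> = (\<Sum>i\<in>I. expectation (\<lambda>\<omega>. (X i \<omega>)\<^sup>2))"
    using fin by (simp add: sum.delta)
  finally show "expectation (\<lambda>\<omega>. (\<Sum>i\<in>I. X i \<omega>)\<^sup>2) = (\<Sum>i\<in>I. expectation (\<lambda>\<omega>. (X i \<omega>)\<^sup>2))" .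
qed

text \<open>In logarithms both claims are linear in \<open>ln C\<close>, \<open>ln p\<close> and
  \<open>ln \<epsilon>\<close>, with coefficients depending on \<eta>. A negative
  \<open>ln C\<close> is controlled by \<open>lower\<close>, and
  \<open>ln p \<le> 1 / \<eta>\<close> lets the constants 48 and 6 absorb the rest. The number 2084
  is \<open>4 * (512 + 7 + 2)\<close>, so that the tail errors of the isotropic bound add up to at
  most \<open>\<epsilon> / 4\<close>.\<close>

lemma sample_size_estimates:
  fixes C \<eta> \<epsilon> p s :: real
  assumes C: "0 < C" and \<eta>: "0 < \<eta>" and \<epsilon>: "0 < \<epsilon>" "\<epsilon> < 1" and p: "p = 1 + 1 / \<eta>"
    and lower: "1 \<le> C * p powr (1 + \<eta>)"
    and s: "s = 1 / 2 * ((48 * C) powr (2 + 2 / \<eta>) * (6 * p) powr (1 + 4 / \<eta>) * \<epsilon> powr (- (2 / \<eta>)))"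
  shows "C \<le> 2 * s" and "2084 * (C * p\<^sup>2) \<le> \<epsilon>\<^sup>2 * s powr \<eta>"
proof -
  define i where "i = 1 / \<eta>"
  define c where "c = ln C"
  define l where "l = ln p"
  define a where "a = ln (48::real)"
  define b where "b = ln (6::real)"
  define E where "E = - ln \<epsilon>"
  have i: "0 < i" "\<eta> * i = 1" using \<eta> by (simp_all add: i_def)
  have p1: "1 < p" using i by (simp add: p i_def)
  have l0: "0 \<le> l" using p1 by (simp add: l_def)
  have li: "l \<le> i" using ln_add_one_self_le_self[of i] i by (simp add: l_def p i_def)
  have \<eta>l: "\<eta> * l \<le> 1" using mult_left_mono[OF li, of \<eta>] \<eta> i by simp
  have E: "0 \<le> E" using \<epsilon> by (simp add: E_def)
  have e1: "exp 1 \<le> (3::real)" by (rule exp_le)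
  have a3: "3 \<le> a"
  proof -
    have "exp (3::real) = exp 1 ^ 3" by (simp add: exp_of_nat_mult[symmetric])
    also have "\<dots> \<le> 3 ^ 3" using e1 by (intro power_mono) auto
    also have "\<dots> \<le> (48::real)" by simp
    finally show ?thesis by (simp add: a_def ln_ge_iff)
  qed
  have b1: "1 \<le> b" using e1 by (simp add: b_def ln_ge_iff)
  have "0 \<le> ln (C * p powr (1 + \<eta>))" using lower by simp
  then have c: "- ((1 + \<eta>) * l) \<le> c" using C p1 by (simp add: ln_mult ln_powr c_def l_def)
  have s0: "0 < s" using C \<epsilon> p1 by (simp add: s)
  have "2 * s = (48 * C) powr (2 + 2 / \<eta>) * (6 * p) powr (1 + 4 / \<eta>) * \<epsilon> powr (- (2 / \<eta>))" by (simp add: s)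
  then have "ln (2 * s) = (2 + 2 * i) * (a + c) + (1 + 4 * i) * (b + l) + 2 * i * E"
    using C \<epsilon> p1 by (simp add: ln_mult ln_powr a_def b_def c_def l_def E_def i_def)
  note ln_s = this
  have "c \<le> ln (2 * s)"
  proof -
    \<comment> \<open>Besides one copy of \<open>c\<close>, \<open>ln (2 * s)\<close> contains
      \<open>(1 + 2 * i) * c\<close>, which may be negative; \<open>lower\<close> bounds it from
      below by multiples of \<open>l\<close>.\<close>
    have "(1 + 2 * i) * (- ((1 + \<eta>) * l)) \<le> (1 + 2 * i) * c" using c i by (intro mult_left_mono) auto
    moreover have "i * (\<eta> * l) = l" using i(2) by (metis mult.assoc mult.commute mult_1)
    moreover have "(1 + 2 * i) * (- ((1 + \<eta>) * l)) = - (l + \<eta> * l + 2 * (i * l) + 2 * (i * (\<eta> * l)))"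
      "(1 + 2 * i) * c = c + 2 * (i * c)" by (simp_all add: algebra_simps)
    ultimately have "- (3 * l + \<eta> * l + 2 * (i * l)) \<le> c + 2 * (i * c)" by linarith
    moreover have "0 \<le> i * l" using i l0 by simp
    moreover have "i * 3 \<le> i * a" using a3 i by (intro mult_left_mono) auto
    moreover have "i * 1 \<le> i * b" using b1 i by (intro mult_left_mono) auto
    moreover have "0 \<le> i * E" using i E by simp
    moreover have "(2 + 2 * i) * (a + c) + (1 + 4 * i) * (b + l) + 2 * i * E
        = 2 * a + 2 * (i * a) + 2 * c + 2 * (i * c) + b + 4 * (i * b) + l + 4 * (i * l) + 2 * (i * E)"
      by (simp add: algebra_simps)
    ultimately show ?thesis unfolding ln_s using \<eta>l li i(1) a3 b1 by linarith
  qed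
  then show "C \<le> 2 * s" using C s0 by (simp add: c_def)
  have "ln (2084 * (C * p\<^sup>2)) \<le> ln (\<epsilon>\<^sup>2 * s powr \<eta>)"
  proof -
    have "ln (2084::real) \<le> ln (48 ^ 2)" by (subst ln_le_cancel_iff) auto
    also have "\<dots> = 2 * a" by (subst ln_realpow) (simp_all add: a_def)
    finally have n: "ln (2084::real) \<le> 2 * a" .
    have l2: "ln (2::real) \<le> 1" using ln_add_one_self_le_self[of 1] by simp
    \<comment> \<open>The exponent \<open>- (2 / \<eta>)\<close> of \<epsilon> in \<open>s\<close>
      makes the terms in \<open>E\<close> cancel exactly.\<close>
    have "ln (\<epsilon>\<^sup>2 * s powr \<eta>) = - 2 * E + \<eta> * ln s"
      using \<epsilon> s0 by (simp add: ln_mult ln_powr ln_realpow E_def)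
    also have "ln s = ln (2 * s) - ln 2" using s0 by (simp add: ln_mult)
    also have "\<eta> * (ln (2 * s) - ln 2) = 2 * \<eta> * (a + c) + 2 * (\<eta> * i) * (a + c) + \<eta> * (b + l) + 4 * (\<eta> * i) * (b + l) + 2 * (\<eta> * i) * E - \<eta> * ln 2"
      unfolding ln_s by (simp add: algebra_simps)
    finally have R: "ln (\<epsilon>\<^sup>2 * s powr \<eta>) =
        2 * (\<eta> * a) + 2 * a + 2 * (\<eta> * c) + 2 * c + \<eta> * b + 4 * b + \<eta> * l + 4 * l - \<eta> * ln 2"
      unfolding i(2) by (simp add: algebra_simps)
    have L: "ln (2084 * (C * p\<^sup>2)) = ln 2084 + c + 2 * l"
      using C p1 by (simp add: ln_mult ln_realpow c_def l_def)
    have "(2 * \<eta> + 1) * (- ((1 + \<eta>) * l)) \<le> (2 * \<eta> + 1) * c" using c \<eta> by (intro mult_left_mono) auto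
    moreover have "(2 * \<eta> + 1) * (- ((1 + \<eta>) * l)) = - (3 * (\<eta> * l) + 2 * (\<eta> * (\<eta> * l)) + l)"
      "(2 * \<eta> + 1) * c = 2 * (\<eta> * c) + c" by (simp_all add: algebra_simps)
    ultimately have "- (3 * (\<eta> * l) + 2 * (\<eta> * (\<eta> * l)) + l) \<le> 2 * (\<eta> * c) + c" by linarith
    moreover have "\<eta> * (\<eta> * l) \<le> \<eta> * 1" using \<eta>l \<eta> by (intro mult_left_mono) auto
    moreover have "\<eta> * 3 \<le> \<eta> * a" using a3 \<eta> by (intro mult_left_mono) auto
    moreover have "\<eta> * 1 \<le> \<eta> * b" using b1 \<eta> by (intro mult_left_mono) auto
    moreover have "\<eta> * ln 2 \<le> \<eta> * 1" using l2 \<eta> by (intro mult_left_mono) auto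
    ultimately show ?thesis unfolding R L using n \<eta>l l0 \<eta> b1 by linarith
  qed
  then show "2084 * (C * p\<^sup>2) \<le> \<epsilon>\<^sup>2 * s powr \<eta>" using C p1 \<epsilon> s0 by (subst (asm) ln_le_cancel_iff) auto
qed

context regular_isotropic
begin

text \<open>Independence makes the law of the sample a product measure, to which
  \<open>barrier_iterate\<close> applies with either sign. The start
  \<open>mat (real CARD('n) * \<theta>)\<close> has potential exactly \<open>1 / \<theta>\<close>
  and serves both barriers: it is \<open>u I - A\<close> and \<open>A - l I\<close> at
  \<open>A = 0\<close>, with \<open>u = real CARD('n) * \<theta>\<close> and
  \<open>l = - u\<close>.\<close>

lemma expectation_rayleigh_sup_bounds:
  fixes h s \<theta> :: real
  assumes M': "prob_space M'" and ind: "prob_space.indep_vars M' (\<lambda>_. borel) Z I"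
    and dist: "\<And>i. i \<in> I \<Longrightarrow> distr M' borel (Z i) = M" and I: "finite I" "I \<noteq> {}"
    and h: "0 < h" "h \<le> 1 / 6" and s: "h * \<theta> = 4 * s" "C \<le> 2 * s" and \<theta>: "0 < \<theta>"
  shows "(\<integral>\<omega>. rayleigh_sup ((\<Sum>i\<in>I. outer (Z i \<omega>)) - mat (real CARD('n) * \<theta>)) \<partial>M')
      \<le> real (card I) * (1 + 3 * h + 32 * (C * (1 + 1 / \<eta>)\<^sup>2) * s powr (- \<eta>) / h)" (is ?upper)
    and "(\<integral>\<omega>. rayleigh_sup (- (\<Sum>i\<in>I. outer (Z i \<omega>)) - mat (real CARD('n) * \<theta>)) \<partial>M')
      \<le> real (card I) * - (1 - 2 * h - 7 * (C / \<eta> * s powr (- \<eta>)))" (is ?lower)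
proof -
  interpret M': prob_space M' by fact
  have Zm [measurable]: "Z i \<in> borel_measurable M'" if "i \<in> I" for i
    using ind that unfolding M'.indep_vars_def2 by blast
  have "distr M' (\<Pi>\<^sub>M i\<in>I. borel) (\<lambda>\<omega>. \<lambda>i\<in>I. Z i \<omega>) = (\<Pi>\<^sub>M i\<in>I. distr M' borel (Z i))"
    using ind I by (subst (asm) M'.indep_vars_iff_distr_eq_PiM') auto
  also have "\<dots> = (\<Pi>\<^sub>M i\<in>I. M)" by (intro PiM_cong refl) (simp add: dist)
  finally have law: "distr M' (\<Pi>\<^sub>M i\<in>I. borel) (\<lambda>\<omega>. \<lambda>i\<in>I. Z i \<omega>) = (\<Pi>\<^sub>M i\<in>I. M)" .
  define B where "B = (mat (real CARD('n) * \<theta>) :: real ^ 'n ^ 'n)"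
  define e :: "'n \<Rightarrow> real ^ 'n" where "e i = axis i 1" for i
  have e: "orthonormal_family e" by (auto simp: orthonormal_family_def e_def inner_axis_axis)
  have bar: "barrier (1 / \<theta>) B"
    unfolding barrier_def B_def using e \<theta>
    by (intro exI[of _ e] exI[of _ "\<lambda>_. real CARD('n) * \<theta>"]) (auto simp: eigen_matrix_const)
  have transfer: "(\<integral>\<omega>. rayleigh_sup (\<sigma> *\<^sub>R (\<Sum>i\<in>I. outer (Z i \<omega>)) - B) \<partial>M') =
      (\<integral>\<omega>. rayleigh_sup (\<sigma> *\<^sub>R (\<Sum>i\<in>I. outer (\<omega> i)) - B) \<partial>Pi\<^sub>M I (\<lambda>_. M))" for \<sigma>
  proof -
    have "(\<integral>\<omega>. rayleigh_sup (\<sigma> *\<^sub>R (\<Sum>i\<in>I. outer (\<omega> i)) - B) \<partial>Pi\<^sub>M I (\<lambda>_. M))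
      = (\<integral>\<omega>. rayleigh_sup (\<sigma> *\<^sub>R (\<Sum>i\<in>I. outer ((\<lambda>i\<in>I. Z i \<omega>) i)) - B) \<partial>M')"
      unfolding law[symmetric] using Zm
      by (subst integral_distr) (auto intro!: measurable_restrict)
    also have "(\<lambda>\<omega>. \<Sum>i\<in>I. outer ((\<lambda>i\<in>I. Z i \<omega>) i)) = (\<lambda>\<omega>. \<Sum>i\<in>I. outer (Z i \<omega>))"
      by (intro ext sum.cong) auto
    then have "(\<integral>\<omega>. rayleigh_sup (\<sigma> *\<^sub>R (\<Sum>i\<in>I. outer ((\<lambda>i\<in>I. Z i \<omega>) i)) - B) \<partial>M')
      = (\<integral>\<omega>. rayleigh_sup (\<sigma> *\<^sub>R (\<Sum>i\<in>I. outer (Z i \<omega>)) - B) \<partial>M')" by (metis (no_types))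
    finally show ?thesis by simp
  qed
  have step: "barrier_step M C \<eta> e w \<theta> h s"
    if "orthonormal_family e" "\<forall>i. 0 < w i" "(\<Sum>i\<in>UNIV. 1 / w i) \<le> 1 / \<theta>" for e w
    using that h s \<theta> by unfold_locales auto
  note iterate = barrier_iterate[OF prob_space_axioms sets_M integrable_norm_square _ I(1) bar]
  have "(\<integral>\<omega>. rayleigh_sup (1 *\<^sub>R (\<Sum>i\<in>I. outer (\<omega> i)) - B) \<partial>Pi\<^sub>M I (\<lambda>_. M))
      \<le> real (card I) * (1 + 3 * h + 32 * (C * (1 + 1 / \<eta>)\<^sup>2) * s powr (- \<eta>) / h)"
  proof (rule iterate)
    fix A :: "real ^ 'n ^ 'n"
    assume "barrier (1 / \<theta>) A"
    then obtain e w where ew: "orthonormal_family e" "\<forall>i. 0 < w i" "(\<Sum>i\<in>UNIV. 1 / w i) \<le> 1 / \<theta>"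
      and A: "A = eigen_matrix e w" unfolding barrier_def by blast
    interpret barrier_step M C \<eta> e w \<theta> h s by (rule step[OF ew])
    show "\<exists>\<delta>. integrable M \<delta> \<and> (\<integral>x. \<delta> x \<partial>M) \<le> 1 + 3 * h + 32 * (C * (1 + 1 / \<eta>)\<^sup>2) * s powr (- \<eta>) / h \<and>
        (AE x in M. barrier (1 / \<theta>) (A + mat (\<delta> x) - 1 *\<^sub>R outer x))"
      unfolding A by (rule shift_exists_upper)
  qed
  then show ?upper unfolding transfer[symmetric] by (simp add: B_def)
  have "(\<integral>\<omega>. rayleigh_sup ((-1) *\<^sub>R (\<Sum>i\<in>I. outer (\<omega> i)) - B) \<partial>Pi\<^sub>M I (\<lambda>_. M))
      \<le> real (card I) * - (1 - 2 * h - 7 * (C / \<eta> * s powr (- \<eta>)))"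
  proof (rule iterate)
    fix A :: "real ^ 'n ^ 'n"
    assume "barrier (1 / \<theta>) A"
    then obtain e w where ew: "orthonormal_family e" "\<forall>i. 0 < w i" "(\<Sum>i\<in>UNIV. 1 / w i) \<le> 1 / \<theta>"
      and A: "A = eigen_matrix e w" unfolding barrier_def by blast
    interpret barrier_step M C \<eta> e w \<theta> h s by (rule step[OF ew])
    show "\<exists>\<delta>. integrable M \<delta> \<and> (\<integral>x. \<delta> x \<partial>M) \<le> - (1 - 2 * h - 7 * (C / \<eta> * s powr (- \<eta>))) \<and>
        (AE x in M. barrier (1 / \<theta>) (A + mat (\<delta> x) - (-1) *\<^sub>R outer x))"
      unfolding A by (rule shift_exists_lower)
  qed
  then show ?lower unfolding transfer[symmetric] by (simp add: B_def)
qed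

text \<open>The regularity does not give the normalised squared norm \<open>W\<close> a finite
  variance when \<open>\<eta> \<le> 1\<close>, so it is truncated at \<open>K = C + s\<close>. The
  truncation has variance at most \<open>K\<close>, since it lies between 0 and \<open>K\<close> and
  has mean at most one. The excess has mean at most \<open>L\<close> and enters twice, through
  \<open>U\<close> and through the bias \<open>1 - m\<close>. The free parameter \<beta> replaces a
  square root.\<close>

lemma trace_deviation:
  assumes M': "prob_space M'" and ind: "prob_space.indep_vars M' (\<lambda>_. borel) Z I"
    and dist: "\<And>i. i \<in> I \<Longrightarrow> distr M' borel (Z i) = M" and I: "finite I" "I \<noteq> {}"
    and s: "0 < s" and \<beta>: "0 < \<beta>"
  defines "T \<equiv> (\<lambda>\<omega>. (\<Sum>i\<in>I. (norm (Z i \<omega>))\<^sup>2 / real CARD('n) - 1) / real (card I))"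
  shows "integrable M' T"
    and "(\<integral>\<omega>. \<bar>T \<omega>\<bar> \<partial>M') \<le> (C + s) / real (card I) / (2 * \<beta>) + \<beta> / 2 + 2 * (C / \<eta> * s powr (- \<eta>))"
proof -
  interpret M': prob_space M' by fact
  define N where "N = real (card I)"
  have N: "0 < N" using I by (simp add: N_def card_gt_0_iff)
  have Zm [measurable]: "Z i \<in> borel_measurable M'" if "i \<in> I" for i
    using ind that unfolding M'.indep_vars_def2 by blast
  have Zint: "integrable M' (\<lambda>\<omega>. f (Z i \<omega>))" if "i \<in> I" "integrable M f" for i and f :: "_ \<Rightarrow> real"
  proof -
    have "integrable (distr M' borel (Z i)) f" using that dist by simp
    then show ?thesis using that Zm[OF that(1)] sets_M by (subst (asm) integrable_distr_eq) auto
  qed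
  have Zexp: "(\<integral>\<omega>. f (Z i \<omega>) \<partial>M') = (\<integral>x. f x \<partial>M)" if "i \<in> I" "f \<in> borel_measurable borel" for i and f :: "_ \<Rightarrow> real"
    using that Zm[OF that(1)] dist[OF that(1)] by (subst integral_distr[symmetric, of "Z i" M' borel f]) auto
  define K where "K = C + s"
  have K: "0 < K" using C_pos s by (simp add: K_def)
  define W where "W x = (norm x)\<^sup>2 / real CARD('n)" for x :: "real ^ 'n"
  define V where "V x = min (W x) K" for x
  have [measurable]: "W \<in> borel_measurable borel" "V \<in> borel_measurable borel"
    unfolding W_def V_def by measurable
  have W0: "0 \<le> W x" for x by (simp add: W_def)
  have V0: "0 \<le> V x" "V x \<le> K" "V x \<le> W x" for x using W0 K by (auto simp: V_def)
  define e :: "'n \<Rightarrow> real ^ 'n" where "e i = axis i 1" for i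
  have e: "orthonormal_family e" by (auto simp: orthonormal_family_def e_def inner_axis_axis)
  have W_eq: "W x = (\<Sum>i\<in>UNIV. 1 / real CARD('n) * (x \<bullet> e i)\<^sup>2)" for x
    unfolding W_def norm_orthonormal_family[OF e, of x] by (simp add: sum_divide_distrib)
  have Wi: "integrable M W" unfolding W_eq[abs_def] by (rule integrable_weighted_squares)
  have W1: "(\<integral>x. W x \<partial>M) = 1" unfolding W_eq by (subst integral_weighted_squares[OF e]) simp
  have Vi: "integrable M V"
    by (rule Bochner_Integration.integrable_bound[OF Wi]) (use V0 W0 in \<open>auto simp: sets_M\<close>)
  have V2i: "integrable M (\<lambda>x. (V x)\<^sup>2)"
  proof (rule Bochner_Integration.integrable_bound)
    show "integrable M (\<lambda>x. K * V x)" using Vi by simp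
    show "AE x in M. norm ((V x)\<^sup>2) \<le> norm (K * V x)"
      using V0 K by (intro AE_I2) (simp add: power2_eq_square mult_right_mono)
  qed measurable
  define L where "L = C / \<eta> * s powr (- \<eta>)"
  have L: "0 \<le> L" using C_pos \<eta>_pos by (simp add: L_def)
  have "ennreal (\<integral>x. W x - V x \<partial>M) = (\<integral>\<^sup>+x. ennreal (W x - V x) \<partial>M)"
    using Wi Vi V0 by (intro nn_integral_eq_integral[symmetric]) auto
  also have "\<dots> = (\<integral>\<^sup>+x. ennreal (max 0 ((\<Sum>i\<in>UNIV. 1 / real CARD('n) * (x \<bullet> e i)\<^sup>2) - C * 1 - s * 1)) \<partial>M)"
    unfolding W_eq[symmetric] by (intro nn_integral_cong arg_cong[where f = ennreal]) (auto simp: V_def K_def)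
  also have "\<dots> \<le> ennreal (1 * L)" unfolding L_def
    by (rule weighted_tail_integral[OF e _ _ _ s]) auto
  finally have WV: "(\<integral>x. W x - V x \<partial>M) \<le> L" using L by simp
  define m where "m = (\<integral>x. V x \<partial>M)"
  have mL: "1 - m \<le> L" using WV Wi Vi W1 by (simp add: m_def)
  have m1: "m \<le> 1" unfolding m_def W1[symmetric] using Wi Vi V0 by (intro integral_mono) auto
  have "(\<integral>x. (V x - m)\<^sup>2 \<partial>M) = (\<integral>x. (V x)\<^sup>2 - 2 * m * V x + m\<^sup>2 \<partial>M)"
    by (intro Bochner_Integration.integral_cong) (auto simp: power2_eq_square algebra_simps)
  also have "\<dots> = (\<integral>x. (V x)\<^sup>2 \<partial>M) - 2 * m * m + m\<^sup>2"
    using V2i Vi by (simp add: m_def prob_space)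
  also have "\<dots> \<le> (\<integral>x. (V x)\<^sup>2 \<partial>M)" by (simp add: power2_eq_square)
  also have "\<dots> \<le> (\<integral>x. K * V x \<partial>M)"
    using V2i Vi V0 K by (intro integral_mono) (auto simp: power2_eq_square mult_right_mono)
  also have "\<dots> = K * m" by (simp add: m_def)
  also have "\<dots> \<le> K" using m1 K by simp
  finally have var: "(\<integral>x. (V x - m)\<^sup>2 \<partial>M) \<le> K" .
  define X where "X i \<omega> = V (Z i \<omega>) - m" for i \<omega>
  have indX: "M'.indep_vars (\<lambda>_. borel) X I"
    unfolding X_def using M'.indep_vars_compose2[OF ind, of "\<lambda>_ x. V x - m" "\<lambda>_. borel"] by simp
  have Vmi: "integrable M (\<lambda>x. V x - m)" using Vi by simp
  have V2mi: "integrable M (\<lambda>x. (V x - m)\<^sup>2)"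
    using V2i Vi by (simp add: power2_diff)
  have X1: "integrable M' (X i)" if "i \<in> I" for i unfolding X_def[abs_def] by (rule Zint[OF that Vmi])
  have X2: "integrable M' (\<lambda>\<omega>. (X i \<omega>)\<^sup>2)" if "i \<in> I" for i unfolding X_def using Zint[OF that V2mi] .
  have X3: "(\<integral>\<omega>. X i \<omega> \<partial>M') = 0" if "i \<in> I" for i
    unfolding X_def using Zexp[OF that, of "\<lambda>x. V x - m"] Vi by (simp add: m_def prob_space)
  have X4: "(\<integral>\<omega>. (X i \<omega>)\<^sup>2 \<partial>M') \<le> K" if "i \<in> I" for i
    unfolding X_def using Zexp[OF that, of "\<lambda>x. (V x - m)\<^sup>2"] var by simp
  define S where "S \<omega> = (\<Sum>i\<in>I. X i \<omega>)" for \<omega>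
  have Si: "integrable M' S" unfolding S_def using X1 by (intro Bochner_Integration.integrable_sum)
  have S2i: "integrable M' (\<lambda>\<omega>. (S \<omega>)\<^sup>2)"
    unfolding S_def using M'.expectation_sum_square_indep(1)[OF I(1) indX X1 X2 X3] by simp
  have "(\<integral>\<omega>. (S \<omega>)\<^sup>2 \<partial>M') = (\<Sum>i\<in>I. \<integral>\<omega>. (X i \<omega>)\<^sup>2 \<partial>M')"
    unfolding S_def using M'.expectation_sum_square_indep(2)[OF I(1) indX X1 X2 X3] by simp
  also have "\<dots> \<le> (\<Sum>i\<in>I. K)" by (intro sum_mono X4)
  finally have S2: "(\<integral>\<omega>. (S \<omega>)\<^sup>2 \<partial>M') \<le> N * K" by (simp add: N_def)
  define U where "U \<omega> = (\<Sum>i\<in>I. W (Z i \<omega>) - V (Z i \<omega>))" for \<omega>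
  have Ui: "integrable M' U" unfolding U_def
    using Wi Vi by (intro Bochner_Integration.integrable_sum Bochner_Integration.integrable_diff Zint)
  have "(\<integral>\<omega>. U \<omega> \<partial>M') = (\<Sum>i\<in>I. \<integral>\<omega>. W (Z i \<omega>) - V (Z i \<omega>) \<partial>M')" unfolding U_def
    using Wi Vi by (intro Bochner_Integration.integral_sum Bochner_Integration.integrable_diff Zint)
  also have "\<dots> \<le> (\<Sum>i\<in>I. L)"
    using WV Zexp[of _ "\<lambda>x. W x - V x"] by (intro sum_mono) simp
  finally have U1: "(\<integral>\<omega>. U \<omega> \<partial>M') \<le> N * L" by (simp add: N_def)
  have U0: "0 \<le> U \<omega>" for \<omega> unfolding U_def using V0 by (intro sum_nonneg) simp
  have T_eq: "T \<omega> = (S \<omega> + U \<omega>) / N - (1 - m)" for \<omega>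
  proof -
    have "(\<Sum>i\<in>I. W (Z i \<omega>) - 1) = S \<omega> + U \<omega> - N * (1 - m)"
      unfolding S_def U_def X_def N_def by (simp add: sum_subtractf algebra_simps)
    then show ?thesis using N unfolding T_def W_def[symmetric] N_def[symmetric] by (simp add: diff_divide_distrib)
  qed
  show Ti: "integrable M' T" unfolding T_eq[abs_def] using Si Ui by simp
  have "\<bar>T \<omega>\<bar> \<le> (S \<omega>)\<^sup>2 / (2 * \<beta> * N\<^sup>2) + \<beta> / 2 + U \<omega> / N + (1 - m)" for \<omega>
  proof -
    \<comment> \<open>The inequality of arithmetic and geometric means,
      \<open>2 * \<beta> * y \<le> y\<^sup>2 + \<beta>\<^sup>2\<close>, trades the absolute first
      moment for the second.\<close>
    have "0 \<le> (\<bar>S \<omega> / N\<bar> - \<beta>)\<^sup>2" by simp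
    then have "2 * \<beta> * \<bar>S \<omega> / N\<bar> \<le> (S \<omega> / N)\<^sup>2 + \<beta>\<^sup>2" by (simp add: power2_diff mult_ac del: abs_divide)
    then have "\<bar>S \<omega> / N\<bar> \<le> ((S \<omega> / N)\<^sup>2 + \<beta>\<^sup>2) / (2 * \<beta>)" using \<beta> by (simp only: pos_le_divide_eq mult.commute mult_pos_pos zero_less_numeral)
    also have "\<dots> = (S \<omega>)\<^sup>2 / (2 * \<beta> * N\<^sup>2) + \<beta> / 2"
      using \<beta> N by (simp add: field_simps power2_eq_square)
    finally have 1: "\<bar>S \<omega> / N\<bar> \<le> (S \<omega>)\<^sup>2 / (2 * \<beta> * N\<^sup>2) + \<beta> / 2" .
    have "\<bar>T \<omega>\<bar> \<le> \<bar>S \<omega> / N\<bar> + U \<omega> / N + (1 - m)"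
      unfolding T_eq add_divide_distrib using m1 U0[of \<omega>] N
      by (smt (verit) divide_nonneg_pos)
    with 1 show ?thesis by linarith
  qed
  then have "(\<integral>\<omega>. \<bar>T \<omega>\<bar> \<partial>M') \<le> (\<integral>\<omega>. (S \<omega>)\<^sup>2 / (2 * \<beta> * N\<^sup>2) + \<beta> / 2 + U \<omega> / N + (1 - m) \<partial>M')"
    using Ti S2i Ui by (intro integral_mono) auto
  also have "\<dots> = (\<integral>\<omega>. (S \<omega>)\<^sup>2 \<partial>M') / (2 * \<beta> * N\<^sup>2) + \<beta> / 2 + (\<integral>\<omega>. U \<omega> \<partial>M') / N + (1 - m)"
    using S2i Ui by (simp add: M'.prob_space)
  also have "\<dots> \<le> (N * K) / (2 * \<beta> * N\<^sup>2) + \<beta> / 2 + (N * L) / N + L"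
    using S2 U1 mL \<beta> N by (intro add_mono divide_right_mono) auto
  also have "\<dots> = K / N / (2 * \<beta>) + \<beta> / 2 + 2 * L"
    using N by (simp add: power2_eq_square)
  finally show "(\<integral>\<omega>. \<bar>T \<omega>\<bar> \<partial>M') \<le> (C + s) / real (card I) / (2 * \<beta>) + \<beta> / 2 + 2 * (C / \<eta> * s powr (- \<eta>))"
    by (simp add: K_def N_def L_def)
qed

end

lemma rayleigh_sup_diff_mat:
  fixes A :: "real ^ 'n ^ 'n"
  shows "rayleigh_sup (A - mat c) = rayleigh_sup A - c"
  using rayleigh_sup_shift[of "A - mat c" c] by simp

lemma trace_le_rayleigh_sup:
  fixes A :: "real ^ 'n ^ 'n"
  shows "trace A \<le> real CARD('n) * rayleigh_sup A"
proof -
  have "A $ k $ k \<le> rayleigh_sup A" for k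
  proof -
    have "axis k 1 \<bullet> (A *v axis k 1) = A $ k $ k"
      by (simp add: inner_axis' matrix_vector_mul_component inner_axis)
    then show ?thesis using rayleigh_sup_upper[of "axis k 1" A] by simp
  qed
  then have "trace A \<le> (\<Sum>k\<in>(UNIV :: 'n set). rayleigh_sup A)" unfolding trace_def by (intro sum_mono)
  then show ?thesis by simp
qed

context regular_isotropic
begin

theorem isotropic_sample_covariance:
  fixes \<epsilon> :: real and N :: nat
  assumes M': "prob_space M'" and ind: "prob_space.indep_vars M' (\<lambda>_. borel) Z {1..N}"
    and dist: "\<And>i. i \<in> {1..N} \<Longrightarrow> distr M' borel (Z i) = M"
    and \<epsilon>: "0 < \<epsilon>" "\<epsilon> < 1" and N: "0 < N"
    and large: "512 * (48 * C) powr (2 + 2 / \<eta>) * (6 + 6 / \<eta>) powr (1 + 4 / \<eta>) * \<epsilon> powr (- 2 - 2 / \<eta>) * real CARD('n) \<le> real N"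
  shows "integrable M' (\<lambda>\<omega>. rayleigh_sup (sample_cov N Z \<omega> - mat 1))"
    and "integrable M' (\<lambda>\<omega>. rayleigh_sup (mat 1 - sample_cov N Z \<omega>))"
    and "(\<integral>\<omega>. max (rayleigh_sup (sample_cov N Z \<omega> - mat 1)) (rayleigh_sup (mat 1 - sample_cov N Z \<omega>)) \<partial>M') \<le> \<epsilon>"
proof -
  interpret M': prob_space M' by fact
  define p where "p = 1 + 1 / \<eta>"
  define n where "n = real CARD('n)"
  \<comment> \<open>Chosen so that the required sample size is
    \<open>1024 * s * n / \<epsilon>\<^sup>2\<close>; here 1024 is 16 times the 64 in \<theta>
    below, which makes the starting offset cost at most \<open>\<epsilon> / 16\<close>.\<close>
  define s where "s = 1 / 2 * ((48 * C) powr (2 + 2 / \<eta>) * (6 * p) powr (1 + 4 / \<eta>) * \<epsilon> powr (- (2 / \<eta>)))"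
  have n: "1 \<le> n" by (simp add: n_def)
  have N0: "0 < real N" using N by simp
  have Cs: "C \<le> 2 * s" and s_big: "2084 * (C * p\<^sup>2) \<le> \<epsilon>\<^sup>2 * s powr \<eta>"
    using sample_size_estimates[OF C_pos \<eta>_pos \<epsilon> p_def _ s_def] regularity_constant_lower_bound by (auto simp: p_def)
  have s: "0 < s" using Cs C_pos by linarith
  have N_ge: "1024 * s * n \<le> \<epsilon>\<^sup>2 * real N"
  proof -
    have 6: "6 + 6 / \<eta> = 6 * p" by (simp add: p_def)
    have "\<epsilon> powr (- 2 - 2 / \<eta>) = \<epsilon> powr (- (2 / \<eta>)) * \<epsilon> powr (- 2)"
      by (subst powr_add[symmetric]) (rule arg_cong[where f = "\<lambda>x. \<epsilon> powr x"], simp)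
    also have "\<epsilon> powr (- 2) = 1 / \<epsilon>\<^sup>2" using \<epsilon> by (simp add: powr_minus_divide powr_numeral)
    finally have "512 * (48 * C) powr (2 + 2 / \<eta>) * (6 + 6 / \<eta>) powr (1 + 4 / \<eta>) * \<epsilon> powr (- 2 - 2 / \<eta>) * real CARD('n)
       = 1024 * s * n / \<epsilon>\<^sup>2" unfolding 6 by (simp add: s_def n_def)
    with large have "1024 * s * n / \<epsilon>\<^sup>2 \<le> real N" by simp
    then show ?thesis using \<epsilon> by (simp add: divide_le_eq mult.commute)
  qed
  \<comment> \<open>The relative losses \<open>3 * h\<close> above and \<open>2 * h\<close> below
    then cost \<open>5 / 16\<close> of \<epsilon>, and \<open>h * \<theta> = 4 * s\<close> dictates
    \<theta>.\<close>
  define h where "h = \<epsilon> / 16"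
  define \<theta> where "\<theta> = 64 * s / \<epsilon>"
  have h: "0 < h" "h \<le> 1 / 6" using \<epsilon> by (auto simp: h_def)
  have \<theta>: "0 < \<theta>" and h\<theta>: "h * \<theta> = 4 * s" using s \<epsilon> by (simp_all add: \<theta>_def h_def)
  define q where "q = C * p\<^sup>2 * s powr (- \<eta>)"
  have p1: "1 \<le> p" "1 / \<eta> \<le> p" using \<eta>_pos by (simp_all add: p_def)
  have q: "q \<le> \<epsilon>\<^sup>2 / 2084" "0 \<le> q"
  proof -
    have "2084 * (C * p\<^sup>2) * s powr (- \<eta>) \<le> \<epsilon>\<^sup>2 * s powr \<eta> * s powr (- \<eta>)"
      using s_big by (intro mult_right_mono) auto
    also have "\<dots> = \<epsilon>\<^sup>2" using s by (simp add: mult.assoc powr_add[symmetric])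
    finally show "q \<le> \<epsilon>\<^sup>2 / 2084" by (simp add: q_def)
    show "0 \<le> q" using C_pos by (simp add: q_def)
  qed
  have Cq: "C / \<eta> * s powr (- \<eta>) \<le> q"
  proof -
    have "1 / \<eta> * 1 \<le> p * p" using p1 \<eta>_pos by (intro mult_mono) auto
    then have "C * (1 / \<eta>) * s powr (- \<eta>) \<le> C * p\<^sup>2 * s powr (- \<eta>)"
      using C_pos by (intro mult_right_mono mult_left_mono) (auto simp: power2_eq_square)
    then show ?thesis by (simp add: q_def)
  qed
  define I where "I = {1..N}"
  have I: "finite I" "I \<noteq> {}" "card I = N" using N by (auto simp: I_def)
  note ind' = ind[folded I_def] and dist' = dist[folded I_def]
  have Zm [measurable]: "Z i \<in> borel_measurable M'" if "i \<in> I" for i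
    using ind' that unfolding M'.indep_vars_def2 by blast
  define A where "A \<omega> = (\<Sum>i\<in>I. outer (Z i \<omega>))" for \<omega>
  have [measurable]: "A \<in> borel_measurable M'" unfolding A_def by measurable
  have Z2: "integrable M' (\<lambda>\<omega>. (norm (Z i \<omega>))\<^sup>2)" if "i \<in> I" for i
  proof -
    have "integrable (distr M' borel (Z i)) (\<lambda>x. (norm x)\<^sup>2)"
      using integrable_norm_square dist'[OF that] by simp
    then show ?thesis using Zm[OF that] by (subst (asm) integrable_distr_eq) auto
  qed
  have rs_int: "integrable M' (\<lambda>\<omega>. rayleigh_sup (\<sigma> *\<^sub>R A \<omega>))" if "\<bar>\<sigma>\<bar> = 1" for \<sigma>
  proof (rule Bochner_Integration.integrable_bound)
    show "integrable M' (\<lambda>\<omega>. \<Sum>i\<in>I. (norm (Z i \<omega>))\<^sup>2)" using Z2 by (intro Bochner_Integration.integrable_sum)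
    show "AE \<omega> in M'. norm (rayleigh_sup (\<sigma> *\<^sub>R A \<omega>)) \<le> norm (\<Sum>i\<in>I. (norm (Z i \<omega>))\<^sup>2)"
    proof (intro AE_I2)
      fix \<omega>
      have "\<bar>rayleigh_sup (\<sigma> *\<^sub>R A \<omega>)\<bar> \<le> norm (A \<omega>)"
        using abs_rayleigh_sup_le[of "\<sigma> *\<^sub>R A \<omega>"] that by simp
      also have "\<dots> \<le> (\<Sum>i\<in>I. (norm (Z i \<omega>))\<^sup>2)"
        unfolding A_def by (rule order_trans[OF norm_sum]) (simp add: norm_outer)
      finally show "norm (rayleigh_sup (\<sigma> *\<^sub>R A \<omega>)) \<le> norm (\<Sum>i\<in>I. (norm (Z i \<omega>))\<^sup>2)"
        unfolding real_norm_def by (meson abs_ge_self order_trans)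
    qed
  qed measurable
  define a where "a \<omega> = rayleigh_sup (sample_cov N Z \<omega> - mat 1)" for \<omega>
  define b where "b \<omega> = rayleigh_sup (mat 1 - sample_cov N Z \<omega>)" for \<omega>
  have S_eq: "sample_cov N Z \<omega> = (1 / real N) *\<^sub>R A \<omega>" for \<omega>
    by (simp add: sample_cov_def A_def I_def)
  have a_eq: "a \<omega> = rayleigh_sup (1 *\<^sub>R A \<omega>) / real N - 1" for \<omega>
    unfolding a_def S_eq rayleigh_sup_diff_mat using N0 by (subst rayleigh_sup_scaleR) auto
  have b_eq: "b \<omega> = rayleigh_sup ((-1) *\<^sub>R A \<omega>) / real N + 1" for \<omega>
  proof -
    have "mat 1 - sample_cov N Z \<omega> = (1 / real N) *\<^sub>R ((-1) *\<^sub>R A \<omega>) + mat 1" by (simp add: S_eq)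
    then show ?thesis unfolding b_def using N0 by (simp only: rayleigh_sup_shift) (subst rayleigh_sup_scaleR, auto)
  qed
  have ai: "integrable M' a" unfolding a_eq[abs_def] using rs_int[of 1] by simp
  have bi: "integrable M' b" unfolding b_eq[abs_def] using rs_int[of "-1"] by simp
  show "integrable M' (\<lambda>\<omega>. rayleigh_sup (sample_cov N Z \<omega> - mat 1))" using ai by (simp add: a_def[abs_def])
  show "integrable M' (\<lambda>\<omega>. rayleigh_sup (mat 1 - sample_cov N Z \<omega>))" using bi by (simp add: b_def[abs_def])
  note bounds = expectation_rayleigh_sup_bounds[OF M' ind' dist' I(1,2) h h\<theta> Cs \<theta>, folded A_def n_def p_def, unfolded I(3)]
  have E1: "(\<integral>\<omega>. a \<omega> \<partial>M') \<le> 3 * h + 32 * (C * p\<^sup>2) * s powr (- \<eta>) / h + n * \<theta> / real N"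
  proof -
    have "(\<integral>\<omega>. rayleigh_sup (1 *\<^sub>R A \<omega>) - n * \<theta> \<partial>M') \<le> real N * (1 + 3 * h + 32 * (C * p\<^sup>2) * s powr (- \<eta>) / h)"
      using bounds(1) by (simp add: rayleigh_sup_diff_mat)
    then have "(\<integral>\<omega>. rayleigh_sup (1 *\<^sub>R A \<omega>) \<partial>M') \<le> real N * (1 + 3 * h + 32 * (C * p\<^sup>2) * s powr (- \<eta>) / h) + n * \<theta>"
      using rs_int[of 1] by (simp add: M'.prob_space)
    then have "(\<integral>\<omega>. rayleigh_sup (1 *\<^sub>R A \<omega>) \<partial>M') / real N \<le> (real N * (1 + 3 * h + 32 * (C * p\<^sup>2) * s powr (- \<eta>) / h) + n * \<theta>) / real N"
      using N0 by (intro divide_right_mono) auto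
    also have "\<dots> = 1 + 3 * h + 32 * (C * p\<^sup>2) * s powr (- \<eta>) / h + n * \<theta> / real N"
      using N0 by (simp add: add_divide_distrib)
    finally show ?thesis unfolding a_eq using rs_int[of 1] by (simp add: M'.prob_space)
  qed
  have E2: "(\<integral>\<omega>. b \<omega> \<partial>M') \<le> 2 * h + 7 * (C / \<eta> * s powr (- \<eta>)) + n * \<theta> / real N"
  proof -
    have "(\<integral>\<omega>. rayleigh_sup ((-1) *\<^sub>R A \<omega>) - n * \<theta> \<partial>M') \<le> real N * - (1 - 2 * h - 7 * (C / \<eta> * s powr (- \<eta>)))"
      using bounds(2) by (simp add: rayleigh_sup_diff_mat)
    then have "(\<integral>\<omega>. rayleigh_sup ((-1) *\<^sub>R A \<omega>) \<partial>M') \<le> real N * - (1 - 2 * h - 7 * (C / \<eta> * s powr (- \<eta>))) + n * \<theta>"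
      using rs_int[of "-1"] by (simp add: M'.prob_space)
    then have "(\<integral>\<omega>. rayleigh_sup ((-1) *\<^sub>R A \<omega>) \<partial>M') / real N \<le> (real N * - (1 - 2 * h - 7 * (C / \<eta> * s powr (- \<eta>))) + n * \<theta>) / real N"
      using N0 by (intro divide_right_mono) auto
    also have "\<dots> = - (1 - 2 * h - 7 * (C / \<eta> * s powr (- \<eta>))) + n * \<theta> / real N"
      using N0 by (simp add: add_divide_distrib)
    finally show ?thesis unfolding b_eq using rs_int[of "-1"] by (simp add: M'.prob_space)
  qed
  define T where "T \<omega> = (\<Sum>i\<in>I. (norm (Z i \<omega>))\<^sup>2 / n - 1) / real N" for \<omega>
  have \<beta>: "0 < \<epsilon> / 16" using \<epsilon> by simp
  have tr: "integrable M' T"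
    "(\<integral>\<omega>. \<bar>T \<omega>\<bar> \<partial>M') \<le> (C + s) / real N / (2 * (\<epsilon> / 16)) + \<epsilon> / 16 / 2 + 2 * (C / \<eta> * s powr (- \<eta>))"
    unfolding T_def n_def using trace_deviation[OF M' ind' dist' I(1,2) s \<beta>] unfolding I(3) by blast+
  \<comment> \<open>\<open>T \<omega>\<close> is the average eigenvalue of
    \<open>sample_cov N Z \<omega>\<close> minus one, so it lies between the extreme deviations
    \<open>- b \<omega>\<close> and \<open>a \<omega>\<close>.\<close>
  have "a \<omega> \<ge> T \<omega> \<and> b \<omega> \<ge> - T \<omega>" for \<omega>
  proof -
    have tA: "trace (A \<omega>) = (\<Sum>i\<in>I. (norm (Z i \<omega>))\<^sup>2)"
      by (simp add: A_def trace_sum trace_outer power2_norm_eq_inner)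
    have "T \<omega> = (trace (A \<omega>) / n - real N) / real N"
      by (simp add: T_def tA sum_subtractf sum_divide_distrib I(3))
    then have T: "T \<omega> = trace (A \<omega>) / n / real N - 1" using N0 by (simp add: diff_divide_distrib)
    have "trace (A \<omega>) / n \<le> rayleigh_sup (1 *\<^sub>R A \<omega>)"
      using trace_le_rayleigh_sup[of "A \<omega>"] n by (simp add: n_def field_simps)
    moreover have "- (trace (A \<omega>) / n) \<le> rayleigh_sup ((-1) *\<^sub>R A \<omega>)"
      using trace_le_rayleigh_sup[of "(-1) *\<^sub>R A \<omega>"] n unfolding trace_scaleR by (simp add: n_def field_simps)
    ultimately have "trace (A \<omega>) / n / real N \<le> rayleigh_sup (1 *\<^sub>R A \<omega>) / real N"
      "- (trace (A \<omega>) / n) / real N \<le> rayleigh_sup ((-1) *\<^sub>R A \<omega>) / real N"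
      using N0 by (blast intro: divide_right_mono less_imp_le)+
    then show ?thesis unfolding T a_eq b_eq by simp
  qed
  \<comment> \<open>The smaller of \<open>a \<omega>\<close> and \<open>b \<omega>\<close> is at
    least \<open>- \<bar>T \<omega>\<bar>\<close>, so adding it to the larger loses at most
    \<open>\<bar>T \<omega>\<bar>\<close>.\<close>
  then have pw: "max (a \<omega>) (b \<omega>) \<le> a \<omega> + b \<omega> + \<bar>T \<omega>\<bar>" for \<omega>
    by (smt (verit))
  have max_i: "integrable M' (\<lambda>\<omega>. max (a \<omega>) (b \<omega>))" using ai bi by simp
  have "(\<integral>\<omega>. max (a \<omega>) (b \<omega>) \<partial>M') \<le> (\<integral>\<omega>. a \<omega> + b \<omega> + \<bar>T \<omega>\<bar> \<partial>M')"
    using ai bi tr(1) max_i pw by (intro integral_mono) auto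
  also have "\<dots> = (\<integral>\<omega>. a \<omega> \<partial>M') + (\<integral>\<omega>. b \<omega> \<partial>M') + (\<integral>\<omega>. \<bar>T \<omega>\<bar> \<partial>M')"
    using ai bi tr(1) by simp
  also have "\<dots> \<le> \<epsilon>"
  proof -
    have e2: "\<epsilon>\<^sup>2 \<le> \<epsilon>" using \<epsilon> by (simp add: power2_eq_square mult_left_le)
    have "32 * (C * p\<^sup>2) * s powr (- \<eta>) / h = 512 * (q / \<epsilon>)" by (simp add: q_def h_def)
    moreover have "q / \<epsilon> \<le> \<epsilon>\<^sup>2 / 2084 / \<epsilon>" using q \<epsilon> by (intro divide_right_mono) auto
    then have "q / \<epsilon> \<le> \<epsilon> / 2084" using \<epsilon> by (simp add: power2_eq_square)
    moreover have "n * \<theta> / real N \<le> \<epsilon> / 16"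
    proof -
      have "16 * (n * \<theta>) * \<epsilon> = 1024 * s * n" using \<epsilon> by (simp add: \<theta>_def)
      also have "\<dots> \<le> (\<epsilon> * real N) * \<epsilon>" using N_ge by (simp add: power2_eq_square mult_ac)
      finally have "16 * (n * \<theta>) \<le> \<epsilon> * real N" using \<epsilon> by (simp add: mult.commute)
      then show ?thesis using N0 by (simp add: field_simps)
    qed
    moreover have "(C + s) / real N / (2 * (\<epsilon> / 16)) \<le> 24 / 1024 * \<epsilon>"
    proof -
      have "1024 * s * 1 \<le> 1024 * s * n" using n s by (intro mult_left_mono) auto
      then have "1024 * s \<le> \<epsilon>\<^sup>2 * real N" using N_ge by simp
      moreover have "1024 * (C + s) \<le> 3 * (1024 * s)" using Cs by simp
      ultimately have "1024 * (C + s) \<le> 3 * (\<epsilon>\<^sup>2 * real N)" by (meson mult_left_mono order_trans zero_le_numeral)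
      then have "(C + s) / real N \<le> 3 / 1024 * \<epsilon>\<^sup>2" using N0 by (simp add: field_simps)
      then have "(C + s) / real N / (2 * (\<epsilon> / 16)) \<le> 3 / 1024 * \<epsilon>\<^sup>2 / (2 * (\<epsilon> / 16))"
        using \<epsilon> by (intro divide_right_mono) auto
      also have "\<dots> = 24 / 1024 * \<epsilon>" using \<epsilon> by (simp add: power2_eq_square)
      finally show ?thesis .
    qed
    moreover have "q \<le> \<epsilon> / 2084" using q e2 by simp
    \<comment> \<open>The budget in units of \<epsilon>: 5/16 from \<open>h\<close>, 1/8 from the
      two starting offsets, 521/2084 = 1/4 from the tails, and 1/32 + 3/128 from the remaining trace
      terms, in total 95/128.\<close>
    moreover have "x + y + z \<le> \<epsilon>"
      if "x \<le> 3 * h + k1 + k3" "y \<le> 2 * h + 7 * k2 + k3" "z \<le> k4 + \<epsilon> / 16 / 2 + 2 * k2"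
        "k1 \<le> 512 * (\<epsilon> / 2084)" "k2 \<le> \<epsilon> / 2084" "k3 \<le> \<epsilon> / 16" "k4 \<le> 24 / 1024 * \<epsilon>"
      for x y z k1 k2 k3 k4 :: real
      using that \<epsilon> unfolding h_def by linarith
    ultimately show ?thesis using E1 E2 tr(2) Cq by (smt (verit))
  qed
  finally show "(\<integral>\<omega>. max (rayleigh_sup (sample_cov N Z \<omega> - mat 1)) (rayleigh_sup (mat 1 - sample_cov N Z \<omega>)) \<partial>M') \<le> \<epsilon>"
    by (simp add: a_def b_def)
qed

end

section \<open>Square roots, spectral norms and the reduction to the isotropic case\<close>

text \<open>For a unit eigenvector \<open>v\<close> of \<open>A - B\<close> with eigenvalue
  \<open>w i\<close>, equality of the squares gives
  \<open>w i * (v \<bullet> (A *v v) + v \<bullet> (B *v v)) = 0\<close>. If \<open>w i\<close> were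
  nonzero, both nonnegative forms would vanish, although they differ by \<open>w i\<close>.\<close>

lemma pos_semidef_square_unique:
  fixes A B :: "real ^ 'n ^ 'n"
  assumes A: "pos_semidef A" and B: "pos_semidef B" and eq: "A ** A = B ** B"
  shows "A = B"
proof -
  have symA: "transpose A = A" and symB: "transpose B = B" using A B by (auto simp: pos_semidef_def)
  have "transpose (A - B) = A - B" by (simp add: transpose_diff symA symB)
  then obtain e w where e: "orthonormal_family e" and D: "A - B = eigen_matrix e w"
    using spectral_theorem_symmetric by blast
  have "w i = 0" for i
  proof (rule ccontr)
    assume w: "w i \<noteq> 0"
    define v where "v = e i"
    have vv: "v \<bullet> v = 1" using e by (simp add: v_def orthonormal_family_def)
    have Dv: "(A - B) *v v = w i *\<^sub>R v" unfolding D v_def by (rule eigen_matrix_eigenvector[OF e])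
    have AB: "A *v v = B *v v + w i *\<^sub>R v" using Dv by (simp add: matrix_vector_mult_diff_rdistrib algebra_simps)
    have "(A *v v) \<bullet> (A *v v) = v \<bullet> ((A ** A) *v v)"
      by (simp add: symmetric_matrix_inner[OF symA] matrix_vector_mul_assoc)
    also have "\<dots> = (B *v v) \<bullet> (B *v v)"
      unfolding eq by (simp add: symmetric_matrix_inner[OF symB] matrix_vector_mul_assoc)
    finally have "w i * (2 * (v \<bullet> (B *v v)) + w i) = 0"
      unfolding AB using vv by (simp add: inner_add_left inner_add_right inner_commute algebra_simps)
    then have "2 * (v \<bullet> (B *v v)) + w i = 0" using w by simp
    moreover have "v \<bullet> (A *v v) = v \<bullet> (B *v v) + w i" unfolding AB using vv by (simp add: inner_add_right)
    moreover have "0 \<le> v \<bullet> (A *v v)" "0 \<le> v \<bullet> (B *v v)" using A B by (auto simp: pos_semidef_def)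
    ultimately show False using w by linarith
  qed
  then have "A - B = 0" unfolding D eigen_matrix_def by simp
  then show ?thesis by simp
qed

lemma matrix_sqrt_eqI:
  fixes A B :: "real ^ 'n ^ 'n"
  assumes "pos_semidef B" "B ** B = A"
  shows "matrix_sqrt A = B"
  unfolding matrix_sqrt_def using assms pos_semidef_square_unique by (intro the_equality) auto

lemma matrix_inv_eqI:
  fixes A B :: "real ^ 'n ^ 'n"
  assumes "A ** B = mat 1"
  shows "matrix_inv A = B"
proof -
  have "B ** A = mat 1" using assms by (rule matrix_left_right_inverse[THEN iffD1])
  then have "\<exists>A'. A ** A' = mat 1 \<and> A' ** A = mat 1" using assms by blast
  then have "A ** matrix_inv A = mat 1" unfolding matrix_inv_def by (rule someI2_ex) simp
  then show ?thesis using assms by (rule matrix_eq_inverse)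
qed

text \<open>The Frobenius norm on the right makes \<open>spectral_norm\<close> Lipschitz for the
  ambient metric, from which measurability follows.\<close>

lemma spectral_norm_triangle:
  fixes A B :: "real ^ 'n ^ 'n"
  shows "spectral_norm A \<le> spectral_norm B + norm (A - B)"
proof -
  have "onorm ((*v) A) = onorm (\<lambda>x. B *v x + (A - B) *v x)"
    by (rule arg_cong[where f = onorm]) (auto simp: matrix_vector_mult_diff_rdistrib)
  also have "\<dots> \<le> onorm ((*v) B) + onorm ((*v) (A - B))"
    by (intro onorm_triangle matrix_vector_mul_bounded_linear)
  also have "onorm ((*v) (A - B)) \<le> norm (A - B)" by (intro onorm_le norm_matrix_vector_mult_le)
  finally show ?thesis by (simp add: spectral_norm_def)
qed

lemma spectral_norm_measurable [measurable]:
  "(spectral_norm :: real ^ 'n ^ 'n \<Rightarrow> real) \<in> borel_measurable borel"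
  by (rule lipschitz_borel_measurable) (rule spectral_norm_triangle)

lemma spectral_norm_nonneg: "0 \<le> spectral_norm (A :: real ^ 'n ^ 'n)"
  unfolding spectral_norm_def by (intro onorm_pos_le matrix_vector_mul_bounded_linear)

text \<open>The form at the eigenvectors bounds all eigenvalues in absolute value, and for a
  symmetric matrix these determine the operator norm.\<close>

lemma spectral_norm_symmetric_le:
  fixes A :: "real ^ 'n ^ 'n"
  assumes sym: "transpose A = A" and c: "0 \<le> c" and q: "\<And>x. \<bar>x \<bullet> (A *v x)\<bar> \<le> c * (norm x)\<^sup>2"
  shows "spectral_norm A \<le> c"
proof -
  obtain e w where e: "orthonormal_family e" and A: "A = eigen_matrix e w"
    using spectral_theorem_symmetric[OF sym] .
  have w: "(w i)\<^sup>2 \<le> c\<^sup>2" for i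
  proof -
    have "norm (e i) = 1" using e by (simp add: orthonormal_family_def norm_eq_1)
    then have "\<bar>w i\<bar> \<le> c" using q[of "e i"] by (simp add: A eigenvalue_quadratic_form[OF e])
    then show ?thesis using power_mono[of "\<bar>w i\<bar>" c 2] by simp
  qed
  have "norm (A *v x) \<le> c * norm x" for x
  proof -
    have "(norm (A *v x))\<^sup>2 = (\<Sum>i\<in>UNIV. (w i)\<^sup>2 * (x \<bullet> e i)\<^sup>2)"
      unfolding norm_orthonormal_family[OF e, of "A *v x"] by (simp add: A inner_eigen_matrix[OF e] power_mult_distrib)
    also have "\<dots> \<le> (\<Sum>i\<in>UNIV. c\<^sup>2 * (x \<bullet> e i)\<^sup>2)" by (intro sum_mono mult_right_mono w) auto
    also have "\<dots> = (c * norm x)\<^sup>2"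
      by (simp add: norm_orthonormal_family[OF e, of x] power_mult_distrib sum_distrib_left)
    finally show ?thesis by (rule power2_le_imp_le) (use c in simp)
  qed
  then show ?thesis unfolding spectral_norm_def by (rule onorm_le)
qed

lemma quadratic_form_le_spectral_norm: "x \<bullet> (A *v x) \<le> spectral_norm (A :: real ^ 'n ^ 'n) * (norm x)\<^sup>2"
proof -
  have "x \<bullet> (A *v x) \<le> norm x * norm (A *v x)" by (rule norm_cauchy_schwarz)
  also have "\<dots> \<le> norm x * (spectral_norm A * norm x)"
    unfolding spectral_norm_def by (intro mult_left_mono onorm matrix_vector_mul_bounded_linear) auto
  finally show ?thesis by (simp add: power2_eq_square mult_ac)
qed

section \<open>Covariance matrices through their quadratic forms\<close>

lemma outer_quadratic_form: "x \<bullet> (outer z *v x) = (z \<bullet> x)\<^sup>2"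
  by (simp add: outer_mult power2_eq_square inner_commute)

text \<open>The form \<open>v \<bullet> (A *v v)\<close> is a bounded linear functional of the
  matrix \<open>A\<close>, so it commutes with the matrix-valued Bochner integral.\<close>

lemma covariance_quadratic_form:
  fixes X :: "'a \<Rightarrow> real ^ 'n"
  assumes "integrable M (\<lambda>\<omega>. outer (X \<omega>))"
  shows "integrable M (\<lambda>\<omega>. (X \<omega> \<bullet> v)\<^sup>2)" and "(\<integral>\<omega>. (X \<omega> \<bullet> v)\<^sup>2 \<partial>M) = v \<bullet> (cov_matrix M X *v v)"
proof -
  have "linear (\<lambda>A :: real ^ 'n ^ 'n. v \<bullet> (A *v v))"
    by (auto intro!: linearI simp: matrix_vector_mult_add_rdistrib inner_add_right scaleR_matrix_vector_assoc[symmetric])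
  then have bl: "bounded_linear (\<lambda>A :: real ^ 'n ^ 'n. v \<bullet> (A *v v))" by (rule linear_conv_bounded_linear[THEN iffD1])
  show "integrable M (\<lambda>\<omega>. (X \<omega> \<bullet> v)\<^sup>2)"
    using integrable_bounded_linear[OF bl assms] by (simp add: outer_quadratic_form)
  show "(\<integral>\<omega>. (X \<omega> \<bullet> v)\<^sup>2 \<partial>M) = v \<bullet> (cov_matrix M X *v v)"
    using integral_bounded_linear[OF bl assms] by (simp add: outer_quadratic_form cov_matrix_def)
qed

lemma transpose_cov_matrix:
  fixes X :: "'a \<Rightarrow> real ^ 'n"
  assumes "integrable M (\<lambda>\<omega>. outer (X \<omega>))"
  shows "transpose (cov_matrix M X) = cov_matrix M X"
proof -
  have "linear (transpose :: real ^ 'n ^ 'n \<Rightarrow> _)"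
    by (intro linearI transpose_add transpose_scaleR)
  then have "bounded_linear (transpose :: real ^ 'n ^ 'n \<Rightarrow> _)" by (rule linear_conv_bounded_linear[THEN iffD1])
  from integral_bounded_linear[OF this assms] show ?thesis by (simp add: cov_matrix_def transpose_outer)
qed

lemma sample_cov_quadratic_form: "v \<bullet> (sample_cov N Y \<omega> *v v) = (\<Sum>i=1..N. (Y i \<omega> \<bullet> v)\<^sup>2) / real N"
  by (simp add: sample_cov_def scaleR_matrix_vector_assoc[symmetric] matrix_vector_mult_sum inner_sum_right outer_quadratic_form)

lemma transpose_sample_cov: "transpose (sample_cov N Y \<omega>) = sample_cov N Y \<omega>"
  by (simp add: sample_cov_def transpose_scaleR transpose_sum transpose_outer)

text \<open>Links the hypothesis on projection matrices to the coordinate form of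
  \<open>regular\<close>. An inequality for the rank suffices, since a smaller rank only lowers the
  threshold for \<open>t\<close>.\<close>

lemma coordinate_projection:
  fixes e :: "'n \<Rightarrow> real ^ 'n"
  assumes e: "orthonormal_family e"
  obtains P :: "real ^ 'n ^ 'n" where "orthogonal_projection P" "rank P \<le> card S"
    "\<And>x. (norm (P *v x))\<^sup>2 = (\<Sum>i\<in>S. (x \<bullet> e i)\<^sup>2)"
proof
  define P where "P = eigen_matrix e (indicator S)"
  show "orthogonal_projection P"
    unfolding orthogonal_projection_def P_def transpose_eigen_matrix eigen_matrix_compose[OF e]
    by (auto intro!: arg_cong[where f = "eigen_matrix e"] simp: indicator_def)
  have P: "P *v x = (\<Sum>i\<in>S. (x \<bullet> e i) *\<^sub>R e i)" for x
  proof -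
    have "P *v x = (\<Sum>i\<in>UNIV. if i \<in> S then (x \<bullet> e i) *\<^sub>R e i else 0)"
      unfolding P_def eigen_matrix_mult by (intro sum.cong) (auto simp: indicator_def)
    then show ?thesis by (simp add: sum.If_cases)
  qed
  have "range ((*v) P) \<subseteq> span (e ` S)"
    by (auto simp: P intro!: span_sum span_scale intro: span_base)
  then have "dim (range ((*v) P)) \<le> card (e ` S)" by (intro dim_le_card) auto
  also have "\<dots> \<le> card S" by (rule card_image_le) simp
  finally show "rank P \<le> card S" by (simp add: rank_dim_range)
  show "(norm (P *v x))\<^sup>2 = (\<Sum>i\<in>S. (x \<bullet> e i)\<^sup>2)" for x
  proof -
    have "(norm (P *v x))\<^sup>2 = (\<Sum>i\<in>UNIV. if i \<in> S then (x \<bullet> e i)\<^sup>2 else 0)"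
      unfolding norm_orthonormal_family[OF e, of "P *v x"] unfolding P_def inner_eigen_matrix[OF e]
      by (intro sum.cong) (auto simp: indicator_def)
    then show ?thesis by (simp add: sum.If_cases)
  qed
qed

text \<open>Conjugation by the square root \<open>G\<close> of \<Sigma> carries the isotropic
  estimate over to \<open>X\<close>: the form of the error at \<open>v\<close> is the isotropic
  error form at \<open>G *v v\<close>, and
  \<open>(norm (G *v v))\<^sup>2 = v \<bullet> (\<Sigma> *v v)\<close> brings in
  \<open>spectral_norm \<Sigma>\<close>. The condition number of \<Sigma> therefore does not
  enter.\<close>

theorem corollary1p2:
  fixes M :: "'a measure" and X :: "'a \<Rightarrow> real ^ 'n"
    and M' :: "'b measure" and Y :: "nat \<Rightarrow> 'b \<Rightarrow> real ^ 'n"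
    and C \<eta> \<epsilon> :: real and N :: nat
  defines "\<Sigma> \<equiv> cov_matrix M X"
  defines "Z \<equiv> (\<lambda>\<omega>. matrix_inv (matrix_sqrt \<Sigma>) *v X \<omega>)"
  defines "C_main \<equiv> 512 * (48 * C) powr (2 + 2 / \<eta>) * (6 + 6 / \<eta>) powr (1 + 4 / \<eta>)"
  assumes "prob_space M" and "X \<in> borel_measurable M"
    and "integrable M (\<lambda>\<omega>. outer (X \<omega>))" and "invertible \<Sigma>"
    and "C > 0" and "\<eta> > 0"
    and "\<And>P t. orthogonal_projection P \<Longrightarrow> t > C * real (rank P) \<Longrightarrow>
           measure M {\<omega> \<in> space M. (norm (P *v Z \<omega>))\<^sup>2 > t} \<le> C * t powr (- 1 - \<eta>)"
    and "0 < \<epsilon>" and "\<epsilon> < 1"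
    and "N > 0" and "real N \<ge> C_main * \<epsilon> powr (- 2 - 2 / \<eta>) * real CARD('n)"
    and "prob_space M'"
    and "prob_space.indep_vars M' (\<lambda>_. borel) Y {1..N}"
    and "\<And>i. i \<in> {1..N} \<Longrightarrow> distr M' borel (Y i) = distr M borel X"
  shows "integrable M' (\<lambda>\<omega>. spectral_norm (sample_cov N Y \<omega> - \<Sigma>))
    \<and> (\<integral>\<omega>. spectral_norm (sample_cov N Y \<omega> - \<Sigma>) \<partial>M') \<le> \<epsilon> * spectral_norm \<Sigma>"
proof -
  note X_int = assms(6) and tail = assms(10)
  interpret M: prob_space M by fact
  interpret M': prob_space M' by fact
  have [measurable]: "X \<in> borel_measurable M" by fact
  have Ym [measurable]: "Y i \<in> borel_measurable M'" if "i \<in> {1..N}" for i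
    using assms(16) that unfolding M'.indep_vars_def2 by blast
  have "transpose \<Sigma> = \<Sigma>" unfolding \<Sigma>_def by (rule transpose_cov_matrix[OF X_int])
  then obtain e w where e: "orthonormal_family e" and \<Sigma>: "\<Sigma> = eigen_matrix e w"
    by (rule spectral_theorem_symmetric)
  have w: "0 < w i" for i
  proof -
    have "w i = (\<integral>\<omega>. (X \<omega> \<bullet> e i)\<^sup>2 \<partial>M)"
      using covariance_quadratic_form(2)[OF X_int, of "e i"] eigenvalue_quadratic_form[OF e, of i w]
      unfolding \<Sigma>_def[symmetric] \<Sigma> by simp
    then have "0 \<le> w i" by simp
    moreover have "w i \<noteq> 0"
    proof
      assume "w i = 0"
      then have "\<Sigma> *v e i = 0" by (simp add: \<Sigma> eigen_matrix_eigenvector[OF e])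
      moreover obtain B where "B ** \<Sigma> = mat 1" using assms(7) unfolding invertible_def by blast
      then have "B *v (\<Sigma> *v e i) = e i" by (simp add: matrix_vector_mul_assoc)
      ultimately have "e i = 0" by simp
      then show False using e unfolding orthonormal_family_def by (metis inner_zero_left zero_neq_one)
    qed
    ultimately show ?thesis by simp
  qed
  \<comment> \<open>Explicit square root and inverse square root in the eigenbasis; uniqueness
    identifies them with \<open>matrix_sqrt\<close> and \<open>matrix_inv\<close>.\<close>
  define G where "G = eigen_matrix e (\<lambda>i. sqrt (w i))"
  define J where "J = eigen_matrix e (\<lambda>i. 1 / sqrt (w i))"
  have w_sqrt: "sqrt (w i) * sqrt (w i) = w i" "sqrt (w i) \<noteq> 0" for i using w[of i] by simp_all
  have GG: "G ** G = \<Sigma>" unfolding G_def eigen_matrix_compose[OF e] w_sqrt(1) \<Sigma> ..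
  have GJ: "G ** J = mat 1"
    by (simp add: G_def J_def eigen_matrix_compose[OF e] w_sqrt(2) eigen_matrix_one[OF e] del: real_sqrt_eq_0_iff)
  have symG: "transpose G = G" and symJ: "transpose J = J"
    by (simp_all add: G_def J_def transpose_eigen_matrix)
  have "pos_semidef G"
    unfolding pos_semidef_def
    using w by (auto simp: symG) (auto simp: G_def quadratic_eigen_matrix[OF e] less_imp_le intro!: sum_nonneg)
  then have "matrix_sqrt \<Sigma> = G" using GG by (rule matrix_sqrt_eqI)
  then have Z: "Z = (\<lambda>\<omega>. J *v X \<omega>)" unfolding Z_def using matrix_inv_eqI[OF GJ] by simp
  have [measurable]: "(*v) J \<in> borel_measurable borel"
    by (intro borel_measurable_continuous_onI matrix_vector_mult_linear_continuous_on)
  have [measurable]: "Z \<in> borel_measurable M" unfolding Z by measurable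
  have Zv: "Z \<omega> \<bullet> v = X \<omega> \<bullet> (J *v v)" for \<omega> v unfolding Z by (rule symmetric_matrix_inner[OF symJ])
  have iso: "(J *v v) \<bullet> (\<Sigma> *v (J *v v)) = (norm v)\<^sup>2" for v
  proof -
    have "(J *v v) \<bullet> (\<Sigma> *v (J *v v)) = (G *v (J *v v)) \<bullet> (G *v (J *v v))"
      unfolding GG[symmetric] matrix_vector_mul_assoc[symmetric] by (rule symmetric_matrix_inner[OF symG, symmetric])
    also have "G *v (J *v v) = v" by (simp add: matrix_vector_mul_assoc GJ)
    finally show ?thesis by (simp add: power2_norm_eq_inner)
  qed
  define L where "L = distr M borel Z"
  interpret L: regular_isotropic L C \<eta>
  proof (intro regular_isotropic.intro regular_isotropic_axioms.intro)
    show "prob_space L" unfolding L_def by (rule M.prob_space_distr) measurable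
    show "sets L = sets borel" by (simp add: L_def)
    show "0 < C" by fact
    show "0 < \<eta>" by fact
    have "integrable M (\<lambda>\<omega>. (norm (Z \<omega>))\<^sup>2)"
      unfolding norm_orthonormal_family[OF e, of "Z _"] Zv
      by (intro Bochner_Integration.integrable_sum covariance_quadratic_form(1)[OF X_int])
    then show "integrable L (\<lambda>x. (norm x)\<^sup>2)" unfolding L_def by (subst integrable_distr_eq) auto
    show "(\<integral>x. (x \<bullet> v)\<^sup>2 \<partial>L) = (norm v)\<^sup>2" for v
    proof -
      have "(\<integral>x. (x \<bullet> v)\<^sup>2 \<partial>L) = (\<integral>\<omega>. (Z \<omega> \<bullet> v)\<^sup>2 \<partial>M)" unfolding L_def by (subst integral_distr) auto
      then show ?thesis unfolding Zv covariance_quadratic_form(2)[OF X_int] \<Sigma>_def[symmetric] iso .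
    qed
    show "measure L {x \<in> space L. t < (\<Sum>i\<in>S. (x \<bullet> f i)\<^sup>2)} \<le> C * t powr (- 1 - \<eta>)"
      if f: "orthonormal_family f" and t: "C * real (card S) < t" for f S t
    proof -
      obtain P :: "real ^ 'n ^ 'n" where P: "orthogonal_projection P" "rank P \<le> card S"
        "\<And>x. (norm (P *v x))\<^sup>2 = (\<Sum>i\<in>S. (x \<bullet> f i)\<^sup>2)" using coordinate_projection[OF f] by blast
      have "C * real (rank P) \<le> C * real (card S)" using P(2) \<open>C > 0\<close> by (intro mult_left_mono) auto
      then have "C * real (rank P) < t" using t by simp
      moreover have "measure L {x \<in> space L. t < (\<Sum>i\<in>S. (x \<bullet> f i)\<^sup>2)} = measure M {\<omega> \<in> space M. t < (norm (P *v Z \<omega>))\<^sup>2}"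
        unfolding P(3) L_def by (subst measure_distr) (auto intro!: arg_cong[where f = "measure M"])
      ultimately show ?thesis using tail[OF P(1)] by simp
    qed
  qed
  define W where "W i \<omega> = J *v Y i \<omega>" for i \<omega>
  have W_ind: "M'.indep_vars (\<lambda>_. borel) W {1..N}"
    unfolding W_def using M'.indep_vars_compose2[OF assms(16), of "\<lambda>_. (*v) J" "\<lambda>_. borel"] by simp
  have W_dist: "distr M' borel (W i) = L" if "i \<in> {1..N}" for i
  proof -
    have "distr M' borel (W i) = distr (distr M' borel (Y i)) borel ((*v) J)"
      using Ym[OF that] by (subst distr_distr) (auto simp: W_def[abs_def] comp_def)
    also have "\<dots> = L" unfolding assms(17)[OF that] L_def Z
      by (subst distr_distr) (auto simp: comp_def)
    finally show ?thesis .
  qed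
  define a where "a \<omega> = rayleigh_sup (sample_cov N W \<omega> - mat 1)" for \<omega>
  define b where "b \<omega> = rayleigh_sup (mat 1 - sample_cov N W \<omega>)" for \<omega>
  note iso_bound = L.isotropic_sample_covariance[OF assms(15) W_ind W_dist assms(11,12,13) assms(14)[unfolded C_main_def], folded a_def b_def]
  have max_int: "integrable M' (\<lambda>\<omega>. max (a \<omega>) (b \<omega>))" using iso_bound(1,2) by simp
  have GW: "G *v W i \<omega> = Y i \<omega>" for i \<omega> by (simp add: W_def matrix_vector_mul_assoc GJ)
  have pw: "spectral_norm (sample_cov N Y \<omega> - \<Sigma>) \<le> max (a \<omega>) (b \<omega>) * spectral_norm \<Sigma>" for \<omega>
  proof -
    define D where "D = sample_cov N W \<omega> - mat 1"
    define m where "m = max (a \<omega>) (b \<omega>)"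
    have Dq: "\<bar>v \<bullet> (D *v v)\<bar> \<le> m * (norm v)\<^sup>2" for v
    proof -
      have "v \<bullet> (D *v v) \<le> a \<omega> * (norm v)\<^sup>2" unfolding D_def a_def by (rule quadratic_form_le_rayleigh_sup)
      also have "\<dots> \<le> m * (norm v)\<^sup>2" by (intro mult_right_mono) (auto simp: m_def)
      finally have 1: "v \<bullet> (D *v v) \<le> m * (norm v)\<^sup>2" .
      have "- (v \<bullet> (D *v v)) = v \<bullet> ((mat 1 - sample_cov N W \<omega>) *v v)"
        by (simp add: D_def matrix_vector_mult_diff_rdistrib inner_diff_right)
      also have "\<dots> \<le> b \<omega> * (norm v)\<^sup>2" unfolding b_def by (rule quadratic_form_le_rayleigh_sup)
      also have "\<dots> \<le> m * (norm v)\<^sup>2" by (intro mult_right_mono) (auto simp: m_def)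
      finally show ?thesis using 1 by (simp add: abs_le_iff)
    qed
    \<comment> \<open>Either of \<open>a \<omega>\<close> and \<open>b \<omega>\<close> may be
      negative, but their maximum bounds an absolute value at a unit vector.\<close>
    have "norm (e k) = 1" for k using e by (simp add: orthonormal_family_def norm_eq_1)
    then have m0: "0 \<le> m" using Dq[of "e undefined"] by simp
    have q: "v \<bullet> ((sample_cov N Y \<omega> - \<Sigma>) *v v) = (G *v v) \<bullet> (D *v (G *v v))" for v
    proof -
      have "Y i \<omega> \<bullet> v = W i \<omega> \<bullet> (G *v v)" for i
        unfolding GW[symmetric] by (rule symmetric_matrix_inner[OF symG])
      then have "v \<bullet> (sample_cov N Y \<omega> *v v) = (G *v v) \<bullet> (sample_cov N W \<omega> *v (G *v v))"
        unfolding sample_cov_quadratic_form by simp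
      moreover have "v \<bullet> (\<Sigma> *v v) = (G *v v) \<bullet> (G *v v)"
        unfolding GG[symmetric] matrix_vector_mul_assoc[symmetric] by (rule symmetric_matrix_inner[OF symG, symmetric])
      ultimately show ?thesis by (simp add: D_def matrix_vector_mult_diff_rdistrib inner_diff_right)
    qed
    show ?thesis
      unfolding m_def[symmetric]
    proof (rule spectral_norm_symmetric_le)
      show "transpose (sample_cov N Y \<omega> - \<Sigma>) = sample_cov N Y \<omega> - \<Sigma>"
        by (simp add: transpose_diff transpose_sample_cov \<open>transpose \<Sigma> = \<Sigma>\<close>)
      show "0 \<le> m * spectral_norm \<Sigma>" using m0 spectral_norm_nonneg by (rule mult_nonneg_nonneg)
      show "\<bar>v \<bullet> ((sample_cov N Y \<omega> - \<Sigma>) *v v)\<bar> \<le> m * spectral_norm \<Sigma> * (norm v)\<^sup>2" for v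
      proof -
        have "\<bar>v \<bullet> ((sample_cov N Y \<omega> - \<Sigma>) *v v)\<bar> \<le> m * (norm (G *v v))\<^sup>2" unfolding q by (rule Dq)
        also have "(norm (G *v v))\<^sup>2 = v \<bullet> (\<Sigma> *v v)"
          unfolding power2_norm_eq_inner GG[symmetric] matrix_vector_mul_assoc[symmetric]
          by (rule symmetric_matrix_inner[OF symG])
        also have "m * \<dots> \<le> m * (spectral_norm \<Sigma> * (norm v)\<^sup>2)"
          by (intro mult_left_mono quadratic_form_le_spectral_norm m0)
        finally show ?thesis by (simp add: mult.assoc)
      qed
    qed
  qed
  have [measurable]: "sample_cov N Y \<in> borel_measurable M'" unfolding sample_cov_def by measurable
  have norm_int: "integrable M' (\<lambda>\<omega>. spectral_norm (sample_cov N Y \<omega> - \<Sigma>))"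
  proof (rule Bochner_Integration.integrable_bound)
    show "integrable M' (\<lambda>\<omega>. max (a \<omega>) (b \<omega>) * spectral_norm \<Sigma>)" using max_int by simp
    show "AE \<omega> in M'. norm (spectral_norm (sample_cov N Y \<omega> - \<Sigma>)) \<le> norm (max (a \<omega>) (b \<omega>) * spectral_norm \<Sigma>)"
      unfolding real_norm_def abs_of_nonneg[OF spectral_norm_nonneg] by (intro AE_I2 order_trans[OF pw abs_ge_self])
  qed measurable
  have "(\<integral>\<omega>. spectral_norm (sample_cov N Y \<omega> - \<Sigma>) \<partial>M') \<le> (\<integral>\<omega>. max (a \<omega>) (b \<omega>) * spectral_norm \<Sigma> \<partial>M')"
    using norm_int max_int pw by (intro integral_mono) auto
  also have "\<dots> = (\<integral>\<omega>. max (a \<omega>) (b \<omega>) \<partial>M') * spectral_norm \<Sigma>" by simp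
  also have "\<dots> \<le> \<epsilon> * spectral_norm \<Sigma>"
    by (intro mult_right_mono iso_bound(3) spectral_norm_nonneg)
  finally show ?thesis using norm_int by blast
qed

end
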